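(* The function $S(\gamma;x,\lambda)$ is a simultaneous eigenfunction of the two Askey-Wilson type second order difference operators $\mathcal{L}_\gamma^x$ and $\widetilde{\mathcal{L}}_\gamma^x$, with eigenvalues $v(w_1,w_2,\gamma;\lambda)$ and $v(w_2,w_1,\gamma;\lambda)$ respectively: $$\mathcal{L}_\gamma^xS(\gamma;x,\lambda)=v(w_1,w_2,\gamma;\lambda)S(\gamma;x,\lambda),\qquad \widetilde{\mathcal{L}}_\gamma^xS(\gamma;x,\lambda)=v(w_2,w_1,\gamma;\lambda)S(\gamma;x,\lambda).$$
   Context: Convention: $\pm$ inside the argument of a function means a product over both signs, e.g. $f(z\pm a)=f(z+a)f(z-a)$; square roots are the principal branch. $\mathbb{C}_+=\{z\in\mathbb{C}:\Re(z)>0\}$; for $w_1,w_2\in\mathbb{C}_+$ set $w=(w_1+w_2)/2$. Hyperbolic gamma function: for $|\Im(z)|<\Re(w)$, $G(z)=G(w_1,w_2;z)=\exp\Big(i\int_0^\infty\Big(\frac{\sin(2yz)}{2\sinh(w_1y)\sinh(w_2y)}-\frac{z}{w_1w_2y}\Big)\frac{dy}{y}\Big)$, continued meromorphically to $z\in\mathbb{C}$ by $G(z+iw_1/2)=2\cosh(\pi z/w_2)G(z-iw_1/2)$ and $G(z+iw_2/2)=2\cosh(\pi z/w_1)G(z-iw_2/2)$. Parameters: $\gamma=(\gamma_0,\gamma_1,\gamma_2,\gamma_3)\in\mathbb{C}^4$ corresponds to $(\rho,\sigma,\tau,\upsilon)\in\mathbb{C}^4$ via $\gamma_0=-\rho+\sigma$,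 $\gamma_1=\rho+\sigma$, $\gamma_2=-\tau-\upsilon$, $\gamma_3=\tau-\upsilon$. Dual parameters $\hat\gamma$: $\hat\gamma_0=\frac12(\gamma_0+\gamma_1+\gamma_2+\gamma_3)$, $\hat\gamma_1=\frac12(\gamma_0+\gamma_1-\gamma_2-\gamma_3)$, $\hat\gamma_2=\frac12(\gamma_0-\gamma_1+\gamma_2-\gamma_3)$, $\hat\gamma_3=\frac12(\gamma_0-\gamma_1-\gamma_2+\gamma_3)$. The function $S$: let $\xi=\max(|\Re\rho|,|\Re\sigma|,|\Re\tau|,|\Re\upsilon|)$ and $\zeta=w/2-\xi-|\Im(\lambda/2)|$. For $w_1,w_2>0$, $\zeta>0$, $|\Im x|<\zeta$ put $$\psi(\gamma;x,\lambda)=\int_{\mathbb{R}}\frac{G(z+x+\lambda/2-iw/2\pm i\tau)\,G(z-\lambda/2-iw/2\pm i\sigma)}{G(z+x-\lambda/2+iw/2\pm i\rho)\,G(z+\lambda/2+iw/2\pm i\upsilon)}\,dz ;$$ $\psi$ extends to a meromorphic function on $\mathcal{O}=\{(w_1,w_2,\rho,\sigma,\tau,\upsilon,x,\lambda)\in\mathbb{C}_+^2\times\mathbb{C}^6\}$. With $\Delta(\gamma;x)=\frac{G(x+i\gamma_2)G(x+i\gamma_3)}{G(x-i\gamma_0)G(x-i\gamma_1)}$ and $N(\gamma)=\prod_{j=1}^3G(i\gamma_0+i\gamma_j+iw)$, define the meromorphic function on $\mathcal{O}$ $$S(\gamma;x,\lambda)=\frac{N(\gamma)\,\psi(\gamma;x,\lambda)}{\sqrt{w_1w_2}\,\Delta(\gamma;x)\,\Delta(\hat\gamma;\lambda)}.$$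 Askey-Wilson operator: with $$A(w_1,w_2,\gamma;x)=\frac{\prod_{j=0}^3\big(1-e^{2\pi(iw+i\gamma_j+x)/w_2}\big)}{(1-e^{4\pi x/w_2})(1-e^{4\pi(x+iw)/w_2})},$$ $$\mathcal{L}_\gamma^xf(x)=A(w_1,w_2,\gamma;x)\big(f(x+iw_1)-f(x)\big)+A(w_1,w_2,\gamma;-x)\big(f(x-iw_1)-f(x)\big),$$ and $\widetilde{\mathcal{L}}_\gamma^x$ is the same operator with $w_1$ and $w_2$ interchanged. The eigenvalue is $$v(w_1,w_2,\gamma;\lambda)=-2e^{\pi iw_1/w_2+2\pi i\hat\gamma_0/w_2}\Big(\cosh(2\pi\lambda/w_2)+\cosh(\pi iw_1/w_2+2\pi i\hat\gamma_0/w_2)\Big).$$ Identities are between meromorphic functions. *)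

theory Defs
  imports "HOL-Complex_Analysis.Complex_Analysis"
begin

text \<open>Holomorphic and meromorphic functions of several complex variables, on open subsets of
  \<open>complex ^ 'n\<close>.  A meromorphic function is represented by a total function whose values on the
  thin set where the local denominator \<open>g\<close> vanishes are irrelevant.\<close>

definition mv_holomorphic_on :: "(complex ^ 'n \<Rightarrow> complex) \<Rightarrow> (complex ^ 'n) set \<Rightarrow> bool" where
  "mv_holomorphic_on f U \<longleftrightarrow>
     (\<forall>p\<in>U. \<exists>f'. (f has_derivative f') (at p) \<and> (\<forall>c v. f' (c *s v) = c * f' v))"

definition mv_meromorphic_on :: "(complex ^ 'n \<Rightarrow> complex) \<Rightarrow> (complex ^ 'n) set \<Rightarrow> bool" where
  "mv_meromorphic_on f D \<longleftrightarrow>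
     (\<forall>p\<in>D. \<exists>U g h. open U \<and> p \<in> U \<and> U \<subseteq> D \<and>
        mv_holomorphic_on g U \<and> mv_holomorphic_on h U \<and>
        U \<subseteq> closure {q \<in> U. g q \<noteq> 0} \<and>
        (\<forall>q\<in>U. g q \<noteq> 0 \<longrightarrow> f q = h q / g q))"

text \<open>Equality of meromorphic functions on \<open>D\<close>: the representatives agree on a dense open
  subset.\<close>

definition mv_mero_eq_on ::
  "(complex ^ 'n) set \<Rightarrow> (complex ^ 'n \<Rightarrow> complex) \<Rightarrow> (complex ^ 'n \<Rightarrow> complex) \<Rightarrow> bool" where
  "mv_mero_eq_on D f g \<longleftrightarrow>
     (\<exists>U. open U \<and> U \<subseteq> D \<and> D \<subseteq> closure U \<and> (\<forall>p\<in>U. f p = g p))"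

text \<open>Functions of \<open>(w\<^sub>1, w\<^sub>2, \<rho>, \<sigma>, \<tau>, \<upsilon>, x, l)\<close>, where \<open>l\<close> is the spectral variable \<open>\<lambda>\<close>,
  regarded as functions on \<open>complex ^ 8\<close>.\<close>

type_synonym fun8 =
  "complex \<Rightarrow> complex \<Rightarrow> complex \<Rightarrow> complex \<Rightarrow> complex \<Rightarrow> complex \<Rightarrow> complex \<Rightarrow> complex \<Rightarrow> complex"

definition on_vec8 :: "fun8 \<Rightarrow> complex ^ 8 \<Rightarrow> complex" where
  "on_vec8 F p = F (p $ 1) (p $ 2) (p $ 3) (p $ 4) (p $ 5) (p $ 6) (p $ 7) (p $ 8)"

definition param_domain :: "(complex ^ 8) set" where
  "param_domain = {p. Re (p $ 1) > 0 \<and> Re (p $ 2) > 0}"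

definition wmean :: "complex \<Rightarrow> complex \<Rightarrow> complex" where
  "wmean w1 w2 = (w1 + w2) / 2"

text \<open>The hyperbolic gamma function: the unique meromorphic function that is given by the integral
  on the strip and satisfies the two difference equations.  The condition
  \<open>nicely_meromorphic_on\<close> makes it continuous off its poles and \<open>0\<close> at its poles.\<close>

definition hyp_gamma_strip :: "complex \<Rightarrow> complex \<Rightarrow> complex \<Rightarrow> complex" where
  "hyp_gamma_strip w1 w2 z =
     exp (\<i> * (LBINT y:{0<..}.
       (sin (2 * of_real y * z) / (2 * sinh (w1 * of_real y) * sinh (w2 * of_real y))
          - z / (w1 * w2 * of_real y)) / of_real y))"

definition hyp_gamma :: "complex \<Rightarrow> complex \<Rightarrow> complex \<Rightarrow> complex" where
  "hyp_gamma w1 w2 =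
     (THE G. G nicely_meromorphic_on UNIV \<and>
        (\<forall>z. \<bar>Im z\<bar> < Re (wmean w1 w2) \<longrightarrow> G z = hyp_gamma_strip w1 w2 z) \<and>
        (\<forall>\<^sub>\<approx>z. G (z + \<i> * w1 / 2) = 2 * cosh (of_real pi * z / w2) * G (z - \<i> * w1 / 2)) \<and>
        (\<forall>\<^sub>\<approx>z. G (z + \<i> * w2 / 2) = 2 * cosh (of_real pi * z / w1) * G (z - \<i> * w2 / 2)))"

text \<open>Parameter vectors \<open>\<gamma> = (\<gamma>\<^sub>0, \<gamma>\<^sub>1, \<gamma>\<^sub>2, \<gamma>\<^sub>3)\<close> are functions of the index; only the indices
  \<open>0, 1, 2, 3\<close> are ever used.\<close>

definition gamma_par :: "complex \<Rightarrow> complex \<Rightarrow> complex \<Rightarrow> complex \<Rightarrow> nat \<Rightarrow> complex" where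
  "gamma_par \<rho> \<sigma> \<tau> \<upsilon> j = [- \<rho> + \<sigma>, \<rho> + \<sigma>, - \<tau> - \<upsilon>, \<tau> - \<upsilon>] ! j"

definition dual_par :: "(nat \<Rightarrow> complex) \<Rightarrow> nat \<Rightarrow> complex" where
  "dual_par \<gamma> j =
     [(\<gamma> 0 + \<gamma> 1 + \<gamma> 2 + \<gamma> 3) / 2, (\<gamma> 0 + \<gamma> 1 - \<gamma> 2 - \<gamma> 3) / 2,
      (\<gamma> 0 - \<gamma> 1 + \<gamma> 2 - \<gamma> 3) / 2, (\<gamma> 0 - \<gamma> 1 - \<gamma> 2 + \<gamma> 3) / 2] ! j"

definition psi_integral :: fun8 where
  "psi_integral w1 w2 \<rho> \<sigma> \<tau> \<upsilon> x l =
     (let G = hyp_gamma w1 w2; w = wmean w1 w2 in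
      LBINT t.
        (let z = complex_of_real t in
           (G (z + x + l / 2 - \<i> * w / 2 + \<i> * \<tau>) * G (z + x + l / 2 - \<i> * w / 2 - \<i> * \<tau>) *
            (G (z - l / 2 - \<i> * w / 2 + \<i> * \<sigma>) * G (z - l / 2 - \<i> * w / 2 - \<i> * \<sigma>))) /
           (G (z + x - l / 2 + \<i> * w / 2 + \<i> * \<rho>) * G (z + x - l / 2 + \<i> * w / 2 - \<i> * \<rho>) *
            (G (z + l / 2 + \<i> * w / 2 + \<i> * \<upsilon>) * G (z + l / 2 + \<i> * w / 2 - \<i> * \<upsilon>)))))"

definition zeta_bound ::
  "complex \<Rightarrow> complex \<Rightarrow> complex \<Rightarrow> complex \<Rightarrow> complex \<Rightarrow> complex \<Rightarrow> complex \<Rightarrow> real" where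
  "zeta_bound w1 w2 \<rho> \<sigma> \<tau> \<upsilon> l =
     Re (wmean w1 w2) / 2 - Max {\<bar>Re \<rho>\<bar>, \<bar>Re \<sigma>\<bar>, \<bar>Re \<tau>\<bar>, \<bar>Re \<upsilon>\<bar>} - \<bar>Im (l / 2)\<bar>"

text \<open>\<open>\<psi>\<close> is the meromorphic extension to \<open>param_domain\<close> of the integral, which is only given for
  \<^emph>\<open>real\<close> positive \<open>w\<^sub>1, w\<^sub>2\<close>.  That set is a uniqueness set for meromorphic functions on
  \<open>param_domain\<close>, so the extension is unique as a meromorphic function.\<close>

definition is_psi :: "fun8 \<Rightarrow> bool" where
  "is_psi \<psi> \<longleftrightarrow>
     mv_meromorphic_on (on_vec8 \<psi>) param_domain \<and>
     (\<forall>w1 w2 :: real. \<forall>\<rho> \<sigma> \<tau> \<upsilon> x l.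
        w1 > 0 \<and> w2 > 0 \<and> zeta_bound w1 w2 \<rho> \<sigma> \<tau> \<upsilon> l > 0 \<and>
        \<bar>Im x\<bar> < zeta_bound w1 w2 \<rho> \<sigma> \<tau> \<upsilon> l \<longrightarrow>
        \<psi> w1 w2 \<rho> \<sigma> \<tau> \<upsilon> x l = psi_integral w1 w2 \<rho> \<sigma> \<tau> \<upsilon> x l)"

definition Delta_fun :: "complex \<Rightarrow> complex \<Rightarrow> (nat \<Rightarrow> complex) \<Rightarrow> complex \<Rightarrow> complex" where
  "Delta_fun w1 w2 \<gamma> x =
     (let G = hyp_gamma w1 w2 in
      (G (x + \<i> * \<gamma> 2) * G (x + \<i> * \<gamma> 3)) / (G (x - \<i> * \<gamma> 0) * G (x - \<i> * \<gamma> 1)))"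

definition N_fun :: "complex \<Rightarrow> complex \<Rightarrow> (nat \<Rightarrow> complex) \<Rightarrow> complex" where
  "N_fun w1 w2 \<gamma> = (\<Prod>j=1..3. hyp_gamma w1 w2 (\<i> * \<gamma> 0 + \<i> * \<gamma> j + \<i> * wmean w1 w2))"

definition S_fun :: "fun8 \<Rightarrow> fun8" where
  "S_fun \<psi> w1 w2 \<rho> \<sigma> \<tau> \<upsilon> x l =
     (let \<gamma> = gamma_par \<rho> \<sigma> \<tau> \<upsilon> in
      (N_fun w1 w2 \<gamma> * \<psi> w1 w2 \<rho> \<sigma> \<tau> \<upsilon> x l) /
      (csqrt (w1 * w2) * Delta_fun w1 w2 \<gamma> x * Delta_fun w1 w2 (dual_par \<gamma>) l))"

definition AW_coeff :: "complex \<Rightarrow> complex \<Rightarrow> (nat \<Rightarrow> complex) \<Rightarrow> complex \<Rightarrow> complex" where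
  "AW_coeff w1 w2 \<gamma> x =
     (\<Prod>j=0..3. 1 - exp (2 * of_real pi * (\<i> * wmean w1 w2 + \<i> * \<gamma> j + x) / w2)) /
     ((1 - exp (4 * of_real pi * x / w2)) *
      (1 - exp (4 * of_real pi * (x + \<i> * wmean w1 w2) / w2)))"

text \<open>The second operator, with \<open>w\<^sub>1\<close> and \<open>w\<^sub>2\<close> interchanged, is \<open>AW_op w2 w1\<close>.\<close>

definition AW_op ::
  "complex \<Rightarrow> complex \<Rightarrow> (nat \<Rightarrow> complex) \<Rightarrow> (complex \<Rightarrow> complex) \<Rightarrow> complex \<Rightarrow> complex" where
  "AW_op w1 w2 \<gamma> f x =
     AW_coeff w1 w2 \<gamma> x * (f (x + \<i> * w1) - f x) +
     AW_coeff w1 w2 \<gamma> (- x) * (f (x - \<i> * w1) - f x)"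

definition AW_eigenvalue :: "complex \<Rightarrow> complex \<Rightarrow> (nat \<Rightarrow> complex) \<Rightarrow> complex \<Rightarrow> complex" where
  "AW_eigenvalue w1 w2 \<gamma> l =
     (let a = of_real pi * \<i> * w1 / w2 + 2 * of_real pi * \<i> * dual_par \<gamma> 0 / w2 in
      - 2 * exp a * (cosh (2 * of_real pi * l / w2) + cosh a))"

end

theory Submission
  imports Defs "HOL-Probability.Sinc_Integral"
begin

text \<open>The integrands of \<open>\<psi>\<close> at \<open>x + i w\<^sub>1\<close>, \<open>x\<close> and \<open>x - i w\<^sub>1\<close>, weighted by the coefficients of the
  Askey--Wilson equation gauged by \<open>\<Delta>\<close>, add up to \<open>M(z + i w\<^sub>1) - M(z)\<close>, where \<open>M\<close> is again a product of
  hyperbolic gamma functions times a Laurent polynomial of degree one in \<open>exp (2 \<pi> z / w\<^sub>2)\<close>.  If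
  \<open>w\<^sub>2\<close> is large compared with \<open>w\<^sub>1\<close> and the other parameters, no pole lies between the real line and
  its translate by \<open>i w\<^sub>1\<close>, so moving the contour gives the equation for the integral.  The parameters
  for which this works contain an open piece of a totally real subspace, which is a uniqueness
  set for meromorphic functions on the connected parameter domain, and so the equation holds for
  the meromorphic extension.  The equation for the second operator follows because \<open>G\<close>, and with it
  \<open>\<psi>\<close>, is symmetric in \<open>w\<^sub>1\<close> and \<open>w\<^sub>2\<close>.\<close>

section \<open>Differentiation under the integral sign\<close>

text \<open>The integral formula has to hold at x and at x +- i w1 at once. Since zeta <= w/2, this
  implies w1 < (w1 + w2)/4, that is w2 > 3 w1; the second operator would need w1 > 3 w2. Hence no
  region serves both equations directly, and the second one is obtained by symmetry. With w1, w2,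
  rho, sigma, tau, upsilon real and x, lambda purely imaginary, every G in the integrand has an
  argument t + i a with t and a real. There |G| is comparable to the power a/(w1 w2) of 2 cosh (pi
  t), so exponents in a quotient simply add up, and |a| alone decides whether poles or zeros are
  met. The quotient behind \<open>M\<close> decays at the rate 2 pi (1/w1 + 1/w2); a Laurent
  polynomial of degree one in exp (2 pi z / w2) uses up 2 pi / w2 of it and leaves 2 pi / w1. As
  \<open>hyp_gamma\<close> is a definite description, existence and uniqueness of G come before all
  this. Its difference equations rest on an integral representation of ln (2 cosh), derived from the
  Digamma function and the reflection formula.\<close>

lemma has_field_derivative_lebesgue_integral:
  fixes f f' :: "'a \<Rightarrow> complex \<Rightarrow> complex"
  assumes r: "r > 0"
    and deriv: "\<And>y z. y \<in> space M \<Longrightarrow> z \<in> ball z0 r \<Longrightarrow> (f y has_field_derivative f' y z) (at z)"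
    and meas [measurable]: "\<And>z. z \<in> ball z0 r \<Longrightarrow> (\<lambda>y. f y z) \<in> borel_measurable M"
    and g: "integrable M g"
    and bound: "\<And>y z. y \<in> space M \<Longrightarrow> z \<in> ball z0 r \<Longrightarrow> cmod (f y z) \<le> g y"
  shows "integrable M (\<lambda>y. f' y z0)"
    and "((\<lambda>z. \<integral>y. f y z \<partial>M) has_field_derivative (\<integral>y. f' y z0 \<partial>M)) (at z0)"
proof -
  have intf: "integrable M (\<lambda>y. f y z)" if "z \<in> ball z0 r" for z
    by (rule Bochner_Integration.integrable_bound[OF g]) (use that bound order_trans[OF _ abs_ge_self] in \<open>auto intro!: AE_I2 meas\<close>)
  have lip: "cmod (f y (z0 + h) - f y z0) \<le> 2 / r * g y * cmod h"
    if y: "y \<in> space M" and h: "cmod h < r / 2" for y h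
  proof -
    have hol: "f y holomorphic_on ball z0 r"
      using deriv[OF y] unfolding holomorphic_on_open[OF open_ball] by blast
    \<comment> \<open>Cauchy's inequality turns the bound on \<open>f\<close> into one on
      \<open>f'\<close> on a smaller disc; this dominates the difference quotients.\<close>
    have d: "cmod (f' y z) \<le> 2 / r * g y" if z: "z \<in> cball z0 (r / 2)" for z
    proof -
      have sub: "ball z (r / 2) \<subseteq> ball z0 r"
      proof
        fix x assume "x \<in> ball z (r / 2)"
        with z dist_triangle[of z0 x z] show "x \<in> ball z0 r" by auto
      qed
      have "z \<in> ball z0 r" using z r by auto
      have le: "cmod (f' y z) * \<rho> \<le> g y" if \<rho>: "0 < \<rho>" "\<rho> < r / 2" for \<rho>
      proof -
        have sub2: "cball z \<rho> \<subseteq> ball z0 r" using sub \<rho> by fastforce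
        have "cmod ((deriv ^^ 1) (f y) z) \<le> fact 1 * g y / \<rho> ^ 1"
        proof (rule Cauchy_inequality)
          show "f y holomorphic_on ball z \<rho>"
            using hol sub2 by (meson ball_subset_cball holomorphic_on_subset order_trans)
          show "continuous_on (cball z \<rho>) (f y)"
            using hol sub2 by (meson holomorphic_on_imp_continuous_on holomorphic_on_subset)
          show "cmod (f y x) \<le> g y" if "cmod (z - x) = \<rho>" for x
            using that sub2 by (intro bound y) (auto simp: dist_norm subset_eq)
        qed (use \<rho> in auto)
        moreover have "deriv (f y) z = f' y z"
          using deriv[OF y \<open>z \<in> ball z0 r\<close>] by (rule DERIV_imp_deriv)
        ultimately show ?thesis using \<rho> by (simp add: field_simps)
      qed
      \<comment> \<open>Cauchy's inequality wants closed discs inside the open ball, so it is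
        applied with radii below r/2, and the constant 2/r appears in the limit.\<close>
      have "((\<lambda>\<rho>. cmod (f' y z) * \<rho>) \<longlongrightarrow> cmod (f' y z) * (r / 2)) (at_left (r / 2))"
        by (intro tendsto_intros)
      moreover have "\<forall>\<^sub>F \<rho> in at_left (r / 2). cmod (f' y z) * \<rho> \<le> g y"
        using eventually_at_left_real[of 0 "r / 2"] r by (auto elim!: eventually_mono intro: le)
      ultimately have "cmod (f' y z) * (r / 2) \<le> g y"
        by (intro tendsto_upperbound) auto
      thus ?thesis using r by (simp add: field_simps)
    qed
    have "cmod (f y (z0 + h) - f y z0) \<le> (2 / r * g y) * cmod (z0 + h - z0)"
    proof (rule field_differentiable_bound)
      show "convex (cball z0 (r / 2))" by simp
      show "(f y has_field_derivative f' y z) (at z within cball z0 (r / 2))"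
        if "z \<in> cball z0 (r / 2)" for z
        using that r by (intro has_field_derivative_at_within[OF deriv[OF y]]) auto
    qed (use d h r in \<open>auto simp: dist_norm\<close>)
    thus ?thesis by simp
  qed
  have main: "integrable M (\<lambda>y. f' y z0) \<and>
      (\<lambda>i. ((\<integral>y. f y (z0 + X i) \<partial>M) - (\<integral>y. f y z0 \<partial>M)) / X i) \<longlonglongrightarrow> (\<integral>y. f' y z0 \<partial>M)"
    if X: "\<forall>i. X i \<in> UNIV - {0}" and X0: "X \<longlonglongrightarrow> 0" for X :: "nat \<Rightarrow> complex"
  proof -
    have "\<forall>\<^sub>F i in sequentially. cmod (X i) < r / 2"
      using tendstoD[OF X0, of "r / 2"] r by (simp add: dist_norm)
    then obtain N where N: "\<And>i. i \<ge> N \<Longrightarrow> cmod (X i) < r / 2"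
      by (auto simp: eventually_sequentially)
    \<comment> \<open>The tail of \<open>X\<close> stays within r/2 of 0, where the difference
      quotients are dominated.\<close>
    have X1: "(\<lambda>i. X (i + N)) \<longlonglongrightarrow> 0" using X0 by (rule LIMSEQ_ignore_initial_segment)
    have in_ball: "z0 + X (i + N) \<in> ball z0 r" for i
      using N[of "i + N"] r by (simp add: dist_norm)
    have lim: "(\<lambda>i. (f y (z0 + X (i + N)) - f y z0) / X (i + N)) \<longlonglongrightarrow> f' y z0" if "y \<in> space M" for y
    proof -
      have "((\<lambda>h. (f y (z0 + h) - f y z0) / h) \<longlongrightarrow> f' y z0) (at 0)"
        using deriv[OF that, of z0] r by (simp add: DERIV_def)
      thus ?thesis using X X1 by (auto simp: tendsto_at_iff_sequentially comp_def)
    qed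
    have meas1 [measurable]: "(\<lambda>y. (f y (z0 + X (i + N)) - f y z0) / X (i + N)) \<in> borel_measurable M" for i
    proof -
      have [measurable]: "(\<lambda>y. f y (z0 + X (i + N))) \<in> borel_measurable M"
        by (rule meas[OF in_ball])
      have [measurable]: "(\<lambda>y. f y z0) \<in> borel_measurable M" using r by (intro meas) auto
      show ?thesis by measurable
    qed
    have meas2: "(\<lambda>y. f' y z0) \<in> borel_measurable M"
      by (rule borel_measurable_LIMSEQ_metric[OF meas1 lim])
    have intg: "integrable M (\<lambda>y. 2 / r * g y)" using g by simp
    have dom: "AE y in M. cmod ((f y (z0 + X (i + N)) - f y z0) / X (i + N)) \<le> 2 / r * g y" for i
      using lip[OF _ N[of "i + N"]] X by (auto simp: norm_divide divide_simps)
    have aelim: "AE y in M. (\<lambda>i. (f y (z0 + X (i + N)) - f y z0) / X (i + N)) \<longlonglongrightarrow> f' y z0"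
      using lim by auto
    have int': "integrable M (\<lambda>y. f' y z0)"
      by (rule integrable_dominated_convergence[OF meas2 meas1 intg aelim dom])
    have "(\<lambda>i. \<integral>y. (f y (z0 + X (i + N)) - f y z0) / X (i + N) \<partial>M) \<longlonglongrightarrow> (\<integral>y. f' y z0 \<partial>M)"
      by (rule integral_dominated_convergence[OF meas2 meas1 intg aelim dom])
    also have "(\<lambda>i. \<integral>y. (f y (z0 + X (i + N)) - f y z0) / X (i + N) \<partial>M) =
        (\<lambda>i. ((\<integral>y. f y (z0 + X (i + N)) \<partial>M) - (\<integral>y. f y z0 \<partial>M)) / X (i + N))"
      using intf[OF in_ball] intf[of z0] r by (simp add: Bochner_Integration.integral_diff)
    finally have "(\<lambda>i. ((\<integral>y. f y (z0 + X i) \<partial>M) - (\<integral>y. f y z0 \<partial>M)) / X i) \<longlonglongrightarrow> (\<integral>y. f' y z0 \<partial>M)"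
      by (rule LIMSEQ_offset)
    with int' show ?thesis by blast
  qed
  have "(\<lambda>n. 1 / of_nat (Suc n) :: complex) \<longlonglongrightarrow> 0"
    by (rule LIMSEQ_Suc[OF lim_1_over_n])
  from main[OF _ this] show "integrable M (\<lambda>y. f' y z0)" by (auto simp del: of_nat_Suc)
  show "((\<lambda>z. \<integral>y. f y z \<partial>M) has_field_derivative (\<integral>y. f' y z0 \<partial>M)) (at z0)"
    unfolding DERIV_def tendsto_at_iff_sequentially comp_def using main by blast
qed

section \<open>Integrable majorants and Laplace integrals on the half-line\<close>

lemma integrable_inverse_one_plus_square: "integrable lborel (\<lambda>y::real. C / (1 + y\<^sup>2))"
  using integrable_inverse_1_plus_square
  by (simp add: set_integrable_def divide_inverse)

lemma set_integrable_if_le_inverse_square: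
  fixes f :: "real \<Rightarrow> complex"
  assumes "continuous_on {0<..} f" "\<And>y. y > 0 \<Longrightarrow> cmod (f y) \<le> C / (1 + y\<^sup>2)"
  shows "set_integrable lborel {0<..} f"
  unfolding set_integrable_def
proof (rule Bochner_Integration.integrable_bound[OF integrable_inverse_one_plus_square[of "C"]])
  show "(\<lambda>y. indicat_real {0<..} y *\<^sub>R f y) \<in> borel_measurable lborel"
    using borel_measurable_continuous_on_indicator[OF _ assms(1)] by simp
  show "AE y in lborel. norm (indicat_real {0<..} y *\<^sub>R f y) \<le> norm (C / (1 + y\<^sup>2))"
  proof (rule AE_I2)
    fix y :: real
    show "norm (indicat_real {0<..} y *\<^sub>R f y) \<le> norm (C / (1 + y\<^sup>2))"
      using assms(2)[of y] abs_ge_self[of "C / (1 + y\<^sup>2)"] by (auto simp: indicator_def)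
  qed
qed

lemma has_field_derivative_set_lebesgue_integral_Ioi:
  fixes f f' :: "complex \<Rightarrow> real \<Rightarrow> complex"
  assumes r: "r > 0"
    and deriv: "\<And>y z. y > 0 \<Longrightarrow> z \<in> ball z0 r \<Longrightarrow> ((\<lambda>z. f z y) has_field_derivative f' z y) (at z)"
    and cont: "\<And>z. z \<in> ball z0 r \<Longrightarrow> continuous_on {0<..} (f z)"
    and bound: "\<And>y z. y > 0 \<Longrightarrow> z \<in> ball z0 r \<Longrightarrow> cmod (f z y) \<le> C / (1 + y\<^sup>2)"
  shows "set_integrable lborel {0<..} (f' z0)"
    and "((\<lambda>z. LBINT y:{0<..}. f z y) has_field_derivative (LBINT y:{0<..}. f' z0 y)) (at z0)"
proof -
  note * = has_field_derivative_lebesgue_integral[OF r,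
      of lborel z0 "\<lambda>y z. indicat_real {0<..} y *\<^sub>R f z y" "\<lambda>y z. indicat_real {0<..} y *\<^sub>R f' z y"
         "\<lambda>y. C / (1 + y\<^sup>2)"]
  have 1: "((\<lambda>z. indicat_real {0<..} y *\<^sub>R f z y) has_field_derivative indicat_real {0<..} y *\<^sub>R f' z y) (at z)"
    if "z \<in> ball z0 r" for y z
    using deriv[OF _ that, of y] by (cases "y > 0") auto
  have 2: "(\<lambda>y. indicat_real {0<..} y *\<^sub>R f z y) \<in> borel_measurable lborel" if "z \<in> ball z0 r" for z
    using borel_measurable_continuous_on_indicator[OF _ cont[OF that]] by simp
  have "cmod (f z0 1) \<le> C / (1 + 1\<^sup>2)" using bound[of 1 z0] r by simp
  hence C: "0 \<le> C" using order_trans[OF norm_ge_zero] by fastforce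
  have 3: "cmod (indicat_real {0<..} y *\<^sub>R f z y) \<le> C / (1 + y\<^sup>2)" if "z \<in> ball z0 r" for y z
    using bound[OF _ that, of y] C by (cases "y > 0") auto
  show "set_integrable lborel {0<..} (f' z0)"
    unfolding set_integrable_def using 1 2 3 integrable_inverse_one_plus_square by (intro *(1)) auto
  show "((\<lambda>z. LBINT y:{0<..}. f z y) has_field_derivative (LBINT y:{0<..}. f' z0 y)) (at z0)"
    unfolding set_lebesgue_integral_def using 1 2 3 integrable_inverse_one_plus_square by (intro *(2)) auto
qed

text \<open>The exponential is bounded below by its quadratic Taylor polynomial. The constant is
  chosen so that its product with this polynomial contains both 1 and y^2, all other terms being
  nonnegative.\<close>

lemma exp_minus_le_inverse_square:
  assumes "\<kappa> > 0" "(y::real) \<ge> 0"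
  shows "exp (- (\<kappa> * y)) \<le> (1 + 2 / \<kappa>\<^sup>2) / (1 + y\<^sup>2)"
proof -
  have "(1 + 2 / \<kappa>\<^sup>2) * (1 + \<kappa> * y + (\<kappa> * y)\<^sup>2 / 2)
     = 1 + y\<^sup>2 + (\<kappa> * y + (\<kappa> * y)\<^sup>2 / 2 + 2 / \<kappa>\<^sup>2 * (1 + \<kappa> * y))"
    using assms by (simp add: field_simps power2_eq_square)
  moreover have "0 \<le> \<kappa> * y + (\<kappa> * y)\<^sup>2 / 2 + 2 / \<kappa>\<^sup>2 * (1 + \<kappa> * y)"
    using assms by simp
  ultimately have "1 + y\<^sup>2 \<le> (1 + 2 / \<kappa>\<^sup>2) * (1 + \<kappa> * y + (\<kappa> * y)\<^sup>2 / 2)" by linarith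
  also have "\<dots> \<le> (1 + 2 / \<kappa>\<^sup>2) * exp (\<kappa> * y)"
    using assms by (intro mult_left_mono exp_lower_Taylor_quadratic) auto
  finally have "1 + y\<^sup>2 \<le> (1 + 2 / \<kappa>\<^sup>2) * exp (\<kappa> * y)" .
  moreover have "1 + y\<^sup>2 > 0" by (simp add: add_pos_nonneg)
  ultimately show ?thesis
    by (simp add: exp_minus pos_le_divide_eq) (simp add: field_simps)
qed

lemma integral_exp_minus_Ioi:
  assumes b: "Re b > 0"
  shows "set_integrable lborel {0<..} (\<lambda>y. exp (- (b * of_real y)))"
    and "(LBINT y:{0<..}. exp (- (b * of_real y))) = 1 / b"
proof -
  have b0: "b \<noteq> 0" using b by auto
  show int: "set_integrable lborel {0<..} (\<lambda>y. exp (- (b * of_real y)))"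
    by (rule set_integrable_if_le_inverse_square[where C = "1 + 2 / (Re b)\<^sup>2"])
       (use exp_minus_le_inverse_square[OF b] in \<open>auto intro!: continuous_intros\<close>)
  define F where "F = (\<lambda>y::real. - exp (- (b * of_real y)) / b)"
  have "(LBINT y=ereal 0..\<infinity>. exp (- (b * of_real y))) = 0 - (- 1 / b)"
  proof (rule interval_integral_FTC_integrable[where F = F])
    show "(F has_vector_derivative exp (- (b * of_real x))) (at x)" for x :: real
    proof -
      have "((\<lambda>y. - exp (- (b * y)) / b) has_field_derivative exp (- (b * of_real x))) (at (of_real x))"
        using b0 by (auto intro!: derivative_eq_intros)
      thus ?thesis unfolding F_def by (rule has_vector_derivative_real_field)
    qed
    show "((F \<circ> real_of_ereal) \<longlongrightarrow> - 1 / b) (at_right (ereal 0))"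
      unfolding ereal_tendsto_simps F_def using b0 by (auto intro!: tendsto_eq_intros)
    have "((\<lambda>y. exp (- (Re b * y)) / cmod b) \<longlongrightarrow> 0) at_top"
      using b b0 by real_asymp
    hence "((\<lambda>y. norm (F y)) \<longlongrightarrow> 0) at_top"
      by (simp add: F_def norm_divide)
    thus "((F \<circ> real_of_ereal) \<longlongrightarrow> 0) (at_left \<infinity>)"
      unfolding ereal_tendsto_simps by (rule tendsto_norm_zero_cancel)
  qed (use int in \<open>auto simp: einterval_eq\<close>)
  thus "(LBINT y:{0<..}. exp (- (b * of_real y))) = 1 / b"
    by (simp add: interval_integral_to_infinity_eq)
qed

section \<open>The integral on the strip\<close>

definition hyp_gamma_integrand :: "complex \<Rightarrow> complex \<Rightarrow> complex \<Rightarrow> real \<Rightarrow> complex" where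
  "hyp_gamma_integrand w1 w2 z y =
     (sin (2 * of_real y * z) / (2 * sinh (w1 * of_real y) * sinh (w2 * of_real y))
          - z / (w1 * w2 * of_real y)) / of_real y"

text \<open>Passing to the odd part removes the quadratic Taylor terms, so the second-order
  remainder of exp already gives a bound of third order.\<close>

lemma norm_sinh_minus_self_le: "cmod (sinh u - u) \<le> exp (cmod u) * cmod u ^ 3"
proof -
  have *: "cmod (exp v - (1 + v + v\<^sup>2 / 2)) \<le> exp (cmod u) * cmod u ^ 3 / 2" if "cmod v = cmod u" for v
  proof -
    have "cmod (exp v - (\<Sum>k\<le>2. v ^ k / fact k)) \<le> exp \<bar>Re v\<bar> * cmod v ^ Suc 2 / fact 2"
      by (rule Taylor_exp)
    also have "(\<Sum>k\<le>2. v ^ k / fact k) = 1 + v + v\<^sup>2 / 2"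
      by (simp add: eval_nat_numeral)
    also have "exp \<bar>Re v\<bar> * cmod v ^ Suc 2 / fact 2 \<le> exp (cmod u) * cmod u ^ 3 / 2"
      using that abs_Re_le_cmod[of v] by (auto simp: eval_nat_numeral intro!: mult_right_mono)
    finally show ?thesis .
  qed
  have "sinh u - u = ((exp u - (1 + u + u\<^sup>2 / 2)) - (exp (-u) - (1 + (-u) + (-u)\<^sup>2 / 2))) / 2"
    by (simp add: sinh_def scaleR_conv_of_real field_simps)
  also have "cmod \<dots> \<le> (exp (cmod u) * cmod u ^ 3 / 2 + exp (cmod u) * cmod u ^ 3 / 2) / 2"
    unfolding norm_divide
    using order_trans[OF norm_triangle_ineq4 add_mono[OF *[of u] *[of "-u"]]] by simp
  also have "\<dots> \<le> exp (cmod u) * cmod u ^ 3" by simp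
  finally show ?thesis .
qed

lemma norm_sin_minus_self_le: "cmod (sin u - u) \<le> exp (cmod u) * cmod u ^ 3"
proof -
  have "sin u = - \<i> * sinh (\<i> * u)"
    by (simp add: sinh_def sin_exp_eq scaleR_conv_of_real field_simps)
  hence "sin u - u = - \<i> * (sinh (\<i> * u) - \<i> * u)"
    by (simp add: algebra_simps)
  thus ?thesis using norm_sinh_minus_self_le[of "\<i> * u"] by (simp add: norm_mult)
qed

lemma norm_sinh_ge:
  assumes "Re u \<ge> 0"
  shows "cmod (sinh u) \<ge> sinh (Re u)"
proof -
  have "cmod (exp u) - cmod (exp (-u)) \<le> cmod (exp u - exp (-u))"
    by (rule norm_triangle_ineq2)
  thus ?thesis by (simp add: sinh_def norm_divide)
qed

lemma sinh_ge_self: "x \<ge> 0 \<Longrightarrow> sinh x \<ge> (x::real)"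
proof -
  assume "x \<ge> 0"
  have "sinh 0 - 0 \<le> sinh x - x"
  proof (rule DERIV_nonneg_imp_nondecreasing[OF \<open>x \<ge> 0\<close>], goal_cases)
    case (1 t)
    have "((\<lambda>x. sinh x - x) has_field_derivative cosh t - 1) (at t)"
      by (auto intro!: derivative_eq_intros)
    thus ?case using cosh_real_ge_1[of t] by (intro exI[of _ "cosh t - 1"]) auto
  qed
  thus ?thesis by simp
qed

lemma norm_sinh_le: "cmod (sinh u) \<le> cmod u * exp (cmod u) * (1 + cmod u ^ 2)"
proof -
  have "cmod (sinh u) \<le> cmod (sinh u - u) + cmod u"
    using norm_triangle_ineq[of "sinh u - u" u] by simp
  also have "\<dots> \<le> exp (cmod u) * cmod u ^ 3 + cmod u * exp (cmod u)"
    using norm_sinh_minus_self_le[of u] mult_left_mono[of 1 "exp (cmod u)" "cmod u"] by simp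
  finally show ?thesis by (simp add: algebra_simps power2_eq_square eval_nat_numeral)
qed

lemma norm_sin_le_exp_Im: "cmod (sin u) \<le> exp \<bar>Im u\<bar>"
proof -
  have "cmod (sin u) = cmod (exp (\<i> * u) - exp (- (\<i> * u))) / 2"
    by (simp add: sin_exp_eq norm_divide norm_mult)
  also have "\<dots> \<le> (exp (- Im u) + exp (Im u)) / 2"
    using norm_triangle_ineq4[of "exp (\<i> * u)" "exp (- (\<i> * u))"] by simp
  also have "\<dots> \<le> exp \<bar>Im u\<bar>"
  proof -
    have "exp (- Im u) + exp (Im u) \<le> exp \<bar>Im u\<bar> + exp \<bar>Im u\<bar>" by (intro add_mono) auto
    thus ?thesis by simp
  qed
  finally show ?thesis .
qed

text \<open>Near 0 the singular terms cancel. Near infinity sin (2 y z) grows at most like exp (2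
  delta y), which is slower than the growth exp (Re (w1 + w2) y) of the two sinh factors.
  Differentiation under the integral requires the uniformity in z on bounded pieces of a closed
  substrip.\<close>

lemma hyp_gamma_integrand_bound:
  assumes w: "Re w1 > 0" "Re w2 > 0" and \<delta>: "\<delta> < Re (wmean w1 w2)"
  obtains C where "C \<ge> 0" "\<And>z y. y > 0 \<Longrightarrow> cmod z \<le> B \<Longrightarrow> \<bar>Im z\<bar> \<le> \<delta> \<Longrightarrow>
    cmod (hyp_gamma_integrand w1 w2 z y) \<le> C / (1 + y\<^sup>2)"
proof (cases "B \<ge> 0")
  case False
  show thesis
    by (rule that[of 0]) (use False norm_ge_zero order_trans in \<open>blast+\<close>)
next
  case True
  define a1 where "a1 = Re w1"
  define a2 where "a2 = Re w2"
  have a: "a1 > 0" "a2 > 0" using w by (auto simp: a1_def a2_def)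
  have nz: "w1 \<noteq> 0" "w2 \<noteq> 0" using w by auto
  have sinh_nz: "sinh (w * of_real y) \<noteq> 0" if "Re w > 0" "y > 0" for w y
  proof -
    have "0 < Re (w * of_real y)" using that by simp
    hence "0 < cmod (sinh (w * of_real y))"
      using norm_sinh_ge[of "w * of_real y"] sinh_real_pos_iff[of "Re (w * of_real y)"] by linarith
    thus ?thesis by auto
  qed
  define c where "c = cmod w1 * cmod w2"
  have c: "c > 0" using nz by (simp add: c_def)
  define N1 where "N1 = c * ((2 * B) ^ 3 * exp (2 * B))
     + 2 * B * (cmod w1 * (exp (cmod w2) * cmod w2 ^ 3)
        + cmod w2 * exp (cmod w2) * (1 + cmod w2 ^ 2) * (exp (cmod w1) * cmod w1 ^ 3))"
  have N1: "N1 \<ge> 0" using True c unfolding N1_def by (auto intro!: add_nonneg_nonneg mult_nonneg_nonneg)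
  define C1 where "C1 = N1 / (2 * c * a1 * a2)"
  have C1: "C1 \<ge> 0" unfolding C1_def using N1 c a by simp
  have near: "cmod (hyp_gamma_integrand w1 w2 z y) \<le> C1"
    if y: "0 < y" "y \<le> 1" and z: "cmod z \<le> B" for z y
  proof -
    define Y :: complex where "Y = of_real y"
    have Y: "cmod Y = y" "Y \<noteq> 0" using y by (auto simp: Y_def)
    have s: "sinh (w1 * Y) \<noteq> 0" "sinh (w2 * Y) \<noteq> 0"
      using sinh_nz y w by (auto simp: Y_def)
    \<comment> \<open>Written with the third-order remainders sin u - u and sinh u - u, every term
      of the numerator is O(y^4), the order of the denominator at 0.\<close>
    have eq: "hyp_gamma_integrand w1 w2 z y =
       (w1 * w2 * Y * (sin (2 * Y * z) - 2 * Y * z) +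
        2 * z * (w1 * Y * (w2 * Y - sinh (w2 * Y)) + sinh (w2 * Y) * (w1 * Y - sinh (w1 * Y)))) /
       (2 * w1 * w2 * Y\<^sup>2 * sinh (w1 * Y) * sinh (w2 * Y))"
      using nz Y s unfolding hyp_gamma_integrand_def Y_def[symmetric]
      by (simp add: field_simps power2_eq_square)
    have pow: "y ^ n \<le> 1" for n using y by (intro power_le_one) auto
    have sinw: "cmod (w * Y - sinh (w * Y)) \<le> exp (cmod w) * cmod w ^ 3 * y ^ 3" for w
    proof -
      have "cmod (w * Y - sinh (w * Y)) \<le> exp (cmod (w * Y)) * cmod (w * Y) ^ 3"
        using norm_sinh_minus_self_le[of "w * Y"] by (simp add: norm_minus_commute)
      also have "\<dots> \<le> exp (cmod w) * (cmod w ^ 3 * y ^ 3)"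
        using y by (auto simp: norm_mult Y power_mult_distrib mult_left_le intro!: mult_right_mono)
      finally show ?thesis by (simp add: mult_ac)
    qed
    have t1: "cmod (w1 * w2 * Y * (sin (2 * Y * z) - 2 * Y * z)) \<le> c * ((2 * B) ^ 3 * exp (2 * B)) * y ^ 4"
    proof -
      have "cmod (sin (2 * Y * z) - 2 * Y * z) \<le> exp (cmod (2 * Y * z)) * cmod (2 * Y * z) ^ 3"
        by (rule norm_sin_minus_self_le)
      also have "\<dots> \<le> exp (2 * B) * (2 * B * y) ^ 3"
      proof (intro mult_mono power_mono)
        have "y * cmod z \<le> B * y" using z y by (simp add: mult.commute mult_left_mono)
        thus "cmod (2 * Y * z) \<le> 2 * B * y" by (simp add: norm_mult Y mult.commute)
        also have "\<dots> \<le> 2 * B" using True y by (simp add: mult_left_le)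
        finally show "exp (cmod (2 * Y * z)) \<le> exp (2 * B)" by simp
      qed auto
      finally have "c * y * cmod (sin (2 * Y * z) - 2 * Y * z) \<le> c * y * (exp (2 * B) * (2 * B * y) ^ 3)"
        using c y by (intro mult_left_mono) auto
      thus ?thesis by (simp add: norm_mult Y c_def power_mult_distrib mult_ac eval_nat_numeral)
    qed
    have t2: "cmod (w1 * Y * (w2 * Y - sinh (w2 * Y))) \<le> cmod w1 * (exp (cmod w2) * cmod w2 ^ 3) * y ^ 4"
    proof -
      have "cmod w1 * y * cmod (w2 * Y - sinh (w2 * Y)) \<le> cmod w1 * y * (exp (cmod w2) * cmod w2 ^ 3 * y ^ 3)"
        using y by (intro mult_left_mono sinw) auto
      thus ?thesis by (simp add: norm_mult Y mult_ac eval_nat_numeral)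
    qed
    have t3: "cmod (sinh (w2 * Y) * (w1 * Y - sinh (w1 * Y))) \<le>
        cmod w2 * exp (cmod w2) * (1 + cmod w2 ^ 2) * (exp (cmod w1) * cmod w1 ^ 3) * y ^ 4"
    proof -
      have "cmod (sinh (w2 * Y)) \<le> cmod (w2 * Y) * exp (cmod (w2 * Y)) * (1 + cmod (w2 * Y) ^ 2)"
        by (rule norm_sinh_le)
      also have "\<dots> \<le> (cmod w2 * y) * exp (cmod w2) * (1 + cmod w2 ^ 2)"
      proof (intro mult_mono add_left_mono power_mono)
        show "cmod (w2 * Y) \<le> cmod w2" using y by (simp add: norm_mult Y mult_left_le)
        thus "exp (cmod (w2 * Y)) \<le> exp (cmod w2)" by simp
      qed (use y in \<open>auto simp: norm_mult Y\<close>)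
      finally have "cmod (sinh (w2 * Y)) * cmod (w1 * Y - sinh (w1 * Y)) \<le>
         ((cmod w2 * y) * exp (cmod w2) * (1 + cmod w2 ^ 2)) * (exp (cmod w1) * cmod w1 ^ 3 * y ^ 3)"
        using y by (intro mult_mono sinw) auto
      thus ?thesis by (simp add: norm_mult mult_ac eval_nat_numeral)
    qed
    have t4: "cmod (2 * z * (w1 * Y * (w2 * Y - sinh (w2 * Y)) + sinh (w2 * Y) * (w1 * Y - sinh (w1 * Y))))
       \<le> 2 * B * ((cmod w1 * (exp (cmod w2) * cmod w2 ^ 3)
        + cmod w2 * exp (cmod w2) * (1 + cmod w2 ^ 2) * (exp (cmod w1) * cmod w1 ^ 3)) * y ^ 4)"
      unfolding norm_mult[of "2 * z"]
    proof (intro mult_mono)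
      show "cmod (w1 * Y * (w2 * Y - sinh (w2 * Y)) + sinh (w2 * Y) * (w1 * Y - sinh (w1 * Y))) \<le>
         (cmod w1 * (exp (cmod w2) * cmod w2 ^ 3)
        + cmod w2 * exp (cmod w2) * (1 + cmod w2 ^ 2) * (exp (cmod w1) * cmod w1 ^ 3)) * y ^ 4"
        using order_trans[OF norm_triangle_ineq add_mono[OF t2 t3]] by (simp add: distrib_right)
    qed (use z True in \<open>auto simp: norm_mult\<close>)
    have num: "cmod (w1 * w2 * Y * (sin (2 * Y * z) - 2 * Y * z) +
        2 * z * (w1 * Y * (w2 * Y - sinh (w2 * Y)) + sinh (w2 * Y) * (w1 * Y - sinh (w1 * Y)))) \<le> N1 * y ^ 4"
      using order_trans[OF norm_triangle_ineq add_mono[OF t1 t4]] unfolding N1_def by (simp add: algebra_simps)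
    have den: "2 * c * a1 * a2 * y ^ 4 \<le> cmod (2 * w1 * w2 * Y\<^sup>2 * sinh (w1 * Y) * sinh (w2 * Y))"
    proof -
      have "a1 * y \<le> cmod (sinh (w1 * Y))" "a2 * y \<le> cmod (sinh (w2 * Y))"
        using norm_sinh_ge[of "w1 * Y"] sinh_ge_self[of "a1 * y"] norm_sinh_ge[of "w2 * Y"] sinh_ge_self[of "a2 * y"] a y
        by (auto simp: a1_def a2_def Y_def)
      hence "(2 * c * y\<^sup>2) * ((a1 * y) * (a2 * y)) \<le> (2 * c * y\<^sup>2) * (cmod (sinh (w1 * Y)) * cmod (sinh (w2 * Y)))"
        using c y a by (intro mult_left_mono mult_mono) auto
      thus ?thesis by (simp add: norm_mult Y c_def norm_power mult_ac eval_nat_numeral)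
    qed
    have "cmod (hyp_gamma_integrand w1 w2 z y) \<le> (N1 * y ^ 4) / (2 * c * a1 * a2 * y ^ 4)"
      unfolding eq norm_divide using N1 c a y by (intro frac_le num den mult_nonneg_nonneg mult_pos_pos) auto
    also have "\<dots> = C1" using y by (simp add: C1_def)
    finally show ?thesis .
  qed
  \<comment> \<open>The decay rate that is left: exp (2 y delta) divided by exp ((a1 + a2) y) is exp
    (- kappa y).\<close>
  define \<kappa> where "\<kappa> = 2 * (Re (wmean w1 w2) - \<delta>)"
  have \<kappa>: "\<kappa> > 0" using \<delta> by (simp add: \<kappa>_def)
  \<comment> \<open>With this factor, sinh (a y) >= k(a) exp (a y) for all y >= 1.\<close>
  define k where "k = (\<lambda>a. (1 - exp (- (2 * a))) / 2 :: real)"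
  have k: "k a > 0" if "a > 0" for a using that by (simp add: k_def)
  define C2 where "C2 = 1 / (2 * k a1 * k a2 * \<kappa>) + B / c"
  have C2: "C2 \<ge> 0" unfolding C2_def using k[OF a(1)] k[OF a(2)] \<kappa> c True by simp
  have far: "cmod (hyp_gamma_integrand w1 w2 z y) \<le> C2 / y\<^sup>2"
    if y: "y \<ge> 1" and z: "cmod z \<le> B" "\<bar>Im z\<bar> \<le> \<delta>" for z y
  proof -
    have sh: "k (Re w) * exp (Re w * y) \<le> cmod (sinh (w * of_real y))" if "Re w > 0" for w
    proof -
      have "exp (- (2 * (Re w * y))) \<le> exp (- (2 * Re w))"
        using that y by (simp add: mult_le_cancel_left1)
      hence "exp (Re w * y) * exp (- (2 * (Re w * y))) \<le> exp (Re w * y) * exp (- (2 * Re w))"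
        by (intro mult_left_mono) auto
      hence "exp (- (Re w * y)) \<le> exp (Re w * y) * exp (- (2 * Re w))"
        by (simp flip: exp_add)
      hence "k (Re w) * exp (Re w * y) \<le> sinh (Re w * y)"
        by (simp add: k_def sinh_field_def field_simps)
      also have "\<dots> \<le> cmod (sinh (w * of_real y))"
        using norm_sinh_ge[of "w * of_real y"] that y by simp
      finally show ?thesis .
    qed
    have "cmod (hyp_gamma_integrand w1 w2 z y) \<le>
       (cmod (sin (2 * of_real y * z)) / (2 * cmod (sinh (w1 * of_real y)) * cmod (sinh (w2 * of_real y)))
          + cmod z / (c * y)) / y"
      unfolding hyp_gamma_integrand_def norm_divide using y
      by (intro divide_mono order_trans[OF norm_triangle_ineq4])
         (auto simp: norm_divide norm_mult c_def)
    also have "\<dots> \<le> (exp (2 * y * \<delta>) / (2 * (k a1 * exp (a1 * y)) * (k a2 * exp (a2 * y))) + B / (c * y)) / y"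
    proof (intro divide_right_mono add_mono frac_le mult_mono)
      have "cmod (sin (2 * of_real y * z)) \<le> exp \<bar>Im (2 * of_real y * z)\<bar>" by (rule norm_sin_le_exp_Im)
      also have "\<dots> \<le> exp (2 * y * \<delta>)" using z y by (simp add: abs_mult)
      finally show "cmod (sin (2 * of_real y * z)) \<le> exp (2 * y * \<delta>)" .
    qed (use y c z True k[OF w(1)] k[OF w(2)] sh w in \<open>auto simp: a1_def a2_def zero_le_mult_iff\<close>)
    also have "exp (2 * y * \<delta>) / (2 * (k a1 * exp (a1 * y)) * (k a2 * exp (a2 * y)))
       = exp (- (\<kappa> * y)) / (2 * k a1 * k a2)"
    proof -
      have "2 * y * \<delta> = - (\<kappa> * y) + a1 * y + a2 * y"
        by (simp add: \<kappa>_def wmean_def a1_def a2_def field_simps)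
      hence "exp (2 * y * \<delta>) = exp (- (\<kappa> * y)) * exp (a1 * y) * exp (a2 * y)"
        by (simp only: exp_add)
      thus ?thesis by simp
    qed
    also have "(exp (- (\<kappa> * y)) / (2 * k a1 * k a2) + B / (c * y)) / y
        \<le> (1 / (\<kappa> * y) / (2 * k a1 * k a2) + B / (c * y)) / y"
    proof (intro divide_right_mono add_right_mono)
      have "\<kappa> * y \<le> exp (\<kappa> * y)" using exp_ge_add_one_self[of "\<kappa> * y"] by linarith
      thus "exp (- (\<kappa> * y)) \<le> 1 / (\<kappa> * y)" using \<kappa> y by (simp add: exp_minus divide_simps)
    qed (use k[OF a(1)] k[OF a(2)] y in auto)
    also have "\<dots> = C2 / y\<^sup>2" using y \<kappa> c k[OF a(1)] k[OF a(2)] unfolding C2_def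
      by (simp add: field_simps power2_eq_square)
    finally show ?thesis .
  qed
  show thesis
  \<comment> \<open>The factor 2 merges the two ranges: 1 + y^2 is at most 2 for y <= 1 and at most
    2 y^2 for y >= 1.\<close>
  proof (rule that[of "2 * (C1 + C2)"])
    show "2 * (C1 + C2) \<ge> 0" using C1 C2 by simp
    fix z y assume y: "(y::real) > 0" and z: "cmod z \<le> B" "\<bar>Im z\<bar> \<le> \<delta>"
    show "cmod (hyp_gamma_integrand w1 w2 z y) \<le> 2 * (C1 + C2) / (1 + y\<^sup>2)"
    proof (cases "y \<le> 1")
      case True
      have "C1 * (1 + y\<^sup>2) \<le> C1 * 2" using C1 y True by (intro mult_left_mono) (auto intro: power_le_one)
      hence "C1 \<le> 2 * C1 / (1 + y\<^sup>2)" using y by (simp add: pos_le_divide_eq add_pos_nonneg mult.commute)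
      also have "\<dots> \<le> 2 * (C1 + C2) / (1 + y\<^sup>2)" using C2 by (intro divide_right_mono) auto
      finally show ?thesis using near[OF y True z(1)] by linarith
    next
      case False
      hence y1: "1 \<le> y\<^sup>2" "y \<ge> 1" by (auto simp: one_le_power)
      have "C2 / y\<^sup>2 = 2 * C2 / (y\<^sup>2 + y\<^sup>2)" using y by simp
      also have "\<dots> \<le> 2 * C2 / (1 + y\<^sup>2)" using y1 C2 by (intro divide_left_mono) (auto intro!: mult_pos_pos add_pos_nonneg)
      also have "\<dots> \<le> 2 * (C1 + C2) / (1 + y\<^sup>2)" using C1 by (intro divide_right_mono) auto
      finally show ?thesis using far[OF y1(2) z] by linarith
    qed
  qed
qed

lemma sinh_of_real_mult_nonzero:
  assumes "Re w > 0" "y > 0"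
  shows "sinh (w * of_real y) \<noteq> 0"
proof -
  have "0 < Re (w * of_real y)" using assms by simp
  hence "0 < cmod (sinh (w * of_real y))"
    using norm_sinh_ge[of "w * of_real y"] sinh_real_pos_iff[of "Re (w * of_real y)"] by linarith
  thus ?thesis by auto
qed

lemma continuous_on_hyp_gamma_integrand:
  assumes "Re w1 > 0" "Re w2 > 0"
  shows "continuous_on {0<..} (hyp_gamma_integrand w1 w2 z)"
proof -
  have "w1 \<noteq> 0" "w2 \<noteq> 0" using assms by auto
  thus ?thesis unfolding hyp_gamma_integrand_def
    by (intro continuous_intros) (auto simp: sinh_of_real_mult_nonzero assms)
qed

lemma hyp_gamma_strip_eq:
  "hyp_gamma_strip w1 w2 z = exp (\<i> * (LBINT y:{0<..}. hyp_gamma_integrand w1 w2 z y))"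
  by (simp add: hyp_gamma_strip_def hyp_gamma_integrand_def)

lemma set_integrable_hyp_gamma_integrand:
  assumes w: "Re w1 > 0" "Re w2 > 0" and z: "\<bar>Im z\<bar> < Re (wmean w1 w2)"
  shows "set_integrable lborel {0<..} (hyp_gamma_integrand w1 w2 z)"
proof -
  obtain C where "\<And>z' y. y > 0 \<Longrightarrow> cmod z' \<le> cmod z \<Longrightarrow> \<bar>Im z'\<bar> \<le> \<bar>Im z\<bar> \<Longrightarrow>
    cmod (hyp_gamma_integrand w1 w2 z' y) \<le> C / (1 + y\<^sup>2)"
    using hyp_gamma_integrand_bound[OF w z, of "cmod z"] by metis
  thus ?thesis
    by (intro set_integrable_if_le_inverse_square[OF continuous_on_hyp_gamma_integrand[OF w]]) auto
qed

lemma has_field_derivative_hyp_gamma_integrand: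
  "((\<lambda>z. hyp_gamma_integrand w1 w2 z y) has_field_derivative
     ((2 * of_real y * cos (2 * of_real y * z)) / (2 * sinh (w1 * of_real y) * sinh (w2 * of_real y))
          - 1 / (w1 * w2 * of_real y)) / of_real y) (at z)"
  unfolding hyp_gamma_integrand_def
  by (auto intro!: derivative_eq_intros DERIV_cdivide simp: divide_simps)

lemma strip_ball_obtain:
  assumes "\<bar>Im z0\<bar> < R"
  obtains r \<delta> where "r > 0" "\<delta> < R" "\<And>z. z \<in> ball z0 r \<Longrightarrow> \<bar>Im z\<bar> \<le> \<delta>"
    "\<And>z. z \<in> ball z0 r \<Longrightarrow> cmod z \<le> cmod z0 + r"
proof -
  define r where "r = (R - \<bar>Im z0\<bar>) / 2"
  show thesis
  proof (rule that[of r "\<bar>Im z0\<bar> + r"])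
    fix z assume z: "z \<in> ball z0 r"
    have "\<bar>Im (z - z0)\<bar> \<le> cmod (z - z0)" by (rule abs_Im_le_cmod)
    thus "\<bar>Im z\<bar> \<le> \<bar>Im z0\<bar> + r" using z by (auto simp: dist_norm norm_minus_commute)
    show "cmod z \<le> cmod z0 + r" using z norm_triangle_ineq2[of z z0]
      by (auto simp: dist_norm norm_minus_commute)
  qed (use assms in \<open>auto simp: r_def field_simps\<close>)
qed

lemma holomorphic_on_hyp_gamma_strip:
  assumes w: "Re w1 > 0" "Re w2 > 0"
  shows "hyp_gamma_strip w1 w2 holomorphic_on {z. \<bar>Im z\<bar> < Re (wmean w1 w2)}"
proof -
  have "(\<lambda>z. LBINT y:{0<..}. hyp_gamma_integrand w1 w2 z y) field_differentiable at z0"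
    if z0: "\<bar>Im z0\<bar> < Re (wmean w1 w2)" for z0
  proof -
    obtain r \<delta> where r: "r > 0" "\<delta> < Re (wmean w1 w2)" "\<And>z. z \<in> ball z0 r \<Longrightarrow> \<bar>Im z\<bar> \<le> \<delta>"
      "\<And>z. z \<in> ball z0 r \<Longrightarrow> cmod z \<le> cmod z0 + r"
      using strip_ball_obtain[OF z0] by metis
    obtain C where C: "\<And>z y. y > 0 \<Longrightarrow> cmod z \<le> cmod z0 + r \<Longrightarrow> \<bar>Im z\<bar> \<le> \<delta> \<Longrightarrow>
      cmod (hyp_gamma_integrand w1 w2 z y) \<le> C / (1 + y\<^sup>2)"
      using hyp_gamma_integrand_bound[OF w r(2), of "cmod z0 + r"] by metis
    show ?thesis
      unfolding field_differentiable_def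
      by (rule exI, rule has_field_derivative_set_lebesgue_integral_Ioi(2)[OF r(1)
           has_field_derivative_hyp_gamma_integrand continuous_on_hyp_gamma_integrand[OF w] C])
         (use r in auto)
  qed
  thus ?thesis
    unfolding hyp_gamma_strip_eq
    by (intro holomorphic_intros) (auto simp: holomorphic_on_def intro: field_differentiable_at_within)
qed

section \<open>The first-order difference equation on the strip\<close>

text \<open>The integral over y > 0 is a logarithm of 1 / (2 cosh (pi z / w)). The integrand arises
  from that of G by taking the difference across i w1, which cancels sinh (w1 y) and leaves only the
  other period.\<close>

definition log_cosh_integrand :: "complex \<Rightarrow> complex \<Rightarrow> real \<Rightarrow> complex" where
  "log_cosh_integrand w z y =
     (cos (2 * of_real y * z) / sinh (w * of_real y) - 1 / (w * of_real y)) / of_real y"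

lemma hyp_gamma_integrand_shift:
  assumes "Re w1 > 0" "Re w2 > 0" "y > 0"
  shows "hyp_gamma_integrand w1 w2 (z + \<i> * w1 / 2) y - hyp_gamma_integrand w1 w2 (z - \<i> * w1 / 2) y
     = \<i> * log_cosh_integrand w2 z y"
proof -
  define Y :: complex where "Y = of_real y"
  have nz: "w1 \<noteq> 0" "w2 \<noteq> 0" "Y \<noteq> 0" "sinh (w1 * Y) \<noteq> 0" "sinh (w2 * Y) \<noteq> 0"
    using assms by (auto simp: Y_def sinh_of_real_mult_nonzero)
  have "sin (2 * Y * z + \<i> * (w1 * Y)) - sin (2 * Y * z - \<i> * (w1 * Y)) = 2 * cos (2 * Y * z) * sin (\<i> * (w1 * Y))"
    by (simp add: sin_add sin_diff)
  also have "sin (\<i> * (w1 * Y)) = \<i> * sinh (w1 * Y)"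
    by (simp add: sinh_def sin_exp_eq scaleR_conv_of_real field_simps)
  finally have "sin (2 * Y * (z + \<i> * w1 / 2)) = sin (2 * Y * (z - \<i> * w1 / 2)) + 2 * cos (2 * Y * z) * (\<i> * sinh (w1 * Y))"
    by (simp add: algebra_simps)
  thus ?thesis using nz
    unfolding hyp_gamma_integrand_def log_cosh_integrand_def Y_def[symmetric]
    by (simp add: field_simps)
qed

text \<open>With both periods equal to w, \<open>hyp_gamma_integrand_shift\<close> writes this
  integrand as a difference of two values of the integrand of G, so the earlier bound carries
  over.\<close>

lemma log_cosh_integrand_bound:
  assumes w: "Re w > 0" and \<delta>: "\<delta> < Re w / 2"
  obtains C where "C \<ge> 0" "\<And>z y. y > 0 \<Longrightarrow> cmod z \<le> B \<Longrightarrow> \<bar>Im z\<bar> \<le> \<delta> \<Longrightarrow>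
    cmod (log_cosh_integrand w z y) \<le> C / (1 + y\<^sup>2)"
proof -
  have "\<delta> + Re w / 2 < Re (wmean w w)" using \<delta> by (simp add: wmean_def)
  from hyp_gamma_integrand_bound[OF w w this, of "B + cmod w"]
  obtain C where C: "C \<ge> 0" "\<And>z y. y > 0 \<Longrightarrow> cmod z \<le> B + cmod w \<Longrightarrow> \<bar>Im z\<bar> \<le> \<delta> + Re w / 2 \<Longrightarrow>
    cmod (hyp_gamma_integrand w w z y) \<le> C / (1 + y\<^sup>2)" by metis
  show thesis
  proof (rule that[of "2 * C"])
    fix z y assume y: "(y::real) > 0" and z: "cmod z \<le> B" "\<bar>Im z\<bar> \<le> \<delta>"
    have "cmod (\<i> * w / 2) \<le> cmod w" by (simp add: norm_mult)
    hence n: "cmod (z + \<i> * w / 2) \<le> B + cmod w" "cmod (z - \<i> * w / 2) \<le> B + cmod w"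
      using z norm_triangle_ineq[of z "\<i> * w / 2"] norm_triangle_ineq4[of z "\<i> * w / 2"] by linarith+
    have i: "\<bar>Im (z + \<i> * w / 2)\<bar> \<le> \<delta> + Re w / 2" "\<bar>Im (z - \<i> * w / 2)\<bar> \<le> \<delta> + Re w / 2"
      using z w by auto
    have "cmod (log_cosh_integrand w z y) = cmod (\<i> * log_cosh_integrand w z y)" by (simp add: norm_mult)
    also have "\<dots> \<le> C / (1 + y\<^sup>2) + C / (1 + y\<^sup>2)"
      unfolding hyp_gamma_integrand_shift[OF w w y, symmetric]
      by (intro order_trans[OF norm_triangle_ineq4] add_mono C(2) y n i)
    finally show "cmod (log_cosh_integrand w z y) \<le> 2 * C / (1 + y\<^sup>2)" by simp
  qed (use C in auto)
qed

lemma continuous_on_log_cosh_integrand: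
  "Re w > 0 \<Longrightarrow> continuous_on {0<..} (log_cosh_integrand w z)"
  unfolding log_cosh_integrand_def
  by (intro continuous_intros) (auto simp: sinh_of_real_mult_nonzero)

lemma set_integrable_log_cosh_integrand:
  assumes w: "Re w > 0" and z: "\<bar>Im z\<bar> < Re w / 2"
  shows "set_integrable lborel {0<..} (log_cosh_integrand w z)"
proof -
  obtain C where "\<And>z' y. y > 0 \<Longrightarrow> cmod z' \<le> cmod z \<Longrightarrow> \<bar>Im z'\<bar> \<le> \<bar>Im z\<bar> \<Longrightarrow>
    cmod (log_cosh_integrand w z' y) \<le> C / (1 + y\<^sup>2)"
    using log_cosh_integrand_bound[OF w z, of "cmod z"] by metis
  thus ?thesis
    by (intro set_integrable_if_le_inverse_square[OF continuous_on_log_cosh_integrand[OF w]]) auto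
qed

text \<open>Differentiation in z removes the term 1/(w y) and cancels the division by y; a geometric
  series can evaluate what remains.\<close>

lemma log_cosh_integral_deriv:
  assumes w: "Re w > 0" and z0: "\<bar>Im z0\<bar> < Re w / 2"
  shows "set_integrable lborel {0<..} (\<lambda>y. - 2 * sin (2 * of_real y * z0) / sinh (w * of_real y))"
    and "((\<lambda>z. LBINT y:{0<..}. log_cosh_integrand w z y) has_field_derivative
           (LBINT y:{0<..}. - 2 * sin (2 * of_real y * z0) / sinh (w * of_real y))) (at z0)"
proof -
  obtain r \<delta> where r: "r > 0" "\<delta> < Re w / 2" "\<And>z. z \<in> ball z0 r \<Longrightarrow> \<bar>Im z\<bar> \<le> \<delta>"
    "\<And>z. z \<in> ball z0 r \<Longrightarrow> cmod z \<le> cmod z0 + r"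
    using strip_ball_obtain[OF z0] by metis
  obtain C where C: "\<And>z y. y > 0 \<Longrightarrow> cmod z \<le> cmod z0 + r \<Longrightarrow> \<bar>Im z\<bar> \<le> \<delta> \<Longrightarrow>
    cmod (log_cosh_integrand w z y) \<le> C / (1 + y\<^sup>2)"
    using log_cosh_integrand_bound[OF w r(2), of "cmod z0 + r"] by metis
  have deriv: "((\<lambda>z. log_cosh_integrand w z y) has_field_derivative - 2 * sin (2 * of_real y * z) / sinh (w * of_real y)) (at z)"
    if "y > 0" for y z
    unfolding log_cosh_integrand_def using that sinh_of_real_mult_nonzero[OF w that]
    by (auto intro!: derivative_eq_intros simp: field_simps)
  note * = has_field_derivative_set_lebesgue_integral_Ioi[OF r(1) deriv continuous_on_log_cosh_integrand[OF w] C]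
  show "set_integrable lborel {0<..} (\<lambda>y. - 2 * sin (2 * of_real y * z0) / sinh (w * of_real y))"
    by (rule *(1)) (use r in auto)
  show "((\<lambda>z. LBINT y:{0<..}. log_cosh_integrand w z y) has_field_derivative
           (LBINT y:{0<..}. - 2 * sin (2 * of_real y * z0) / sinh (w * of_real y))) (at z0)"
    by (rule *(2)) (use r in auto)
qed

lemma integral_sin_times_exp_minus:
  assumes "\<bar>2 * Im z\<bar> < Re a"
  shows "set_integrable lborel {0<..} (\<lambda>y. sin (2 * of_real y * z) * exp (- (a * of_real y)))"
    and "(LBINT y:{0<..}. sin (2 * of_real y * z) * exp (- (a * of_real y)))
          = (1 / (a - 2 * \<i> * z) - 1 / (a + 2 * \<i> * z)) / (2 * \<i>)"
proof -
  have eq: "(\<lambda>y. sin (2 * of_real y * z) * exp (- (a * of_real y))) =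
     (\<lambda>y. (exp (- ((a - 2 * \<i> * z) * of_real y)) - exp (- ((a + 2 * \<i> * z) * of_real y))) / (2 * \<i>))"
    by (rule ext) (simp add: sin_exp_eq divide_simps algebra_simps flip: exp_add)
  have "Re (a - 2 * \<i> * z) > 0" "Re (a + 2 * \<i> * z) > 0" using assms by auto
  note * = this[THEN integral_exp_minus_Ioi(1)] this[THEN integral_exp_minus_Ioi(2)]
  show "set_integrable lborel {0<..} (\<lambda>y. sin (2 * of_real y * z) * exp (- (a * of_real y)))"
    unfolding eq using *(1,2) by (intro set_integrable_divide set_integral_diff(1))
  show "(LBINT y:{0<..}. sin (2 * of_real y * z) * exp (- (a * of_real y)))
          = (1 / (a - 2 * \<i> * z) - 1 / (a + 2 * \<i> * z)) / (2 * \<i>)"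
    unfolding eq by (simp only: set_integral_divide_zero set_integral_diff(2)[OF *(1,2)] *(3,4))
qed

text \<open>Partial sums of the geometric series 1 / sinh u = 2 (exp (-u) + exp (-3 u) + ...), in a
  form that exposes the remainder.\<close>

lemma sum_exp_minus_odd:
  assumes "sinh u \<noteq> 0"
  shows "(\<Sum>n<N. 2 * exp (- (of_nat (2 * n + 1) * u))) = (1 - exp (- (of_nat (2 * N) * u))) / sinh (u::complex)"
proof (induction N)
  case (Suc N)
  have "exp (- (of_nat (2 * N + 1) * u)) * 2 * sinh u = exp (- (of_nat (2 * N) * u)) - exp (- (of_nat (2 * Suc N) * u))"
    by (simp add: sinh_def scaleR_conv_of_real algebra_simps flip: exp_add)
  hence "2 * exp (- (of_nat (2 * N + 1) * u)) = (exp (- (of_nat (2 * N) * u)) - exp (- (of_nat (2 * Suc N) * u))) / sinh u"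
    using assms by (simp add: field_simps)
  thus ?case unfolding sum.lessThan_Suc Suc.IH by (simp add: diff_divide_distrib)
qed auto

text \<open>Expanding 1 / sinh and integrating term by term gives a difference of two harmonic-type
  series, whose limit is a difference of Digamma values.\<close>

lemma integral_sin_over_sinh:
  assumes w: "Re w > 0" and z: "\<bar>Im z\<bar> < Re w / 2"
  shows "(LBINT y:{0<..}. - 2 * sin (2 * of_real y * z) / sinh (w * of_real y)) =
    (\<i> / w) * (Digamma (1 / 2 + \<i> * z / w) - Digamma (1 / 2 - \<i> * z / w))"
proof -
  define u where "u = \<i> * z / w"
  have w0: "w \<noteq> 0" using w by auto
  define f where "f = (\<lambda>y::real. - 2 * sin (2 * of_real y * z) / sinh (w * of_real y))"
  define g where "g = (\<lambda>n y::real. sin (2 * of_real y * z) * exp (- (of_nat (2 * n + 1) * w * of_real y)))"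
  have intf: "set_integrable lborel {0<..} f"
    unfolding f_def by (rule log_cosh_integral_deriv(1)[OF w z])
  have arg: "\<bar>2 * Im z\<bar> < Re (of_nat (2 * n + 1) * w)" for n
  proof -
    have "\<bar>2 * Im z\<bar> < Re w" using z by simp
    also have "\<dots> \<le> real (2 * n + 1) * Re w" using w by (simp add: distrib_right)
    also have "\<dots> = Re (of_nat (2 * n + 1) * w)" by simp
    finally show ?thesis .
  qed
  have intg: "set_integrable lborel {0<..} (g n)" for n
    unfolding g_def by (rule integral_sin_times_exp_minus(1)[OF arg])
  have nz: "1 / 2 + u + of_nat n \<noteq> 0" "1 / 2 - u + of_nat n \<noteq> 0" for n
  proof -
    have "of_nat (2 * n + 1) * w + 2 * \<i> * z \<noteq> 0" "of_nat (2 * n + 1) * w - 2 * \<i> * z \<noteq> 0"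
      using arg[of n] by (auto simp: complex_eq_iff)
    thus "1 / 2 + u + of_nat n \<noteq> 0" "1 / 2 - u + of_nat n \<noteq> 0"
      using w0 by (auto simp: u_def field_simps)
  qed
  have valg: "(LBINT y:{0<..}. g n y) = (inverse (1 / 2 - u + of_nat n) - inverse (1 / 2 + u + of_nat n)) / (4 * \<i> * w)" for n
  proof -
    have e: "of_nat (2 * n + 1) * w - 2 * \<i> * z = 2 * w * (1 / 2 - u + of_nat n)"
         "of_nat (2 * n + 1) * w + 2 * \<i> * z = 2 * w * (1 / 2 + u + of_nat n)"
      using w0 by (auto simp: u_def field_simps)
    have "(1 / (2 * w * A) - 1 / (2 * w * B)) / (2 * \<i>) = (inverse A - inverse B) / (4 * \<i> * w)"
      if "A \<noteq> 0" "B \<noteq> 0" for A B :: complex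
      using w0 that by (simp add: field_simps)
    thus ?thesis unfolding g_def integral_sin_times_exp_minus(2)[OF arg] e using nz by blast
  qed
  define s where "s = (\<lambda>N y. - 4 * (\<Sum>n<N. g n y))"
  have s_eq: "s N y = f y * (1 - exp (- (of_nat (2 * N) * (w * of_real y))))" if "y > 0" for N y
  proof -
    have "s N y = - 2 * sin (2 * of_real y * z) * (\<Sum>n<N. 2 * exp (- (of_nat (2 * n + 1) * (w * of_real y))))"
      by (simp add: s_def g_def sum_distrib_left mult_ac)
    also note sum_exp_minus_odd[OF sinh_of_real_mult_nonzero[OF w that]]
    finally show ?thesis by (simp add: f_def)
  qed
  have lim: "(\<lambda>N. s N y) \<longlonglongrightarrow> f y" if y: "y > 0" for y
  proof -
    have "(\<lambda>N. exp (- (real (2 * N) * (Re w * y)))) \<longlonglongrightarrow> 0"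
    proof -
      have "(\<lambda>N. exp (- (real (2 * N) * k))) \<longlonglongrightarrow> 0" if "k > 0" for k :: real
        using that by real_asymp
      thus ?thesis using w y by simp
    qed
    hence "(\<lambda>N. norm (exp (- (of_nat (2 * N) * (w * of_real y))))) \<longlonglongrightarrow> 0"
      by simp
    hence "(\<lambda>N. exp (- (of_nat (2 * N) * (w * of_real y)))) \<longlonglongrightarrow> 0"
      by (rule tendsto_norm_zero_cancel)
    hence "(\<lambda>N. f y * (1 - exp (- (of_nat (2 * N) * (w * of_real y))))) \<longlonglongrightarrow> f y * (1 - 0)"
      by (intro tendsto_intros)
    thus ?thesis using y by (simp add: s_eq)
  qed
  \<comment> \<open>The remainder factor has modulus at most 2, so 2 |f| dominates all partial
    sums.\<close>
  have bound: "cmod (s N y) \<le> 2 * cmod (f y)" if "y > 0" for N y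
  proof -
    have "cmod (1 - exp (- (of_nat (2 * N) * (w * of_real y)))) \<le> 1 + exp (- (real (2 * N) * (Re w * y)))"
      by (rule order_trans[OF norm_triangle_ineq4]) simp
    also have "\<dots> \<le> 2" using w that by simp
    finally have "cmod (1 - exp (- (of_nat (2 * N) * (w * of_real y)))) \<le> 2" .
    hence "cmod (f y) * cmod (1 - exp (- (of_nat (2 * N) * (w * of_real y)))) \<le> cmod (f y) * 2"
      by (rule mult_left_mono) simp
    thus ?thesis unfolding s_eq[OF that] norm_mult by (simp only: mult.commute)
  qed
  have "(\<lambda>N. LBINT y:{0<..}. s N y) \<longlonglongrightarrow> (LBINT y:{0<..}. f y)"
    unfolding set_lebesgue_integral_def
  proof (rule integral_dominated_convergence)
    show "integrable lborel (\<lambda>y. 2 * norm (indicat_real {0<..} y *\<^sub>R f y))"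
      using intf unfolding set_integrable_def by (intro integrable_mult_right integrable_norm)
    show "(\<lambda>y. indicat_real {0<..} y *\<^sub>R f y) \<in> borel_measurable lborel"
      using intf unfolding set_integrable_def by (rule borel_measurable_integrable)
    show "(\<lambda>y. indicat_real {0<..} y *\<^sub>R s N y) \<in> borel_measurable lborel" for N
    proof -
      have "set_integrable lborel {0<..} (s N)"
      proof -
        have "set_integrable lborel {0<..} (\<lambda>y. \<Sum>n<N. g n y)"
          using intg unfolding set_integrable_def scaleR_sum_right
          by (intro Bochner_Integration.integrable_sum)
        thus ?thesis unfolding s_def by (rule set_integrable_mult_right)
      qed
      thus ?thesis unfolding set_integrable_def by (rule borel_measurable_integrable)
    qed
    show "AE y in lborel. (\<lambda>N. indicat_real {0<..} y *\<^sub>R s N y) \<longlonglongrightarrow> indicat_real {0<..} y *\<^sub>R f y"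
      using lim by (auto simp: indicator_def)
    show "AE y in lborel. norm (indicat_real {0<..} y *\<^sub>R s N y) \<le> 2 * norm (indicat_real {0<..} y *\<^sub>R f y)" for N
      using bound by (auto simp: indicator_def)
  qed
  \<comment> \<open>Each of the two series diverges on its own. Inserting ln N with both signs makes
    each half converge to a Digamma value.\<close>
  moreover have "(LBINT y:{0<..}. s N y) = (\<i> / w) *
      ((of_real (ln (real N)) - (\<Sum>n<N. inverse (1 / 2 + u + of_nat n))) - (of_real (ln (real N)) - (\<Sum>n<N. inverse (1 / 2 - u + of_nat n))))" for N
  proof -
    have "(LBINT y:{0<..}. s N y) = - 4 * (\<Sum>n<N. (LBINT y:{0<..}. g n y))"
    proof -
      have "(LBINT y:{0<..}. (\<Sum>n<N. g n y)) = (\<Sum>n<N. (LBINT y:{0<..}. g n y))"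
        using intg unfolding set_lebesgue_integral_def set_integrable_def scaleR_sum_right
        by (intro Bochner_Integration.integral_sum)
      thus ?thesis by (simp only: s_def set_integral_mult_right)
    qed
    also have "\<dots> = (\<i> / w) * ((\<Sum>n<N. inverse (1 / 2 - u + of_nat n)) - (\<Sum>n<N. inverse (1 / 2 + u + of_nat n)))"
      unfolding valg using w0 by (simp add: sum_subtractf sum_divide_distrib[symmetric] field_simps)
    finally show ?thesis by simp
  qed
  moreover have "(\<lambda>N. (\<i> / w) *
      ((of_real (ln (real N)) - (\<Sum>n<N. inverse (1 / 2 + u + of_nat n))) - (of_real (ln (real N)) - (\<Sum>n<N. inverse (1 / 2 - u + of_nat n)))))
    \<longlonglongrightarrow> (\<i> / w) * (Digamma (1 / 2 + u) - Digamma (1 / 2 - u))"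
    using nz[of 0] by (intro tendsto_intros Digamma_LIMSEQ) auto
  ultimately have "(LBINT y:{0<..}. f y) = (\<i> / w) * (Digamma (1 / 2 + u) - Digamma (1 / 2 - u))"
    using LIMSEQ_unique by simp
  thus ?thesis by (simp add: f_def u_def)
qed

text \<open>By \<open>integral_sin_over_sinh\<close> the logarithmic derivative of exp (- J) is the
  negative of that of Gamma (1/2 + i z/w) Gamma (1/2 - i z/w). Their product is therefore constant
  on the strip, and the reflection formula turns the Gamma product into pi / cosh. The constant is
  determined afterwards.\<close>

lemma exp_log_cosh_integral_aux:
  assumes w: "Re w > 0"
  obtains c where "c \<noteq> 0" "\<And>z. \<bar>Im z\<bar> < Re w / 2 \<Longrightarrow>
    exp (- (LBINT y:{0<..}. log_cosh_integrand w z y)) = c * cosh (of_real pi * z / w)"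
proof -
  define S where "S = {z. \<bar>Im z\<bar> < Re w / 2}"
  have w0: "w \<noteq> 0" using w by auto
  have S_eq: "S = {z. Im z < Re w / 2} \<inter> {z. Im z > - (Re w / 2)}"
    by (auto simp: S_def)
  have "convex S" "open S" unfolding S_eq
    by (intro convex_Int convex_halfspace_Im_lt convex_halfspace_Im_gt open_Int open_halfspace_Im_lt open_halfspace_Im_gt)+
  define J where "J = (\<lambda>z. LBINT y:{0<..}. log_cosh_integrand w z y)"
  define \<Phi> where "\<Phi> = (\<lambda>z. exp (- J z) * (Gamma (1 / 2 + \<i> * z / w) * Gamma (1 / 2 - \<i> * z / w)))"
  have nonpole: "1 / 2 + \<i> * z / w \<notin> \<int>\<^sub>\<le>\<^sub>0" "1 / 2 - \<i> * z / w \<notin> \<int>\<^sub>\<le>\<^sub>0" if z: "z \<in> S" for z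
  proof -
    have "1 / 2 + \<epsilon> * \<i> * z / w \<noteq> - of_nat n" if "\<epsilon> = 1 \<or> \<epsilon> = - 1" for \<epsilon> n
    proof
      assume "1 / 2 + \<epsilon> * \<i> * z / w = - of_nat n"
      hence "\<epsilon> * \<i> * z / w = - of_nat n - 1 / 2" by (simp add: eq_diff_eq add.commute)
      hence "\<epsilon> * \<i> * z = (- of_nat n - 1 / 2) * w" using w0 by (simp add: divide_eq_eq)
      hence "2 * (\<epsilon> * \<i> * z) = 2 * ((- of_nat n - 1 / 2) * w)" by (rule arg_cong)
      moreover have "2 * ((- of_nat n - 1 / 2) * w) = - (of_nat (2 * n + 1) * w)"
        by (simp add: algebra_simps)
      ultimately have "2 * \<epsilon> * \<i> * z = - (of_nat (2 * n + 1) * w)"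
        by (simp only: mult.assoc)
      hence "Re (2 * \<epsilon> * \<i> * z) = Re (- (of_nat (2 * n + 1) * w))" by (rule arg_cong)
      hence "\<bar>2 * Im z\<bar> = \<bar>real (2 * n + 1) * Re w\<bar>" using that by auto
      moreover have "\<bar>real (2 * n + 1) * Re w\<bar> \<ge> Re w" using w by (simp add: abs_mult distrib_right)
      ultimately show False using z by (simp add: S_def)
    qed
    from this[of 1] this[of "- 1"] show "1 / 2 + \<i> * z / w \<notin> \<int>\<^sub>\<le>\<^sub>0" "1 / 2 - \<i> * z / w \<notin> \<int>\<^sub>\<le>\<^sub>0"
      by (auto elim!: nonpos_Ints_cases')
  qed
  have deriv: "(\<Phi> has_field_derivative 0) (at z)" if z: "z \<in> S" for z
  proof -
    have J': "(J has_field_derivative ((\<i> / w) * (Digamma (1 / 2 + \<i> * z / w) - Digamma (1 / 2 - \<i> * z / w)))) (at z)"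
    proof -
      have z': "\<bar>Im z\<bar> < Re w / 2" using z by (simp add: S_def)
      show ?thesis
        using log_cosh_integral_deriv(2)[OF w z'] unfolding J_def integral_sin_over_sinh[OF w z'] .
    qed
    show ?thesis
      unfolding \<Phi>_def using nonpole[OF z] w0
      by (auto intro!: derivative_eq_intros J' simp: field_simps)
  qed
  have "\<exists>K. \<forall>z\<in>S. \<Phi> z = K"
  proof (rule has_field_derivative_zero_constant[OF \<open>convex S\<close>])
    show "(\<Phi> has_field_derivative 0) (at z within S)" if "z \<in> S" for z
      using deriv[OF that] by (rule has_field_derivative_at_within)
  qed
  then obtain K where K: "\<And>z. z \<in> S \<Longrightarrow> \<Phi> z = K" by auto
  have prod: "Gamma (1 / 2 + \<i> * z / w) * Gamma (1 / 2 - \<i> * z / w) * cosh (of_real pi * z / w) = of_real pi" if "z \<in> S" for z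
  proof -
    have "Gamma (1 / 2 + \<i> * z / w) * Gamma (1 - (1 / 2 + \<i> * z / w)) = of_real pi / sin (of_real pi * (1 / 2 + \<i> * z / w))"
      by (rule Gamma_reflection_complex)
    also have "sin (of_real pi * (1 / 2 + \<i> * z / w)) = sin (of_real pi / 2 - - (\<i> * (of_real pi * z / w)))"
      by (simp add: field_simps)
    also have "\<dots> = cos (\<i> * (of_real pi * z / w))"
      by (simp only: sin_cos_eq[symmetric] sin_diff) (simp add: sin_of_real_pi_half cos_of_real_pi_half)
    also have "\<dots> = cosh (of_real pi * z / w)"
      by (simp add: cosh_def cos_exp_eq scaleR_conv_of_real field_simps)
    finally have eq: "Gamma (1 / 2 + \<i> * z / w) * Gamma (1 / 2 - \<i> * z / w) = of_real pi / cosh (of_real pi * z / w)"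
      by simp
    have "Gamma (1 / 2 + \<i> * z / w) * Gamma (1 / 2 - \<i> * z / w) \<noteq> 0"
      using nonpole[OF that] by (simp add: Gamma_eq_zero_iff)
    with eq show ?thesis by auto
  qed
  have val: "exp (- J z) = K / of_real pi * cosh (of_real pi * z / w)" if "z \<in> S" for z
  proof -
    have "exp (- J z) * of_real pi = \<Phi> z * cosh (of_real pi * z / w)"
      using prod[OF that, symmetric] by (simp add: \<Phi>_def mult_ac)
    thus ?thesis using K[OF that] by (simp add: field_simps)
  qed
  have "0 \<in> S" using w by (simp add: S_def)
  hence "K \<noteq> 0" using val[of 0] by auto
  show thesis
    by (rule that[of "K / of_real pi"]) (use val \<open>K \<noteq> 0\<close> in \<open>auto simp: S_def J_def\<close>)
qed

text \<open>The normalising constant \<open>2\<close> comes from the duplication formula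
  \<open>cosh (u + \<i> \<pi> / 4) cosh (u - \<i> \<pi> / 4) = cosh (2 u) / 2\<close>, combined with invariance of
  \<open>dy / y\<close> under scaling.\<close>

lemma exp_log_cosh_integral:
  assumes w: "Re w > 0" and z: "\<bar>Im z\<bar> < Re w / 2"
  shows "exp (- (LBINT y:{0<..}. log_cosh_integrand w z y)) = 2 * cosh (of_real pi * z / w)"
proof -
  define J where "J = (\<lambda>w z. LBINT y:{0<..}. log_cosh_integrand w z y)"
  obtain c where c: "c \<noteq> 0" "\<And>z. \<bar>Im z\<bar> < Re w / 2 \<Longrightarrow> exp (- J w z) = c * cosh (of_real pi * z / w)"
    using exp_log_cosh_integral_aux[OF w] unfolding J_def by blast
  have w0: "w \<noteq> 0" using w by auto
  have "J w 0 = J (w / 2) 0"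
  proof -
    have "J w 0 = (LBINT y. indicat_real {0<..} y *\<^sub>R log_cosh_integrand w 0 y)"
      by (simp add: J_def set_lebesgue_integral_def)
    also have "\<dots> = \<bar>1 / 2\<bar> *\<^sub>R (LBINT y. indicat_real {0<..} (0 + 1 / 2 * y) *\<^sub>R log_cosh_integrand w 0 (0 + 1 / 2 * y))"
      by (rule lborel_integral_real_affine) simp
    also have "\<dots> = (LBINT y. \<bar>1 / 2\<bar> *\<^sub>R (indicat_real {0<..} (0 + 1 / 2 * y) *\<^sub>R log_cosh_integrand w 0 (0 + 1 / 2 * y)))"
      by (rule integral_scaleR_right[symmetric])
    also have "\<dots> = J (w / 2) 0"
      unfolding J_def set_lebesgue_integral_def log_cosh_integrand_def
      by (intro Bochner_Integration.integral_cong refl) (auto simp: indicator_def scaleR_conv_of_real field_simps)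
    finally show ?thesis .
  qed
  moreover have "J (w / 2) 0 = J w (\<i> * w / 4) + J w (- (\<i> * w / 4))"
  proof -
    have "J w (\<i> * w / 4) + J w (- (\<i> * w / 4)) =
      (LBINT y:{0<..}. log_cosh_integrand w (\<i> * w / 4) y + log_cosh_integrand w (- (\<i> * w / 4)) y)"
      unfolding J_def using w by (intro set_integral_add(2)[symmetric] set_integrable_log_cosh_integrand) auto
    also have "\<dots> = J (w / 2) 0" unfolding J_def
    proof (rule set_lebesgue_integral_cong)
      show "\<forall>y. y \<in> {0<..} \<longrightarrow> log_cosh_integrand w (\<i> * w / 4) y + log_cosh_integrand w (- (\<i> * w / 4)) y
         = log_cosh_integrand (w / 2) 0 y"
      proof (intro allI impI)
        fix y :: real assume "y \<in> {0<..}"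
        hence y: "y > 0" by simp
        define v where "v = w * of_real y / 2"
        have v0: "v \<noteq> 0" using w0 y by (simp add: v_def)
        have [simp]: "2 * of_real y * (\<i> * w / 4) = \<i> * v" "w * of_real y = 2 * v" "w / 2 * of_real y = v"
          by (simp_all add: v_def field_simps)
        have "sinh (2 * v) \<noteq> 0" using sinh_of_real_mult_nonzero[OF w y] by simp
        hence nz: "sinh v \<noteq> 0" "cosh v \<noteq> 0" by (auto simp: sinh_double)
        have "cos (\<i> * v) = cosh v"
          by (simp add: cosh_conv_cos)
        hence "2 * (cos (\<i> * v) / sinh (2 * v)) = 1 / sinh v"
          using nz by (simp add: sinh_double)
        moreover have "1 / (2 * v) + 1 / (2 * v) = 1 / v" using v0 by (simp add: field_simps)
        ultimately have "(cos (\<i> * v) / sinh (2 * v) - 1 / (2 * v)) + (cos (\<i> * v) / sinh (2 * v) - 1 / (2 * v)) = 1 / sinh v - 1 / v"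
          by algebra
        thus "log_cosh_integrand w (\<i> * w / 4) y + log_cosh_integrand w (- (\<i> * w / 4)) y
         = log_cosh_integrand (w / 2) 0 y"
          unfolding log_cosh_integrand_def by (simp add: add_divide_distrib[symmetric])
      qed
    qed auto
    finally show ?thesis ..
  qed
  ultimately have "exp (- J w 0) = exp (- J w (\<i> * w / 4)) * exp (- J w (- (\<i> * w / 4)))"
    by (simp flip: exp_add)
  also have "\<dots> = c * cosh (of_real pi * (\<i> * w / 4) / w) * (c * cosh (of_real pi * (- (\<i> * w / 4)) / w))"
    using w by (simp add: c)
  also have "of_real pi * (\<i> * w / 4) / w = \<i> * of_real (pi / 4)"
    using w0 by (simp add: field_simps)
  also have "of_real pi * (- (\<i> * w / 4)) / w = - (\<i> * of_real (pi / 4))"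
    using w0 by (simp add: field_simps)
  also have "cosh (- (\<i> * of_real (pi / 4))) = cosh (\<i> * of_real (pi / 4) :: complex)" by simp
  also have "cosh (\<i> * of_real (pi / 4) :: complex) = of_real (cos (pi / 4))"
    unfolding cosh_conv_cos by (simp flip: mult.assoc) (simp flip: cos_of_real)
  also have "exp (- J w 0) = c" using c(2)[of 0] w by simp
  finally have "c = c * c * (of_real (cos (pi / 4)) * of_real (cos (pi / 4)))" by (simp add: mult_ac)
  also have "(of_real (cos (pi / 4)) * of_real (cos (pi / 4)) :: complex) = of_real (cos (pi / 4) * cos (pi / 4))"
    by simp
  also have "cos (pi / 4) * cos (pi / 4) = 1 / 2" by (simp add: cos_45)
  finally have "c = 2" using c(1) by simp
  thus ?thesis using c(2)[OF z] by (simp add: J_def)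
qed

text \<open>The condition on z places both z + i w1/2 and z - i w1/2 in the strip of convergence, so
  the two exponents may be subtracted under one integral.\<close>

lemma hyp_gamma_strip_shift:
  assumes w: "Re w1 > 0" "Re w2 > 0" and z: "\<bar>Im z\<bar> < Re w2 / 2"
  shows "hyp_gamma_strip w1 w2 (z + \<i> * w1 / 2) = 2 * cosh (of_real pi * z / w2) * hyp_gamma_strip w1 w2 (z - \<i> * w1 / 2)"
proof -
  have int: "set_integrable lborel {0<..} (hyp_gamma_integrand w1 w2 (z + \<i> * w1 / 2))"
            "set_integrable lborel {0<..} (hyp_gamma_integrand w1 w2 (z - \<i> * w1 / 2))"
  proof -
    have "\<bar>x + a / 2\<bar> < (a + b) / 2 \<and> \<bar>x - a / 2\<bar> < (a + b) / 2" if "\<bar>x\<bar> < b / 2" "a > 0" "b > 0" for x a b :: real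
      using that by (auto simp: abs_less_iff field_simps)
    from this[OF z w] have "\<bar>Im z + Re w1 / 2\<bar> < (Re w1 + Re w2) / 2" "\<bar>Im z - Re w1 / 2\<bar> < (Re w1 + Re w2) / 2"
      by blast+
    thus "set_integrable lborel {0<..} (hyp_gamma_integrand w1 w2 (z + \<i> * w1 / 2))"
         "set_integrable lborel {0<..} (hyp_gamma_integrand w1 w2 (z - \<i> * w1 / 2))"
      by (auto intro!: set_integrable_hyp_gamma_integrand w simp: wmean_def)
  qed
  have "(LBINT y:{0<..}. hyp_gamma_integrand w1 w2 (z + \<i> * w1 / 2) y) - (LBINT y:{0<..}. hyp_gamma_integrand w1 w2 (z - \<i> * w1 / 2) y)
     = (LBINT y:{0<..}. hyp_gamma_integrand w1 w2 (z + \<i> * w1 / 2) y - hyp_gamma_integrand w1 w2 (z - \<i> * w1 / 2) y)"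
    using int by (rule set_integral_diff(2)[symmetric])
  also have "\<dots> = (LBINT y:{0<..}. \<i> * log_cosh_integrand w2 z y)"
    by (rule set_lebesgue_integral_cong) (auto simp: hyp_gamma_integrand_shift[OF w])
  also have "\<dots> = \<i> * (LBINT y:{0<..}. log_cosh_integrand w2 z y)" by simp
  finally have *: "\<i> * (LBINT y:{0<..}. hyp_gamma_integrand w1 w2 (z + \<i> * w1 / 2) y) =
     - (LBINT y:{0<..}. log_cosh_integrand w2 z y) + \<i> * (LBINT y:{0<..}. hyp_gamma_integrand w1 w2 (z - \<i> * w1 / 2) y)"
    by (metis (no_types, opaque_lifting) complex_i_mult_minus diff_add_cancel distrib_left)
  show ?thesis
    unfolding hyp_gamma_strip_eq exp_log_cosh_integral[OF w(2) z, symmetric] by (simp only: * exp_add)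
qed

section \<open>Meromorphic continuation of the hyperbolic gamma function\<close>

text \<open>The difference is zero off a sparse set or nonzero off a sparse set; the open set
  \<open>U\<close> excludes the second case.\<close>

lemma meromorphic_eq_cosparse:
  assumes "f meromorphic_on UNIV" "g meromorphic_on UNIV"
    and U: "open U" "p \<in> U" "\<And>z. z \<in> U \<Longrightarrow> f z = g z"
  shows "\<forall>\<^sub>\<approx>z. f z = g z"
proof -
  have "(\<lambda>z. f z - g z) meromorphic_on UNIV" using assms by (intro meromorphic_intros)
  from meromorphic_imp_constant_or_avoid[OF this, of 0]
  consider "\<forall>\<^sub>\<approx>z. f z - g z = 0" | "\<forall>\<^sub>\<approx>z. f z - g z \<noteq> 0" by auto
  thus ?thesis
  proof cases
    case 2
    hence "\<forall>\<^sub>F z in at p. f z - g z \<noteq> 0" by (simp add: eventually_cosparse_open_eq)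
    moreover have "\<forall>\<^sub>F z in at p. z \<in> U" using U by (intro eventually_at_in_open')
    ultimately have "\<forall>\<^sub>F z in at p. False" by eventually_elim (use U in auto)
    thus ?thesis by simp
  qed simp
qed

text \<open>At a common pole both values are 0 by normalisation, elsewhere both are limits; so
  equality around a point passes to the point.\<close>

lemma nicely_meromorphic_eqI:
  assumes "f nicely_meromorphic_on UNIV" "g nicely_meromorphic_on UNIV" "\<forall>\<^sub>F z in at z0. f z = g z"
  shows "f z0 = g z0"
proof -
  have f: "(is_pole f z0 \<and> f z0 = 0) \<or> f \<midarrow>z0\<rightarrow> f z0" and g: "(is_pole g z0 \<and> g z0 = 0) \<or> g \<midarrow>z0\<rightarrow> g z0"
    using assms(1,2) by (auto simp: nicely_meromorphic_on_def)
  have pole: "is_pole f z0 \<longleftrightarrow> is_pole g z0"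
    by (rule is_pole_cong[OF assms(3) refl])
  show ?thesis
  proof (cases "is_pole f z0")
    case True
    have "\<not> f \<midarrow>z0\<rightarrow> f z0" "\<not> g \<midarrow>z0\<rightarrow> g z0"
      using True pole not_tendsto_and_filterlim_at_infinity[of "at z0"] unfolding is_pole_def by auto
    thus ?thesis using f g by auto
  next
    case False
    hence "f \<midarrow>z0\<rightarrow> f z0" "g \<midarrow>z0\<rightarrow> g z0" using f g pole by auto
    moreover from this(1) have "g \<midarrow>z0\<rightarrow> f z0" using tendsto_cong[OF assms(3)] by blast
    ultimately show ?thesis using LIM_unique by blast
  qed
qed

lemma nicely_meromorphic_eqI_open:
  assumes "f nicely_meromorphic_on UNIV" "g nicely_meromorphic_on UNIV"
    and U: "open U" "z0 \<in> U" "\<And>z. z \<in> U \<Longrightarrow> f z = g z"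
  shows "f = g"
proof
  fix z
  have "\<forall>\<^sub>\<approx>z. f z = g z"
    using assms by (intro meromorphic_eq_cosparse[of f g U z0]) (auto simp: nicely_meromorphic_on_def)
  hence "\<forall>\<^sub>F z in at z. f z = g z" by (simp add: eventually_cosparse_open_eq)
  thus "f z = g z" by (rule nicely_meromorphic_eqI[OF assms(1,2)])
qed

lemma open_Im_strip: "open {z. \<bar>Im z - a\<bar> < R}"
proof -
  have "{z. \<bar>Im z - a\<bar> < R} = {z. Im z < a + R} \<inter> {z. Im z > a - R}" by auto
  thus ?thesis by (auto intro: open_Int open_halfspace_Im_lt open_halfspace_Im_gt)
qed

lemma hyp_gamma_strip_nonzero: "hyp_gamma_strip w1 w2 z \<noteq> 0"
  by (simp add: hyp_gamma_strip_eq)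

lemma hyp_gamma_strip_commute: "hyp_gamma_strip w1 w2 = hyp_gamma_strip w2 w1"
  by (simp add: hyp_gamma_strip_def fun_eq_iff mult_ac)

lemma wmean_commute: "wmean w1 w2 = wmean w2 w1"
  by (simp add: wmean_def add.commute)

text \<open>The strip has height Re w1 + Re w2, more than the step Re w1, so its translates by n i
  w1 cover the plane with overlaps. On each translate the difference equation, applied n times,
  prescribes the function; agreement on overlaps is the strip equation itself.\<close>

lemma hyp_gamma_meromorphic_extension:
  assumes w: "Re w1 > 0" "Re w2 > 0"
  obtains G where "G meromorphic_on UNIV" "\<And>z. \<bar>Im z\<bar> < Re (wmean w1 w2) \<Longrightarrow> G z = hyp_gamma_strip w1 w2 z"
proof -
  define a1 where "a1 = Re w1"
  define a2 where "a2 = Re w2"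
  define R where "R = (a1 + a2) / 2"
  have a: "a1 > 0" "a2 > 0" using w by (auto simp: a1_def a2_def)
  have R: "Re (wmean w1 w2) = R" by (simp add: wmean_def R_def a1_def a2_def)
  define G0 where "G0 = hyp_gamma_strip w1 w2"
  define c where "c = (\<lambda>z. 2 * cosh (of_real pi * z / w2))"
  have w20: "w2 \<noteq> 0" using w by auto
  have c_mero: "(\<lambda>z. c (z + b)) meromorphic_on A" for A b
    unfolding c_def cosh_field_def using w20
    by (intro analytic_on_imp_meromorphic_on analytic_intros) auto
  have c_mero': "(\<lambda>z. c (z - b)) meromorphic_on A" for A b
    using c_mero[of "- b"] by simp
  \<comment> \<open>\<open>P n\<close> collects the cosh factors of n steps upwards, or the
    reciprocals for steps downwards.\<close>
  define P where "P = (\<lambda>n z. if n \<ge> 0 then \<Prod>k<nat n. c (z + - (\<i> * (of_nat k + 1 / 2) * w1))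
     else \<Prod>k<nat (- n). inverse (c (z + \<i> * (of_nat k + 1 / 2) * w1)))"
  have P_mero: "P n meromorphic_on A" for n A
    unfolding P_def by (cases "n \<ge> 0") (auto intro!: meromorphic_on_prod meromorphic_on_inverse c_mero c_mero')
  define H where "H = (\<lambda>n z. P n z * G0 (z - of_int n * (\<i> * w1)))"
  have P_Suc: "P (n + 1) z = P n z * c (z - \<i> * (of_int n + 1 / 2) * w1)"
    if "c (z - \<i> * (of_int n + 1 / 2) * w1) \<noteq> 0" for n z
  proof (cases "n \<ge> 0")
    case True
    hence "nat (n + 1) = Suc (nat n)" by simp
    thus ?thesis using True by (simp add: P_def)
  next
    case False
    define m where "m = nat (- n - 1)"
    have m: "nat (- n) = Suc m" "nat (- (n + 1)) = m" "of_int n = (- of_nat (Suc m) :: complex)"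
      using False by (auto simp: m_def)
    have e: "z - \<i> * (of_int n + 1 / 2) * w1 = z + \<i> * (of_nat m + 1 / 2) * w1"
      unfolding m by (simp add: algebra_simps)
    have "P n z = P (n + 1) z * inverse (c (z + \<i> * (of_nat m + 1 / 2) * w1))"
    proof (cases "n + 1 \<ge> 0")
      case True
      hence "m = 0" "n = - 1" using False by (auto simp: m_def)
      thus ?thesis by (simp add: P_def)
    next
      case nn: False
      thus ?thesis using False m by (simp add: P_def m_def[symmetric])
    qed
    thus ?thesis using that unfolding e by simp
  qed
  have H_Suc: "H n z = H (n + 1) z" if "\<bar>Im z - of_int n * a1\<bar> < R" "\<bar>Im z - of_int (n + 1) * a1\<bar> < R" for n z
  proof -
    define u where "u = z - \<i> * (of_int n + 1 / 2) * w1"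
    have Im_u: "Im u = Im z - of_int n * a1 - a1 / 2"
      by (simp add: u_def a1_def algebra_simps)
    \<comment> \<open>Lying in both neighbouring strips means that the midpoint u is in the range of
      \<open>hyp_gamma_strip_shift\<close>.\<close>
    have "\<bar>Im u\<bar> < a2 / 2"
    proof -
      define p where "p = Im z - of_int n * a1"
      have "p < R" "- R < p - a1"
        using that by (auto simp: p_def abs_less_iff algebra_simps)
      thus ?thesis unfolding Im_u p_def[symmetric] R_def by (auto simp: abs_less_iff field_simps)
    qed
    hence eq: "G0 (u + \<i> * w1 / 2) = c u * G0 (u - \<i> * w1 / 2)"
      unfolding G0_def c_def a2_def by (rule hyp_gamma_strip_shift[OF w])
    \<comment> \<open>The strip function is an exponential and has no zeros, so the equation rules
      out a zero of the cosh factor here.\<close>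
    hence "c u \<noteq> 0" using hyp_gamma_strip_nonzero[of w1 w2] by (auto simp: G0_def)
    hence "P (n + 1) z = P n z * c u" unfolding u_def by (rule P_Suc)
    moreover have "u + \<i> * w1 / 2 = z - of_int n * (\<i> * w1)" "u - \<i> * w1 / 2 = z - of_int (n + 1) * (\<i> * w1)"
      by (simp_all add: u_def algebra_simps)
    ultimately show ?thesis using eq by (simp add: H_def)
  qed
  have H_le: "\<bar>Im z - of_int m * a1\<bar> < R \<longrightarrow> H n z = H m z" if "n \<le> m" "\<bar>Im z - of_int n * a1\<bar> < R" for n m z
    using that(1)
  proof (induction m rule: int_ge_induct)
    case (step m)
    show ?case
    proof
      assume *: "\<bar>Im z - of_int (m + 1) * a1\<bar> < R"
      \<comment> \<open>A point of the strips n and m + 1 also lies in strip m, so the induction can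
        pass through every strip in between.\<close>
      have "of_int n * a1 \<le> of_int m * a1" "of_int m * a1 \<le> of_int (m + 1) * a1"
        using step a by (auto intro!: mult_right_mono)
      hence "\<bar>Im z - of_int m * a1\<bar> < R" using * that(2) by linarith
      thus "H n z = H (m + 1) z" using step H_Suc[OF _ *] by simp
    qed
  qed simp
  have H_eq: "H n z = H m z" if "\<bar>Im z - of_int n * a1\<bar> < R" "\<bar>Im z - of_int m * a1\<bar> < R" for n m z
  proof (cases "n \<le> m")
    case True
    show ?thesis using H_le[OF True that(1)] that(2) by blast
  next
    case False
    hence "m \<le> n" by simp
    from H_le[OF this that(2)] that(1) show ?thesis by metis
  qed
  \<comment> \<open>Rounding selects the nearest strip centre; by \<open>H_eq\<close> every other
    strip that contains z gives the same value.\<close>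
  define G where "G = (\<lambda>z. H (round (Im z / a1)) z)"
  have near: "\<bar>Im z - of_int (round (Im z / a1)) * a1\<bar> < R" for z
  proof -
    have "\<bar>of_int (round (Im z / a1)) - Im z / a1\<bar> * a1 \<le> 1 / 2 * a1"
      using a of_int_round_abs_le[of "Im z / a1"] by (intro mult_right_mono) auto
    also have "\<bar>of_int (round (Im z / a1)) - Im z / a1\<bar> * a1 = \<bar>(of_int (round (Im z / a1)) - Im z / a1) * a1\<bar>"
      using a by (simp add: abs_mult)
    also have "(of_int (round (Im z / a1)) - Im z / a1) * a1 = of_int (round (Im z / a1)) * a1 - Im z"
      using a by (simp add: field_simps)
    finally have "\<bar>Im z - of_int (round (Im z / a1)) * a1\<bar> \<le> a1 / 2" by (simp add: abs_minus_commute)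
    thus ?thesis using a by (simp add: R_def)
  qed
  show thesis
  proof (rule that)
    show "G z = hyp_gamma_strip w1 w2 z" if "\<bar>Im z\<bar> < Re (wmean w1 w2)" for z
    proof -
      have "G z = H 0 z" unfolding G_def using that near[of z] by (intro H_eq) (auto simp: R)
      thus ?thesis by (simp add: H_def P_def G0_def)
    qed
    have "G meromorphic_on {z0}" for z0
    proof -
      define n where "n = round (Im z0 / a1)"
      define T where "T = {z. \<bar>Im z - of_int n * a1\<bar> < R}"
      have T: "open T" "z0 \<in> T" using near[of z0] by (auto simp: T_def n_def open_Im_strip)
      have "(\<lambda>z. G0 (z - of_int n * (\<i> * w1))) holomorphic_on T"
        unfolding G0_def
        by (rule holomorphic_on_compose_gen[OF _ holomorphic_on_hyp_gamma_strip[OF w], unfolded o_def])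
           (auto intro!: holomorphic_intros simp: T_def R a1_def)
      hence "(\<lambda>z. G0 (z - of_int n * (\<i> * w1))) meromorphic_on T"
        using T by (intro analytic_on_imp_meromorphic_on) (simp add: analytic_on_open)
      hence "H n meromorphic_on T" unfolding H_def by (intro meromorphic_on_mult P_mero)
      hence "H n meromorphic_on {z0}" using T by (elim meromorphic_on_subset) auto
      moreover have "\<forall>\<^sub>F z in at z0. G z = H n z"
      proof -
        have "\<forall>\<^sub>F z in at z0. z \<in> T" using T by (intro eventually_at_in_open')
        thus ?thesis by eventually_elim (use near in \<open>auto simp: G_def T_def intro!: H_eq\<close>)
      qed
      ultimately show ?thesis by (subst meromorphic_on_cong[of _ _ "H n"]) auto
    qed
    thus "G meromorphic_on UNIV" using meromorphic_on_meromorphic_at by blast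
  qed
qed

section \<open>Existence, uniqueness and symmetry of the hyperbolic gamma function\<close>

definition is_hyp_gamma :: "complex \<Rightarrow> complex \<Rightarrow> (complex \<Rightarrow> complex) \<Rightarrow> bool" where
  "is_hyp_gamma w1 w2 G \<longleftrightarrow> G nicely_meromorphic_on UNIV \<and>
        (\<forall>z. \<bar>Im z\<bar> < Re (wmean w1 w2) \<longrightarrow> G z = hyp_gamma_strip w1 w2 z) \<and>
        (\<forall>\<^sub>\<approx>z. G (z + \<i> * w1 / 2) = 2 * cosh (of_real pi * z / w2) * G (z - \<i> * w1 / 2)) \<and>
        (\<forall>\<^sub>\<approx>z. G (z + \<i> * w2 / 2) = 2 * cosh (of_real pi * z / w1) * G (z - \<i> * w2 / 2))"

lemma is_hyp_gamma_commute: "is_hyp_gamma w1 w2 = is_hyp_gamma w2 w1"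
  by (auto simp: is_hyp_gamma_def fun_eq_iff wmean_commute[of w1] hyp_gamma_strip_commute[of w1])

lemma hyp_gamma_eq_The: "hyp_gamma w1 w2 = (THE G. is_hyp_gamma w1 w2 G)"
  unfolding hyp_gamma_def is_hyp_gamma_def ..

lemma hyp_gamma_commute: "hyp_gamma w1 w2 = hyp_gamma w2 w1"
  unfolding hyp_gamma_eq_The by (subst is_hyp_gamma_commute) simp

text \<open>The extension was built from translates by i w1 alone. Both difference equations still
  follow: each holds on a substrip, because the strip integral is symmetric in the periods, and the
  identity theorem spreads it over the plane. \<open>remove_sings\<close> supplies the
  normalisation, and uniqueness is read off on the strip.\<close>

lemma is_hyp_gamma_hyp_gamma:
  assumes w: "Re w1 > 0" "Re w2 > 0"
  shows "is_hyp_gamma w1 w2 (hyp_gamma w1 w2)"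
proof -
  define S where "S = {z. \<bar>Im z\<bar> < Re (wmean w1 w2)}"
  have S: "open S" "0 \<in> S"
    using open_Im_strip[of 0 "Re (wmean w1 w2)"] w unfolding S_def by (simp, simp add: wmean_def)
  obtain G1 where G1: "G1 meromorphic_on UNIV" "\<And>z. z \<in> S \<Longrightarrow> G1 z = hyp_gamma_strip w1 w2 z"
    using hyp_gamma_meromorphic_extension[OF w] unfolding S_def by auto
  define G where "G = remove_sings G1"
  have nice: "G nicely_meromorphic_on UNIV"
    unfolding G_def by (rule remove_sings_nicely_meromorphic[OF G1(1)])
  have strip: "G z = hyp_gamma_strip w1 w2 z" if z: "z \<in> S" for z
  proof -
    have "hyp_gamma_strip w1 w2 analytic_on S"
      unfolding S_def using holomorphic_on_hyp_gamma_strip[OF w] S by (simp add: analytic_on_open S_def)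
    hence "hyp_gamma_strip w1 w2 analytic_on {z}" using z by (elim analytic_on_subset) auto
    moreover have "\<forall>\<^sub>F x in nhds z. hyp_gamma_strip w1 w2 x = G1 x"
      using eventually_nhds_in_open[OF S(1) z] by eventually_elim (simp add: G1)
    ultimately have "G1 analytic_on {z}" using analytic_at_cong by blast
    thus ?thesis using G1(2)[OF z] by (simp add: G_def)
  qed
  have shift: "\<forall>\<^sub>\<approx>z. G (z + \<i> * v1 / 2) = 2 * cosh (of_real pi * z / v2) * G (z - \<i> * v1 / 2)"
    if v: "Re v1 > 0" "Re v2 > 0" "wmean v1 v2 = wmean w1 w2" "hyp_gamma_strip v1 v2 = hyp_gamma_strip w1 w2" for v1 v2
  proof (rule meromorphic_eq_cosparse[where p = 0])
    have mero: "G meromorphic_on A" for A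
      using nice by (auto simp: nicely_meromorphic_on_def intro: meromorphic_on_subset)
    have v20: "v2 \<noteq> 0" using v by auto
    show "(\<lambda>z. G (z + \<i> * v1 / 2)) meromorphic_on UNIV"
      by (rule meromorphic_on_compose[OF mero]) (auto intro!: analytic_intros)
    have "(\<lambda>z. G (z - \<i> * v1 / 2)) meromorphic_on UNIV"
      by (rule meromorphic_on_compose[OF mero]) (auto intro!: analytic_intros)
    moreover have "(\<lambda>z. 2 * cosh (of_real pi * z / v2)) meromorphic_on UNIV"
      unfolding cosh_field_def using v20 by (intro analytic_on_imp_meromorphic_on analytic_intros) auto
    ultimately show "(\<lambda>z. 2 * cosh (of_real pi * z / v2) * G (z - \<i> * v1 / 2)) meromorphic_on UNIV"
      by (rule meromorphic_on_mult[rotated])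
    show "open {z. \<bar>Im z - 0\<bar> < Re v2 / 2}" by (rule open_Im_strip)
    show "0 \<in> {z. \<bar>Im z - 0\<bar> < Re v2 / 2}" using v by simp
    fix z assume "z \<in> {z. \<bar>Im z - 0\<bar> < Re v2 / 2}"
    hence z: "\<bar>Im z\<bar> < Re v2 / 2" by simp
    have "\<bar>x + a / 2\<bar> < (a + b) / 2 \<and> \<bar>x - a / 2\<bar> < (a + b) / 2" if "\<bar>x\<bar> < b / 2" "a > 0" "b > 0" for x a b :: real
      using that by (auto simp: abs_less_iff field_simps)
    from this[OF z v(1,2)] have "z + \<i> * v1 / 2 \<in> S" "z - \<i> * v1 / 2 \<in> S"
      unfolding S_def v(3)[symmetric] by (auto simp: wmean_def)
    thus "G (z + \<i> * v1 / 2) = 2 * cosh (of_real pi * z / v2) * G (z - \<i> * v1 / 2)"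
      using hyp_gamma_strip_shift[OF v(1,2) z] v(4) by (simp add: strip)
  qed
  have ex: "is_hyp_gamma w1 w2 G"
    unfolding is_hyp_gamma_def using nice strip shift[OF w] shift[OF w(2,1)]
    by (auto simp: S_def wmean_commute[of w2] hyp_gamma_strip_commute[of w2])
  show ?thesis
    unfolding hyp_gamma_eq_The
  proof (rule theI[of "is_hyp_gamma w1 w2", OF ex])
    fix G' assume G': "is_hyp_gamma w1 w2 G'"
    show "G' = G"
      using G' ex S strip unfolding is_hyp_gamma_def
      by (intro nicely_meromorphic_eqI_open[of G' G S 0]) (auto simp: S_def)
  qed
qed

lemma hyp_gamma_eq_strip:
  assumes "Re w1 > 0" "Re w2 > 0" "\<bar>Im z\<bar> < Re (wmean w1 w2)"
  shows "hyp_gamma w1 w2 z = hyp_gamma_strip w1 w2 z"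
  using is_hyp_gamma_hyp_gamma[OF assms(1,2)] assms(3) by (simp add: is_hyp_gamma_def)

text \<open>Where the cosh factor is nonzero, the two sides have a pole together, with value 0 on
  both, or are continuous together. At a zero of the factor a pole could be cancelled and the values
  could differ.\<close>

lemma hyp_gamma_shift:
  assumes w: "Re w1 > 0" "Re w2 > 0" and nz: "cosh (of_real pi * z / w2) \<noteq> 0"
  shows "hyp_gamma w1 w2 (z + \<i> * w1 / 2) = 2 * cosh (of_real pi * z / w2) * hyp_gamma w1 w2 (z - \<i> * w1 / 2)"
proof -
  define G where "G = hyp_gamma w1 w2"
  define c where "c = (\<lambda>z. 2 * cosh (of_real pi * z / w2))"
  have w20: "w2 \<noteq> 0" using w by auto
  have nice: "G nicely_meromorphic_on UNIV"
    and shift: "\<forall>\<^sub>\<approx>z. G (z + \<i> * w1 / 2) = c z * G (z - \<i> * w1 / 2)"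
    using is_hyp_gamma_hyp_gamma[OF w] by (auto simp: is_hyp_gamma_def G_def c_def)
  have ev: "\<forall>\<^sub>F u in at z. G (u + \<i> * w1 / 2) = c u * G (u - \<i> * w1 / 2)"
    using shift by (simp add: eventually_cosparse_open_eq)
  have cz: "c \<midarrow>z\<rightarrow> c z" "c z \<noteq> 0"
  proof -
    have "isCont c z" unfolding c_def cosh_field_def using w20 by (intro continuous_intros) auto
    thus "c \<midarrow>z\<rightarrow> c z" by (rule isContD)
    show "c z \<noteq> 0" using nz by (simp add: c_def)
  qed
  have dich: "(filterlim (\<lambda>u. G (u + b)) at_infinity (at z) \<and> G (z + b) = 0) \<or> (\<lambda>u. G (u + b)) \<midarrow>z\<rightarrow> G (z + b)" for b
  proof -
    have "filterlim G F (at (z + b)) \<longleftrightarrow> filterlim (\<lambda>u. G (u + b)) F (at z)" for F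
      unfolding at_to_0[of "z + b"] at_to_0[of z] filterlim_filtermap by (simp add: add_ac)
    moreover have "(is_pole G (z + b) \<and> G (z + b) = 0) \<or> G \<midarrow>z + b\<rightarrow> G (z + b)"
      using nice by (auto simp: nicely_meromorphic_on_def)
    ultimately show ?thesis by (simp add: is_pole_def)
  qed
  note not_both = not_tendsto_and_filterlim_at_infinity[of "at z"]
  have "G (z + \<i> * w1 / 2) = c z * G (z - \<i> * w1 / 2)"
  proof (cases "(\<lambda>u. G (u - \<i> * w1 / 2)) \<midarrow>z\<rightarrow> G (z - \<i> * w1 / 2)")
    case True
    hence "(\<lambda>u. c u * G (u - \<i> * w1 / 2)) \<midarrow>z\<rightarrow> c z * G (z - \<i> * w1 / 2)"
      by (intro tendsto_mult cz)
    hence *: "(\<lambda>u. G (u + \<i> * w1 / 2)) \<midarrow>z\<rightarrow> c z * G (z - \<i> * w1 / 2)"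
      using tendsto_cong[OF ev] by blast
    hence "(\<lambda>u. G (u + \<i> * w1 / 2)) \<midarrow>z\<rightarrow> G (z + \<i> * w1 / 2)"
      using dich[of "\<i> * w1 / 2"] not_both[OF _ *] by auto
    thus ?thesis using * LIM_unique by blast
  next
    case False
    hence inf: "filterlim (\<lambda>u. G (u - \<i> * w1 / 2)) at_infinity (at z)" "G (z - \<i> * w1 / 2) = 0"
      using dich[of "- (\<i> * w1 / 2)"] by auto
    have "filterlim (\<lambda>u. c u * G (u - \<i> * w1 / 2)) at_infinity (at z)"
      by (rule tendsto_mult_filterlim_at_infinity[OF cz inf(1)])
    hence "filterlim (\<lambda>u. G (u + \<i> * w1 / 2)) at_infinity (at z)"
      using filterlim_cong[OF refl refl ev] by blast
    hence "G (z + \<i> * w1 / 2) = 0" using dich[of "\<i> * w1 / 2"] not_both by auto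
    thus ?thesis using inf(2) by simp
  qed
  thus ?thesis by (simp add: G_def c_def)
qed

section \<open>Growth along horizontal lines and contour shifts\<close>

lemma set_lebesgue_integral_bound_inverse_square:
  fixes f :: "real \<Rightarrow> complex"
  assumes "\<And>y. y > 0 \<Longrightarrow> cmod (f y) \<le> C / (1 + y\<^sup>2)" "C \<ge> 0"
  shows "cmod (LBINT y:{0<..}. f y) \<le> (LBINT y. C / (1 + y\<^sup>2))"
proof (cases "set_integrable lborel {0<..} f")
  case True
  have "cmod (LBINT y:{0<..}. f y) \<le> (LBINT y. norm (indicat_real {0<..} y *\<^sub>R f y))"
    unfolding set_lebesgue_integral_def by (rule integral_norm_bound)
  also have "\<dots> \<le> (LBINT y. C / (1 + y\<^sup>2))"
  proof (rule integral_mono)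
    show "integrable lborel (\<lambda>y. norm (indicat_real {0<..} y *\<^sub>R f y))"
      using True unfolding set_integrable_def by (rule integrable_norm)
    show "norm (indicat_real {0<..} y *\<^sub>R f y) \<le> C / (1 + y\<^sup>2)" for y
      using assms by (cases "y > 0") auto
  qed (rule integrable_inverse_one_plus_square)
  finally show ?thesis .
next
  case False
  \<comment> \<open>Without integrability the integral is 0 by default, so the bound holds here
    too.\<close>
  hence "(LBINT y:{0<..}. f y) = 0"
    unfolding set_lebesgue_integral_def set_integrable_def by (rule not_integrable_integral_eq)
  moreover have "(LBINT y. C / (1 + y\<^sup>2)) \<ge> 0"
    using assms(2) by (intro Bochner_Integration.integral_nonneg) auto
  ultimately show ?thesis by simp
qed

lemma sinh_complex_of_real: "sinh (complex_of_real x) = of_real (sinh x)"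
  by (simp add: sinh_field_def flip: exp_of_real)

text \<open>On real \<open>t\<close> the modulus of \<open>G(t + i a)\<close> is compared with a power of \<open>2 cosh (\<pi> t)\<close>: after
  taking real parts, the integrand of the difference of logarithms is \<open>cos (2 y t)\<close> times its
  value at \<open>t = 0\<close>, so the error is bounded uniformly in \<open>t\<close>.\<close>

lemma ln_norm_hyp_gamma_bound:
  fixes w1 w2 a0 :: real
  assumes w: "w1 > 0" "w2 > 0" and a0: "a0 < (w1 + w2) / 2"
  obtains C where "C \<ge> 0" "\<And>a t. \<bar>a\<bar> \<le> a0 \<Longrightarrow>
    \<bar>ln (cmod (hyp_gamma w1 w2 (of_real t + \<i> * of_real a))) - a / (w1 * w2) * ln (2 * cosh (pi * t))\<bar> \<le> C"
proof -
  define F where "F = (\<lambda>z y. hyp_gamma_integrand (of_real w1) (of_real w2) z y)"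
  define J where "J = (\<lambda>t y. log_cosh_integrand 1 (of_real t) y)"
  have Rew: "Re (complex_of_real w1) > 0" "Re (complex_of_real w2) > 0" "a0 < Re (wmean (of_real w1) (of_real w2))"
    using w a0 by (auto simp: wmean_def)
  obtain C1 where C1: "C1 \<ge> 0" "\<And>z y. y > 0 \<Longrightarrow> cmod z \<le> a0 \<Longrightarrow> \<bar>Im z\<bar> \<le> a0 \<Longrightarrow> cmod (F z y) \<le> C1 / (1 + y\<^sup>2)"
    unfolding F_def using hyp_gamma_integrand_bound[OF Rew, of a0] by metis
  obtain C2 where C2: "C2 \<ge> 0" "\<And>y. y > 0 \<Longrightarrow> cmod (J 0 y) \<le> C2 / (1 + y\<^sup>2)"
  proof (rule log_cosh_integrand_bound[of 1 0 0])
    fix C assume "0 \<le> C" "\<And>z y. 0 < y \<Longrightarrow> cmod z \<le> 0 \<Longrightarrow> \<bar>Im z\<bar> \<le> 0 \<Longrightarrow> cmod (log_cosh_integrand 1 z y) \<le> C / (1 + y\<^sup>2)"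
    thus thesis by (intro that[of C]) (auto simp: J_def)
  qed auto
  define C where "C = C1 + a0 / (w1 * w2) * C2"
  show thesis
  proof (rule that[of "\<bar>LBINT y. C / (1 + y\<^sup>2)\<bar>"])
    fix a t :: real assume a: "\<bar>a\<bar> \<le> a0"
    define k where "k = a / (w1 * w2)"
    define z where "z = of_real t + \<i> * of_real a"
    have aR: "\<bar>Im z\<bar> < Re (wmean (of_real w1) (of_real w2))" using a Rew by (simp add: z_def)
    have C: "C \<ge> 0" "\<bar>k\<bar> * C2 \<le> a0 / (w1 * w2) * C2"
      unfolding C_def k_def using C1(1) C2(1) a w by (auto simp: abs_mult intro!: add_nonneg_nonneg mult_right_mono divide_right_mono)
    have G: "hyp_gamma w1 w2 z = exp (\<i> * (LBINT y:{0<..}. F z y))"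
      unfolding F_def using hyp_gamma_eq_strip[OF Rew(1,2) aR] by (simp add: hyp_gamma_strip_eq)
    have ln1: "ln (cmod (hyp_gamma w1 w2 z)) = - Im (LBINT y:{0<..}. F z y)"
      unfolding G by simp
    have "exp (- (LBINT y:{0<..}. J t y)) = of_real (2 * cosh (pi * t))"
      unfolding J_def by (subst exp_log_cosh_integral) (auto simp: cosh_field_def exp_of_real[symmetric])
    hence "cmod (exp (- (LBINT y:{0<..}. J t y))) = cmod (of_real (2 * cosh (pi * t)))" by simp
    hence "exp (- Re (LBINT y:{0<..}. J t y)) = 2 * cosh (pi * t)"
      by (simp only: norm_exp_eq_Re uminus_complex.sel norm_of_real) simp
    hence ln2: "ln (2 * cosh (pi * t)) = - Re (LBINT y:{0<..}. J t y)"
      by (metis ln_exp)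
    have intF: "set_integrable lborel {0<..} (F z)"
      unfolding F_def by (rule set_integrable_hyp_gamma_integrand[OF Rew(1,2) aR])
    have intJ: "set_integrable lborel {0<..} (J t)"
      unfolding J_def by (rule set_integrable_log_cosh_integrand) auto
    have "(LBINT y:{0<..}. \<i> * F z y + of_real k * J t y) = \<i> * (LBINT y:{0<..}. F z y) + of_real k * (LBINT y:{0<..}. J t y)"
      using intF intJ by (subst set_integral_add(2)) auto
    hence eq: "ln (cmod (hyp_gamma w1 w2 z)) - k * ln (2 * cosh (pi * t)) = Re (LBINT y:{0<..}. \<i> * F z y + of_real k * J t y)"
      unfolding ln1 ln2 by simp
    have pt: "Re (\<i> * F z y + of_real k * J t y) = cos (2 * y * t) * Re (\<i> * F (\<i> * of_real a) y + of_real k * J 0 y)"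
      if y: "y > 0" for y
    proof -
      define s where "s = 2 * sinh (w1 * y) * sinh (w2 * y)"
      have s: "2 * sinh (of_real w1 * of_real y) * sinh (of_real w2 * of_real y) = complex_of_real s"
        unfolding s_def by (simp flip: sinh_complex_of_real)
      have F: "F v y = (sin (2 * of_real y * v) / of_real s - v / of_real (w1 * w2 * y)) / of_real y" for v
        unfolding F_def hyp_gamma_integrand_def s by simp
      have J: "J t y = of_real ((cos (2 * y * t) / sinh y - 1 / y) / y)" for t
      proof -
        have "cos (2 * complex_of_real y * complex_of_real t) = of_real (cos (2 * y * t))"
          by (simp flip: cos_of_real)
        thus ?thesis by (simp add: J_def log_cosh_integrand_def sinh_complex_of_real)
      qed
      have "Im (sin (2 * of_real y * z)) = cos (2 * y * t) * Im (sin (2 * of_real y * (\<i> * of_real a)))"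
        by (simp add: Im_sin z_def)
      hence Fz: "Im (F z y) = (cos (2 * y * t) * Im (sin (2 * of_real y * (\<i> * of_real a))) / s - k / y) / y"
        unfolding F by (simp add: z_def k_def)
      have F0: "Im (F (\<i> * of_real a) y) = (Im (sin (2 * of_real y * (\<i> * of_real a))) / s - k / y) / y"
        unfolding F by (simp add: k_def)
      have J0: "Re (J 0 y) = (1 / sinh y - 1 / y) / y" and Jt: "Re (J t y) = (cos (2 * y * t) / sinh y - 1 / y) / y"
        using J[of 0] J[of t] by simp_all
      \<comment> \<open>The exponent k = a / (w1 w2) is the one for which the non-oscillating terms
        k / y^2 cancel; what remains is a multiple of cos (2 y t).\<close>
      have "- ((c * P / s - k / y) / y) + k * ((c / q - 1 / y) / y) = c * (- ((P / s - k / y) / y) + k * ((1 / q - 1 / y) / y))"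
        for c P q by (simp add: diff_divide_distrib algebra_simps)
      thus ?thesis by (simp add: Fz F0 J0 Jt)
    qed
    have "Re (LBINT y:{0<..}. \<i> * F z y + of_real k * J t y) = (LBINT y:{0<..}. Re (\<i> * F z y + of_real k * J t y))"
    proof -
      have "set_integrable lborel {0<..} (\<lambda>y. \<i> * F z y + of_real k * J t y)"
        using intF intJ by (intro set_integral_add set_integrable_mult_right)
      hence "complex_integrable lborel (\<lambda>y. indicat_real {0<..} y *\<^sub>R (\<i> * F z y + of_real k * J t y))"
        by (simp only: set_integrable_def)
      from integral_Re[OF this] show ?thesis by (simp add: set_lebesgue_integral_def)
    qed
    also have "\<dots> = (LBINT y:{0<..}. cos (2 * y * t) * Re (\<i> * F (\<i> * of_real a) y + of_real k * J 0 y))"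
      by (rule set_lebesgue_integral_cong, simp, intro allI impI pt) simp
    also have "complex_of_real \<dots> = (LBINT y:{0<..}. of_real (cos (2 * y * t) * Re (\<i> * F (\<i> * of_real a) y + of_real k * J 0 y)))"
      by (simp only: set_integral_complex_of_real)
    finally have eq2: "complex_of_real (Re (LBINT y:{0<..}. \<i> * F z y + of_real k * J t y)) =
       (LBINT y:{0<..}. of_real (cos (2 * y * t) * Re (\<i> * F (\<i> * of_real a) y + of_real k * J 0 y)))" .
    have "cmod (LBINT y:{0<..}. of_real (cos (2 * y * t) * Re (\<i> * F (\<i> * of_real a) y + of_real k * J 0 y)))
       \<le> (LBINT y. C / (1 + y\<^sup>2))"
    proof (rule set_lebesgue_integral_bound_inverse_square[OF _ C(1)])
      fix y :: real assume y: "y > 0"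
      have "cmod (of_real (cos (2 * y * t) * Re (\<i> * F (\<i> * of_real a) y + of_real k * J 0 y)))
         \<le> \<bar>cos (2 * y * t)\<bar> * \<bar>Re (\<i> * F (\<i> * of_real a) y + of_real k * J 0 y)\<bar>"
        by (simp only: norm_of_real abs_mult)
      also have "\<dots> \<le> 1 * cmod (\<i> * F (\<i> * of_real a) y + of_real k * J 0 y)"
        by (intro mult_mono abs_Re_le_cmod) auto
      also have "\<dots> \<le> cmod (F (\<i> * of_real a) y) + \<bar>k\<bar> * cmod (J 0 y)"
        using norm_triangle_ineq[of "\<i> * F (\<i> * of_real a) y" "of_real k * J 0 y"] by (simp add: norm_mult)
      also have "\<dots> \<le> C1 / (1 + y\<^sup>2) + \<bar>k\<bar> * (C2 / (1 + y\<^sup>2))"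
        using a y by (intro add_mono mult_left_mono C1(2) C2(2)) (auto simp: norm_mult)
      also have "\<dots> = (C1 + \<bar>k\<bar> * C2) / (1 + y\<^sup>2)" by (simp add: add_divide_distrib)
      also have "\<dots> \<le> C / (1 + y\<^sup>2)"
        unfolding C_def using C(2) by (intro divide_right_mono) auto
      finally show "cmod (of_real (cos (2 * y * t) * Re (\<i> * F (\<i> * of_real a) y + of_real k * J 0 y))) \<le> C / (1 + y\<^sup>2)" .
    qed
    hence "\<bar>Re (LBINT y:{0<..}. \<i> * F z y + of_real k * J t y)\<bar> \<le> (LBINT y. C / (1 + y\<^sup>2))"
      unfolding eq2[symmetric] by simp
    thus "\<bar>ln (cmod (hyp_gamma w1 w2 (of_real t + \<i> * of_real a))) - a / (w1 * w2) * ln (2 * cosh (pi * t))\<bar>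
       \<le> \<bar>LBINT y. C / (1 + y\<^sup>2)\<bar>"
      using eq unfolding z_def[symmetric] k_def[symmetric] by linarith
  qed auto
qed

lemma inverse_square_shift_le:
  fixes t c :: real
  shows "1 / (1 + (t + c)\<^sup>2) \<le> 2 * (1 + c\<^sup>2) / (1 + t\<^sup>2)"
proof -
  have "t\<^sup>2 \<le> 2 * (t + c)\<^sup>2 + 2 * c\<^sup>2"
    using sum_squares_ge_zero[of "t + 2 * c" 0] by (simp add: power2_eq_square algebra_simps)
  moreover have "0 \<le> c\<^sup>2 * (t + c)\<^sup>2" by simp
  moreover have "2 * (1 + c\<^sup>2) * (1 + (t + c)\<^sup>2) = 2 + 2 * c\<^sup>2 + 2 * (t + c)\<^sup>2 + 2 * (c\<^sup>2 * (t + c)\<^sup>2)"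
    by (simp only: distrib_left distrib_right mult_1_left mult_1_right mult.assoc)
  ultimately have "1 + t\<^sup>2 \<le> 2 * (1 + c\<^sup>2) * (1 + (t + c)\<^sup>2)"
    by linarith
  moreover have "1 + t\<^sup>2 > 0" "1 + (t + c)\<^sup>2 > 0" by (auto intro: add_pos_nonneg)
  ultimately show ?thesis by (simp add: divide_simps mult.commute)
qed

text \<open>No contour is drawn. The integral \<open>H\<close> of M(t + z) over real t is
  holomorphic in z and unchanged by real translations, so its derivative vanishes and it is constant
  on the strip.\<close>

lemma integral_horizontal_shift:
  fixes M :: "complex \<Rightarrow> complex"
  assumes hol: "M holomorphic_on {z. lo < Im z \<and> Im z < hi}"
    and bound: "\<And>z. lo < Im z \<Longrightarrow> Im z < hi \<Longrightarrow> cmod (M z) \<le> C / (1 + (Re z)\<^sup>2)"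
    and p: "lo < p" "p < hi" and q: "lo < q" "q < hi"
  shows "integrable lborel (\<lambda>t. M (of_real t + \<i> * of_real p))"
    and "(LBINT t. M (of_real t + \<i> * of_real p)) = (LBINT t. M (of_real t + \<i> * of_real q))"
proof -
  define S where "S = {z. lo < Im z \<and> Im z < hi}"
  have S_eq: "S = {z. Im z > lo} \<inter> {z. Im z < hi}" by (auto simp: S_def)
  have "open S" "convex S" unfolding S_eq
    by (intro convex_Int convex_halfspace_Im_lt convex_halfspace_Im_gt open_Int open_halfspace_Im_lt open_halfspace_Im_gt)+
  have C: "C \<ge> 0"
    using bound[of "\<i> * of_real p"] p order_trans[OF norm_ge_zero] by fastforce
  have in_S: "of_real t + z \<in> S \<longleftrightarrow> z \<in> S" for t z by (simp add: S_def)
  have meas: "(\<lambda>t. M (of_real t + z)) \<in> borel_measurable lborel" if "z \<in> S" for z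
  proof -
    have "continuous_on UNIV (\<lambda>t::real. M (of_real t + z))"
      by (rule continuous_on_compose2[OF holomorphic_on_imp_continuous_on[OF hol]])
         (use that in \<open>auto intro!: continuous_intros simp: S_def\<close>)
    thus ?thesis using borel_measurable_continuous_onI by simp
  qed
  have dom: "cmod (M (of_real t + z)) \<le> C * (2 * (1 + R\<^sup>2)) / (1 + t\<^sup>2)" if "z \<in> S" "\<bar>Re z\<bar> \<le> R" for t z R
  proof -
    have "cmod (M (of_real t + z)) \<le> C / (1 + (t + Re z)\<^sup>2)"
      using bound[of "of_real t + z"] that by (simp add: S_def)
    also have "\<dots> = C * (1 / (1 + (t + Re z)\<^sup>2))" by simp
    also have "\<dots> \<le> C * (2 * (1 + (Re z)\<^sup>2) / (1 + t\<^sup>2))"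
      using C by (intro mult_left_mono inverse_square_shift_le)
    also have "\<dots> \<le> C * (2 * (1 + R\<^sup>2) / (1 + t\<^sup>2))"
      using C that(2) abs_le_square_iff[of "Re z" R] by (intro mult_left_mono divide_right_mono add_left_mono) (auto simp: add_nonneg_nonneg)
    finally show ?thesis by simp
  qed
  show "integrable lborel (\<lambda>t. M (of_real t + \<i> * of_real p))"
  proof (rule Bochner_Integration.integrable_bound[OF integrable_inverse_one_plus_square])
    show "(\<lambda>t. M (of_real t + \<i> * of_real p)) \<in> borel_measurable lborel"
      using p by (intro meas) (auto simp: S_def)
    show "AE t in lborel. cmod (M (of_real t + \<i> * of_real p)) \<le> norm (C * (2 * (1 + 0\<^sup>2)) / (1 + t\<^sup>2))"
    proof (rule AE_I2)
      fix t :: real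
      have "cmod (M (of_real t + \<i> * of_real p)) \<le> C * (2 * (1 + 0\<^sup>2)) / (1 + t\<^sup>2)"
        using p by (intro dom) (auto simp: S_def)
      thus "cmod (M (of_real t + \<i> * of_real p)) \<le> norm (C * (2 * (1 + 0\<^sup>2)) / (1 + t\<^sup>2))"
        unfolding real_norm_def by (rule order_trans[OF _ abs_ge_self])
    qed
  qed
  define H where "H = (\<lambda>z. LBINT t. M (of_real t + z))"
  have H_shift: "H (z + of_real c) = H z" for z c
  proof -
    have "H z = \<bar>1\<bar> *\<^sub>R (LBINT t. M (of_real (c + 1 * t) + z))"
      unfolding H_def by (rule lborel_integral_real_affine) simp
    thus ?thesis by (simp add: H_def add_ac)
  qed
  have deriv: "(H has_field_derivative 0) (at z0)" if z0: "z0 \<in> S" for z0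
  proof -
    obtain r where r: "r > 0" "ball z0 r \<subseteq> S" using \<open>open S\<close> z0 openE by blast
    have Re_le: "\<bar>Re z\<bar> \<le> cmod z0 + r" if "z \<in> ball z0 r" for z
      using abs_Re_le_cmod[of z] norm_triangle_ineq2[of z z0] that by (auto simp: dist_norm norm_minus_commute)
    have "((\<lambda>z. LBINT t. M (of_real t + z)) has_field_derivative (LBINT t. deriv M (of_real t + z0))) (at z0)"
    proof (rule has_field_derivative_lebesgue_integral(2)[OF r(1), where f = "\<lambda>t z. M (of_real t + z)"
          and f' = "\<lambda>t z. deriv M (of_real t + z)" and g = "\<lambda>t. C * (2 * (1 + (cmod z0 + r)\<^sup>2)) / (1 + t\<^sup>2)"])
      fix t :: real and z assume z: "z \<in> ball z0 r"
      hence "of_real t + z \<in> S" using r in_S by auto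
      hence "(M has_field_derivative deriv M (of_real t + z)) (at (of_real t + z))"
        using holomorphic_derivI[OF hol[folded S_def] \<open>open S\<close>] by blast
      thus "((\<lambda>z. M (of_real t + z)) has_field_derivative deriv M (of_real t + z)) (at z)"
        by (simp add: DERIV_shift add.commute)
      show "cmod (M (of_real t + z)) \<le> C * (2 * (1 + (cmod z0 + r)\<^sup>2)) / (1 + t\<^sup>2)"
        using z r Re_le by (intro dom) auto
    qed (use r meas integrable_inverse_one_plus_square in auto)
    then obtain D where D: "(H has_field_derivative D) (at z0)" unfolding H_def by blast
    have "((\<lambda>h. (H (z0 + h) - H z0) / h) \<longlongrightarrow> D) (at 0)" using D by (simp add: DERIV_def)
    \<comment> \<open>The complex derivative is already determined by real increments, and along
      these the difference quotients are 0.\<close>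
    moreover have "(\<lambda>n. of_real (1 / real (Suc n)) :: complex) \<longlonglongrightarrow> 0"
      using LIMSEQ_Suc[OF lim_1_over_n[where 'a = real]] tendsto_of_real_iff[of "\<lambda>n. 1 / real (Suc n)" 0 sequentially, where ?'a = complex]
      by simp
    ultimately have "(\<lambda>n. (H (z0 + of_real (1 / real (Suc n))) - H z0) / of_real (1 / real (Suc n))) \<longlonglongrightarrow> D"
      unfolding tendsto_at_iff_sequentially comp_def
      by (auto simp del: of_nat_Suc of_real_divide)
    hence "D = 0" unfolding H_shift by (simp add: LIMSEQ_const_iff)
    with D show ?thesis by simp
  qed
  have "\<exists>c. \<forall>z\<in>S. H z = c"
    by (rule has_field_derivative_zero_constant[OF \<open>convex S\<close>]) (use deriv has_field_derivative_at_within in blast)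
  moreover have "\<i> * of_real p \<in> S" "\<i> * of_real q \<in> S" using p q by (auto simp: S_def)
  ultimately have "H (\<i> * of_real p) = H (\<i> * of_real q)" by metis
  thus "(LBINT t. M (of_real t + \<i> * of_real p)) = (LBINT t. M (of_real t + \<i> * of_real q))"
    by (simp add: H_def)
qed

text \<open>For imaginary x and lambda and real other parameters, every argument of G in the
  integrand of psi differs from z by i a with a real. Listing these shifts treats that integrand and
  the function to be telescoped alike.\<close>

definition hyp_gamma_quot :: "real \<Rightarrow> real \<Rightarrow> real list \<Rightarrow> real list \<Rightarrow> complex \<Rightarrow> complex" where
  "hyp_gamma_quot w1 w2 as bs z =
     (\<Prod>a\<leftarrow>as. hyp_gamma w1 w2 (z + \<i> * of_real a)) / (\<Prod>b\<leftarrow>bs. hyp_gamma w1 w2 (z + \<i> * of_real b))"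

lemma hyp_gamma_real_strip:
  fixes w1 w2 :: real
  assumes "w1 > 0" "w2 > 0"
  shows "hyp_gamma w1 w2 holomorphic_on {z. \<bar>Im z\<bar> < (w1 + w2) / 2}"
    and "\<bar>Im z\<bar> < (w1 + w2) / 2 \<Longrightarrow> hyp_gamma w1 w2 z \<noteq> 0"
proof -
  have *: "Re (complex_of_real w1) > 0" "Re (complex_of_real w2) > 0" "Re (wmean w1 w2) = (w1 + w2) / 2"
    using assms by (auto simp: wmean_def)
  have "hyp_gamma w1 w2 holomorphic_on {z. \<bar>Im z\<bar> < (w1 + w2) / 2} \<longleftrightarrow>
        hyp_gamma_strip w1 w2 holomorphic_on {z. \<bar>Im z\<bar> < (w1 + w2) / 2}"
    using hyp_gamma_eq_strip[OF *(1,2)] *(3) by (intro holomorphic_cong) auto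
  thus "hyp_gamma w1 w2 holomorphic_on {z. \<bar>Im z\<bar> < (w1 + w2) / 2}"
    using holomorphic_on_hyp_gamma_strip[OF *(1,2)] *(3) by simp
  show "hyp_gamma w1 w2 z \<noteq> 0" if "\<bar>Im z\<bar> < (w1 + w2) / 2"
    using hyp_gamma_eq_strip[OF *(1,2), of z] *(3) that hyp_gamma_strip_nonzero by simp
qed

lemma hyp_gamma_real_shift:
  fixes w1 w2 a :: real
  assumes w: "w1 > 0" "w2 > 0" and z: "\<bar>Im z + a + w1 / 2\<bar> < w2 / 2"
  shows "hyp_gamma w1 w2 (z + \<i> * of_real (a + w1)) =
    2 * cosh (of_real pi * (z + \<i> * of_real (a + w1 / 2)) / w2) * hyp_gamma w1 w2 (z + \<i> * of_real a)"
proof -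
  have Re: "Re (complex_of_real w1) > 0" "Re (complex_of_real w2) > 0" using w by auto
  define u where "u = z + \<i> * of_real (a + w1 / 2)"
  have u: "\<bar>Im u\<bar> < w2 / 2" using z by (simp add: u_def add.assoc)
  have e: "z + \<i> * of_real (a + w1) = u + \<i> * of_real w1 / 2" "z + \<i> * of_real a = u - \<i> * of_real w1 / 2"
    by (simp_all add: u_def algebra_simps)
  have "\<bar>Im u + w1 / 2\<bar> < (w1 + w2) / 2" "\<bar>Im u - w1 / 2\<bar> < (w1 + w2) / 2"
    using u w by (auto simp: abs_less_iff field_simps)
  hence s: "\<bar>Im (u + \<i> * of_real w1 / 2)\<bar> < Re (wmean w1 w2)" "\<bar>Im (u - \<i> * of_real w1 / 2)\<bar> < Re (wmean w1 w2)"
    by (auto simp: wmean_def)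
  show ?thesis unfolding e u_def[symmetric] hyp_gamma_eq_strip[OF Re s(1)] hyp_gamma_eq_strip[OF Re s(2)]
    using hyp_gamma_strip_shift[OF Re, of u] u by simp
qed

lemma hyp_gamma_quot_holomorphic:
  fixes w1 w2 :: real
  assumes w: "w1 > 0" "w2 > 0"
    and "\<And>z a. z \<in> S \<Longrightarrow> a \<in> set as \<union> set bs \<Longrightarrow> \<bar>Im z + a\<bar> < (w1 + w2) / 2"
  shows "hyp_gamma_quot w1 w2 as bs holomorphic_on S"
proof -
  have prod: "(\<lambda>z. \<Prod>a\<leftarrow>cs. hyp_gamma w1 w2 (z + \<i> * of_real a)) holomorphic_on S"
    if "\<And>z a. z \<in> S \<Longrightarrow> a \<in> set cs \<Longrightarrow> \<bar>Im z + a\<bar> < (w1 + w2) / 2" for cs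
    using that
  proof (induction cs)
    case (Cons c cs)
    have "(\<lambda>z. hyp_gamma w1 w2 (z + \<i> * of_real c)) holomorphic_on S"
      by (rule holomorphic_on_compose_gen[OF _ hyp_gamma_real_strip(1)[OF w], unfolded o_def])
         (use Cons.prems in \<open>auto intro!: holomorphic_intros\<close>)
    thus ?case using Cons by (auto intro!: holomorphic_intros)
  qed auto
  have "(\<Prod>b\<leftarrow>bs. hyp_gamma w1 w2 (z + \<i> * of_real b)) \<noteq> 0" if "z \<in> S" for z
    using assms(3)[OF that] hyp_gamma_real_strip(2)[OF w] by (auto simp: prod_list_zero_iff)
  thus ?thesis unfolding hyp_gamma_quot_def
    using assms(3) by (intro holomorphic_on_divide prod) auto
qed

text \<open>Up to bounded factors, |G(z + i a)| is the power (Im z + a) / (w1 w2) of 2 cosh (pi Re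
  z). Equally many factors above and below make Im z drop out, and the difference of the sums of
  shifts leaves the power - p.\<close>

lemma hyp_gamma_quot_bound:
  fixes w1 w2 a0 :: real
  assumes w: "w1 > 0" "w2 > 0" and a0: "a0 < (w1 + w2) / 2"
    and sum: "sum_list as - sum_list bs = - (p * (w1 * w2))" "length as = length bs" and p: "p \<ge> 0"
  obtains C where "C \<ge> 0" "\<And>z. (\<And>a. a \<in> set as \<union> set bs \<Longrightarrow> \<bar>Im z + a\<bar> \<le> a0) \<Longrightarrow>
     cmod (hyp_gamma_quot w1 w2 as bs z) \<le> C * exp (- (p * pi * \<bar>Re z\<bar>))"
proof -
  obtain C where C: "C \<ge> 0" "\<And>a t. \<bar>a\<bar> \<le> a0 \<Longrightarrow>
    \<bar>ln (cmod (hyp_gamma w1 w2 (of_real t + \<i> * of_real a))) - a / (w1 * w2) * ln (2 * cosh (pi * t))\<bar> \<le> C"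
    using ln_norm_hyp_gamma_bound[OF w a0] by metis
  define L where "L = (\<lambda>t. ln (2 * cosh (pi * t)))"
  define P where "P = (\<lambda>cs z. \<Prod>a\<leftarrow>cs. hyp_gamma w1 w2 (z + \<i> * of_real a))"
  \<comment> \<open>Nonvanishing is carried through the induction because ln of the modulus is
    additive only over nonzero factors.\<close>
  have prod: "P cs z \<noteq> 0 \<and>
     \<bar>ln (cmod (P cs z)) - (sum_list cs + real (length cs) * Im z) / (w1 * w2) * L (Re z)\<bar> \<le> real (length cs) * C"
    if "\<And>a. a \<in> set cs \<Longrightarrow> \<bar>Im z + a\<bar> \<le> a0" for cs z
    using that
  proof (induction cs)
    case (Cons c cs)
    have z: "z + \<i> * of_real c = of_real (Re z) + \<i> * of_real (Im z + c)" by (simp add: complex_eq_iff)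
    have c: "\<bar>Im z + c\<bar> \<le> a0" using Cons.prems by simp
    hence nz: "hyp_gamma w1 w2 (z + \<i> * of_real c) \<noteq> 0"
      using a0 by (intro hyp_gamma_real_strip(2)[OF w]) auto
    have IH: "P cs z \<noteq> 0"
     "\<bar>ln (cmod (P cs z)) - (sum_list cs + real (length cs) * Im z) / (w1 * w2) * L (Re z)\<bar> \<le> real (length cs) * C"
      using Cons by auto
    have "\<bar>ln (cmod (hyp_gamma w1 w2 (z + \<i> * of_real c))) - (Im z + c) / (w1 * w2) * L (Re z)\<bar> \<le> C"
      unfolding z L_def by (rule C(2)[OF c])
    moreover have "ln (cmod (P (c # cs) z)) = ln (cmod (hyp_gamma w1 w2 (z + \<i> * of_real c))) + ln (cmod (P cs z))"
      using nz IH(1) by (simp add: P_def norm_mult ln_mult)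
    moreover have "(sum_list (c # cs) + real (length (c # cs)) * Im z) / (w1 * w2) * L (Re z) =
       (Im z + c) / (w1 * w2) * L (Re z) + (sum_list cs + real (length cs) * Im z) / (w1 * w2) * L (Re z)"
      by (simp add: add_divide_distrib algebra_simps)
    moreover have "real (length (c # cs)) * C = C + real (length cs) * C" by (simp add: algebra_simps)
    ultimately have "\<bar>ln (cmod (P (c # cs) z)) - (sum_list (c # cs) + real (length (c # cs)) * Im z) / (w1 * w2) * L (Re z)\<bar> \<le> real (length (c # cs)) * C"
      using IH(2) by linarith
    moreover have "P (c # cs) z \<noteq> 0" using nz IH(1) by (simp add: P_def)
    ultimately show ?case by blast
  qed (use C in \<open>auto simp: P_def\<close>)
  show thesis
  proof (rule that[of "exp (2 * real (length bs) * C)"])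
    fix z assume z: "\<And>a. a \<in> set as \<union> set bs \<Longrightarrow> \<bar>Im z + a\<bar> \<le> a0"
    note A = prod[of as z] and B = prod[of bs z]
    have nz: "P as z \<noteq> 0" "P bs z \<noteq> 0" using A B z by auto
    have L: "pi * \<bar>Re z\<bar> \<le> L (Re z)"
    proof -
      have "exp (pi * \<bar>x\<bar>) \<le> 2 * cosh (pi * x)" for x :: real
        by (cases "x \<ge> 0") (auto simp: cosh_field_def)
      hence "ln (exp (pi * \<bar>Re z\<bar>)) \<le> L (Re z)" unfolding L_def by (intro ln_mono) auto
      thus ?thesis by simp
    qed
    have le1: "ln (cmod (P as z)) - ln (cmod (P bs z)) \<le>
       (sum_list as + real (length as) * Im z) / (w1 * w2) * L (Re z) - (sum_list bs + real (length bs) * Im z) / (w1 * w2) * L (Re z)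
         + 2 * real (length bs) * C"
    proof -
      have "\<bar>ln (cmod (P as z)) - (sum_list as + real (length as) * Im z) / (w1 * w2) * L (Re z)\<bar> \<le> real (length bs) * C"
        "\<bar>ln (cmod (P bs z)) - (sum_list bs + real (length bs) * Im z) / (w1 * w2) * L (Re z)\<bar> \<le> real (length bs) * C"
        using A B z sum(2) by auto
      moreover have "p - q \<le> x - y + 2 * c" if "\<bar>p - x\<bar> \<le> c" "\<bar>q - y\<bar> \<le> c" for p q x y c :: real
        using that by linarith
      ultimately show ?thesis unfolding mult.assoc[of 2] by blast
    qed
    have "(sum_list as + real (length as) * Im z) / (w1 * w2) * L (Re z) - (sum_list bs + real (length bs) * Im z) / (w1 * w2) * L (Re z)
       = (sum_list as - sum_list bs) / (w1 * w2) * L (Re z)"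
      using sum(2) by (simp add: diff_divide_distrib add_divide_distrib algebra_simps)
    also have "\<dots> = - (p * L (Re z))" unfolding sum(1) using w by simp
    also have "\<dots> \<le> - (p * (pi * \<bar>Re z\<bar>))" using mult_left_mono[OF L p] by simp
    finally have main: "ln (cmod (P as z)) - ln (cmod (P bs z)) \<le> - (p * (pi * \<bar>Re z\<bar>)) + 2 * real (length bs) * C"
      by (intro order_trans[OF le1] add_right_mono)
    have "ln (cmod (hyp_gamma_quot w1 w2 as bs z)) \<le> 2 * real (length bs) * C + - (p * pi * \<bar>Re z\<bar>)"
    proof -
      have "hyp_gamma_quot w1 w2 as bs z = P as z / P bs z" by (simp add: hyp_gamma_quot_def P_def)
      moreover have "ln (cmod (P as z / P bs z)) = ln (cmod (P as z)) - ln (cmod (P bs z))"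
        unfolding norm_divide using nz by (simp add: ln_div)
      ultimately show ?thesis using main by (simp add: mult.assoc)
    qed
    hence "exp (ln (cmod (hyp_gamma_quot w1 w2 as bs z))) \<le> exp (2 * real (length bs) * C) * exp (- (p * pi * \<bar>Re z\<bar>))"
      by (simp flip: exp_add)
    moreover have "hyp_gamma_quot w1 w2 as bs z \<noteq> 0" using nz by (simp add: hyp_gamma_quot_def P_def)
    ultimately show "cmod (hyp_gamma_quot w1 w2 as bs z) \<le> exp (2 * real (length bs) * C) * exp (- (p * pi * \<bar>Re z\<bar>))"
      by simp
  qed auto
qed

lemma hyp_gamma_quot_integrable:
  fixes w1 w2 a0 p :: real
  assumes w: "w1 > 0" "w2 > 0" and a0: "a0 < (w1 + w2) / 2"
    and sum: "sum_list as - sum_list bs = - (p * (w1 * w2))" "length as = length bs" and p: "p > 0"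
    and le: "\<And>a. a \<in> set as \<union> set bs \<Longrightarrow> \<bar>a\<bar> < a0"
  shows "integrable lborel (\<lambda>t. hyp_gamma_quot w1 w2 as bs (of_real t))"
proof -
  obtain C where C: "C \<ge> 0" "\<And>z. (\<And>a. a \<in> set as \<union> set bs \<Longrightarrow> \<bar>Im z + a\<bar> \<le> a0) \<Longrightarrow>
     cmod (hyp_gamma_quot w1 w2 as bs z) \<le> C * exp (- (p * pi * \<bar>Re z\<bar>))"
    using hyp_gamma_quot_bound[OF w a0 sum] p by auto
  have le': "\<bar>Im (of_real t) + a\<bar> \<le> a0" if "a \<in> set as \<union> set bs" for t a
    using le[OF that] by simp
  have cont: "continuous_on UNIV (\<lambda>t::real. hyp_gamma_quot w1 w2 as bs (of_real t))"
  proof -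
    have "hyp_gamma_quot w1 w2 as bs holomorphic_on range of_real"
      by (rule hyp_gamma_quot_holomorphic[OF w]) (use le' a0 in force)
    from continuous_on_compose2[OF holomorphic_on_imp_continuous_on[OF this], of UNIV of_real]
    show ?thesis by (simp add: continuous_on_of_real_id)
  qed
  show ?thesis
  proof (rule Bochner_Integration.integrable_bound[OF integrable_inverse_one_plus_square])
    show "(\<lambda>t. hyp_gamma_quot w1 w2 as bs (of_real t)) \<in> borel_measurable lborel"
      using borel_measurable_continuous_onI[OF cont] by simp
    show "AE t in lborel. cmod (hyp_gamma_quot w1 w2 as bs (of_real t)) \<le> norm (C * (1 + 2 / (p * pi)\<^sup>2) / (1 + t\<^sup>2))"
    proof (rule AE_I2)
      fix t :: real
      have "cmod (hyp_gamma_quot w1 w2 as bs (of_real t)) \<le> C * exp (- (p * pi * \<bar>t\<bar>))"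
        using C(2)[of "of_real t"] le' by simp
      also have "\<dots> \<le> C * ((1 + 2 / (p * pi)\<^sup>2) / (1 + \<bar>t\<bar>\<^sup>2))"
        using p C(1) by (intro mult_left_mono exp_minus_le_inverse_square) auto
      finally have "cmod (hyp_gamma_quot w1 w2 as bs (of_real t)) \<le> C * (1 + 2 / (p * pi)\<^sup>2) / (1 + t\<^sup>2)" by simp
      thus "cmod (hyp_gamma_quot w1 w2 as bs (of_real t)) \<le> norm (C * (1 + 2 / (p * pi)\<^sup>2) / (1 + t\<^sup>2))"
        unfolding real_norm_def by (rule order_trans[OF _ abs_ge_self])
    qed
  qed
qed

text \<open>The assumption \<open>id\<close> says that the combined integrand has the form \<open>M(z + i w\<^sub>1) - M(z)\<close>: by
  the difference equation, shifting an argument of \<open>G\<close> by \<open>i w\<^sub>1\<close> multiplies by a factor \<open>th\<close>.\<close>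

lemma hyp_gamma_telescope:
  fixes w1 w2 A1 A2 B1 B2 C1 C2 D1 D2 m :: real and \<alpha> \<beta> \<delta> aP aM a0 :: complex
  assumes w: "w1 > 0" "w2 > 0" and m: "m + 3 * w1 < w2 / 2"
    and le: "\<And>a. a \<in> {A1, A2, B1, B2, C1, C2, D1, D2} \<Longrightarrow> \<bar>a\<bar> \<le> m"
    and sum: "(A1 + A2 + B1 + B2) - (C1 + C2 + D1 + D2) = - (2 * (w1 + w2))"
  defines "th \<equiv> \<lambda>a z. 2 * cosh (of_real pi * (z + \<i> * of_real (a + w1 / 2)) / of_real w2)"
    and "f \<equiv> \<lambda>z. \<alpha> + \<beta> * exp (2 * of_real pi * z / of_real w2) + \<delta> * exp (- (2 * of_real pi * z / of_real w2))"
  assumes id: "\<And>z. aP * (th A1 z * th A2 z) * (th (A1 - w1) z * th (A2 - w1) z)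
      + aM * (th C1 z * th C2 z) * (th (C1 - w1) z * th (C2 - w1) z)
      + a0 * (th (A1 - w1) z * th (A2 - w1) z) * (th C1 z * th C2 z)
    = (th (A1 - w1) z * th (A2 - w1) z) * (th B1 z * th B2 z) * f (z + \<i> * of_real w1)
      - (th (D1 - w1) z * th (D2 - w1) z) * (th C1 z * th C2 z) * f z"
  defines "K \<equiv> \<lambda>c. hyp_gamma_quot w1 w2 [A1 + c, A2 + c, B1, B2] [C1 + c, C2 + c, D1, D2]"
  shows "aP * (LBINT t. K w1 (of_real t)) + aM * (LBINT t. K (- w1) (of_real t)) + a0 * (LBINT t. K 0 (of_real t)) = 0"
proof -
  \<comment> \<open>Moving a shift by w1 and letting z range over -w1/2 < Im z < 3 w1/2 costs at
    most 5 w1/2, so with 3 w1 all arguments keep a distance from the edge of the strip.\<close>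
  define a0' where "a0' = m + 3 * w1"
  have a0': "a0' < (w1 + w2) / 2" using m w by (simp add: a0'_def)
  \<comment> \<open>The right-hand side of \<open>sum\<close> is - p w1 w2 for this p. The part 2/w2
    is spent on the growth of \<open>f\<close> in \<open>M_bound\<close>, and 2/w1 survives as
    decay.\<close>
  define p where "p = 2 / w1 + 2 / w2"
  have p: "p > 0" "p * (w1 * w2) = 2 * (w1 + w2)" using w by (auto simp: p_def field_simps)
  have le': "\<bar>A1\<bar> \<le> m" "\<bar>A2\<bar> \<le> m" "\<bar>B1\<bar> \<le> m" "\<bar>B2\<bar> \<le> m" "\<bar>C1\<bar> \<le> m" "\<bar>C2\<bar> \<le> m" "\<bar>D1\<bar> \<le> m" "\<bar>D2\<bar> \<le> m"
    using le by auto
  have bd: "\<bar>a + c\<bar> \<le> m + w1" "\<bar>a - c\<bar> \<le> m + w1" "\<bar>a\<bar> \<le> m + w1" if "\<bar>a\<bar> \<le> m" "\<bar>c\<bar> \<le> w1" for a c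
    using that by linarith+
  have w1': "\<bar>w1\<bar> \<le> w1" using w by simp
  note bds = bd(1,2)[OF _ w1'] bd(3)[OF _ w1']
  have intK: "integrable lborel (\<lambda>t. K c (of_real t))" if c: "\<bar>c\<bar> \<le> w1" for c
    unfolding K_def
  proof (rule hyp_gamma_quot_integrable[OF w a0' _ _ p(1)])
    fix a assume "a \<in> set [A1 + c, A2 + c, B1, B2] \<union> set [C1 + c, C2 + c, D1, D2]"
    hence "\<bar>a\<bar> \<le> m + w1" by (auto intro: bd(1,2)[OF _ c] bds(3) le')
    thus "\<bar>a\<bar> < a0'" using w by (simp add: a0'_def)
  qed (use sum p in auto)
  \<comment> \<open>Lowering the A and D shifts by w1 makes Q(z) and Q(z + i w1) multiples, by
    factors \<open>th\<close>, of the same product \<open>E\<close>.\<close>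
  define Q where "Q = hyp_gamma_quot w1 w2 [A1 - w1, A2 - w1, B1, B2] [C1, C2, D1 - w1, D2 - w1]"
  define M where "M = (\<lambda>z. Q z * f z)"
  have Q_args: "\<bar>Im z + a\<bar> \<le> a0'" if "- w1 / 2 < Im z" "Im z < 3 * w1 / 2"
    "a \<in> set [A1 - w1, A2 - w1, B1, B2] \<union> set [C1, C2, D1 - w1, D2 - w1]" for z a
  proof -
    have "\<bar>a\<bar> \<le> m + w1" using that(3) by (auto intro: bd(1,2)[OF _ w1'] bds(3) le')
    thus ?thesis using that(1,2) w unfolding a0'_def by linarith
  qed
  have M_hol: "M holomorphic_on {z. - w1 / 2 < Im z \<and> Im z < 3 * w1 / 2}"
  proof -
    have "Q holomorphic_on {z. - w1 / 2 < Im z \<and> Im z < 3 * w1 / 2}"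
      unfolding Q_def by (intro hyp_gamma_quot_holomorphic w le_less_trans[OF Q_args a0']) auto
    thus ?thesis unfolding M_def f_def using w by (intro holomorphic_intros) auto
  qed
  obtain C where C: "C \<ge> 0" "\<And>z. (\<And>a. a \<in> set [A1 - w1, A2 - w1, B1, B2] \<union> set [C1, C2, D1 - w1, D2 - w1] \<Longrightarrow> \<bar>Im z + a\<bar> \<le> a0') \<Longrightarrow>
     cmod (Q z) \<le> C * exp (- (p * pi * \<bar>Re z\<bar>))"
    unfolding Q_def by (rule hyp_gamma_quot_bound[OF w a0', of "[A1 - w1, A2 - w1, B1, B2]" "[C1, C2, D1 - w1, D2 - w1]" p])
      (use sum p in auto)
  define c where "c = cmod \<alpha> + cmod \<beta> + cmod \<delta>"
  define C' where "C' = C * c * (1 + 2 / (2 * pi / w1)\<^sup>2)"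
  have M_bound: "cmod (M z) \<le> C' / (1 + (Re z)\<^sup>2)" if z: "- w1 / 2 < Im z" "Im z < 3 * w1 / 2" for z
  proof -
    have Q: "cmod (Q z) \<le> C * exp (- (p * pi * \<bar>Re z\<bar>))"
      using Q_args[OF z] by (intro C(2))
    have "cmod (f z) \<le> c * exp (2 * pi * \<bar>Re z\<bar> / w2)"
    proof -
      have "cmod (f z) \<le> cmod \<alpha> * 1 + cmod \<beta> * exp (2 * pi * Re z / w2) + cmod \<delta> * exp (- (2 * pi * Re z / w2))"
        unfolding f_def by (intro order_trans[OF norm_triangle_ineq] add_mono) (auto simp: norm_mult Re_divide_of_real)
      also have "\<dots> \<le> cmod \<alpha> * exp (2 * pi * \<bar>Re z\<bar> / w2) + cmod \<beta> * exp (2 * pi * \<bar>Re z\<bar> / w2) + cmod \<delta> * exp (2 * pi * \<bar>Re z\<bar> / w2)"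
      proof (intro add_mono mult_left_mono)
        show "exp (2 * pi * Re z / w2) \<le> exp (2 * pi * \<bar>Re z\<bar> / w2)"
          using w by (auto intro!: divide_right_mono)
        have "- (2 * pi * Re z / w2) = 2 * pi * (- Re z) / w2" by simp
        also have "\<dots> \<le> 2 * pi * \<bar>Re z\<bar> / w2" using w by (intro divide_right_mono mult_left_mono) auto
        finally show "exp (- (2 * pi * Re z / w2)) \<le> exp (2 * pi * \<bar>Re z\<bar> / w2)" by simp
      qed (use w in auto)
      finally show ?thesis by (simp add: c_def algebra_simps)
    qed
    hence "cmod (M z) \<le> (C * exp (- (p * pi * \<bar>Re z\<bar>))) * (c * exp (2 * pi * \<bar>Re z\<bar> / w2))"
      unfolding M_def norm_mult using Q C(1) by (intro mult_mono) auto
    also have "\<dots> = C * c * exp (- (p * pi * \<bar>Re z\<bar>) + 2 * pi * \<bar>Re z\<bar> / w2)" unfolding exp_add by simp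
    also have "- (p * pi * \<bar>Re z\<bar>) + 2 * pi * \<bar>Re z\<bar> / w2 = - (2 * pi / w1 * \<bar>Re z\<bar>)"
      using w by (simp add: p_def field_simps)
    also have "C * c * exp (- (2 * pi / w1 * \<bar>Re z\<bar>)) \<le> C * c * ((1 + 2 / (2 * pi / w1)\<^sup>2) / (1 + \<bar>Re z\<bar>\<^sup>2))"
      using w C(1) by (intro mult_left_mono exp_minus_le_inverse_square mult_nonneg_nonneg) (auto simp: c_def)
    finally show ?thesis by (simp add: C'_def)
  qed
  note shift = integral_horizontal_shift[OF M_hol M_bound]
  have int0: "integrable lborel (\<lambda>t. M (of_real t))"
    using shift(1)[of 0 0] w by simp
  have int1: "integrable lborel (\<lambda>t. M (of_real t + \<i> * of_real w1))"
    using shift(1)[of w1 0] w by simp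
  have eq: "(LBINT t. M (of_real t + \<i> * of_real w1)) = (LBINT t. M (of_real t))"
    using shift(2)[of w1 0] w by simp
  have pt: "aP * K w1 (of_real t) + aM * K (- w1) (of_real t) + a0 * K 0 (of_real t) = M (of_real t + \<i> * of_real w1) - M (of_real t)" for t
  proof -
    define z where "z = complex_of_real t"
    define g where "g = (\<lambda>a. hyp_gamma w1 w2 (z + \<i> * of_real a))"
    have g_shift: "g (a + w1) = th a z * g a" if "\<bar>a\<bar> \<le> m + w1" for a
    proof -
      have "\<bar>a + w1 / 2\<bar> < w2 / 2" using that w m by linarith
      thus ?thesis unfolding g_def th_def by (intro hyp_gamma_real_shift w) (simp add: z_def add.assoc)
    qed
    have g_nz: "g a \<noteq> 0" if "\<bar>a\<bar> \<le> m + w1" for a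
    proof -
      have "\<bar>a\<bar> < (w1 + w2) / 2" using that w m unfolding add_divide_distrib by linarith
      thus ?thesis unfolding g_def by (intro hyp_gamma_real_strip(2) w) (simp add: z_def)
    qed
    have g2: "g a = th (a - w1) z * g (a - w1)" if "\<bar>a\<bar> \<le> m" for a
      using g_shift[OF bds(2)[OF that]] by simp
    have g1: "g (a + w1) = th a z * g a" "g (a + w1) \<noteq> 0" "g a \<noteq> 0" "g (a - w1) \<noteq> 0" if "\<bar>a\<bar> \<le> m" for a
      using g_shift[OF bds(3)] g_nz[OF bds(1)] g_nz[OF bds(3)] g_nz[OF bds(2)] that by blast+
    define gA1 where "gA1 = g (A1 - w1)"
    define gA2 where "gA2 = g (A2 - w1)"
    define gC1 where "gC1 = g (C1 + w1)"
    define gC2 where "gC2 = g (C2 + w1)"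
    have A: "g A1 = th (A1 - w1) z * gA1" "g A2 = th (A2 - w1) z * gA2"
      "g (A1 + w1) = th A1 z * th (A1 - w1) z * gA1" "g (A2 + w1) = th A2 z * th (A2 - w1) z * gA2"
      using g1(1)[OF le'(1)] g1(1)[OF le'(2)] g2[OF le'(1)] g2[OF le'(2)] by (simp_all add: gA1_def gA2_def)
    have Ci: "1 / g C1 = th C1 z / gC1" "1 / g C2 = th C2 z / gC2"
      "1 / g (C1 - w1) = th C1 z * th (C1 - w1) z / gC1" "1 / g (C2 - w1) = th C2 z * th (C2 - w1) z / gC2"
    proof -
      have "1 / g c = th c z / g (c + w1) \<and> 1 / g (c - w1) = th c z * th (c - w1) z / g (c + w1)" if "\<bar>c\<bar> \<le> m" for c
        using g1(2-4)[OF that] unfolding g1(1)[OF that] g2[OF that] by (auto simp: divide_simps)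
      thus "1 / g C1 = th C1 z / gC1" "1 / g C2 = th C2 z / gC2"
        "1 / g (C1 - w1) = th C1 z * th (C1 - w1) z / gC1" "1 / g (C2 - w1) = th C2 z * th (C2 - w1) z / gC2"
        using le'(5,6) unfolding gC1_def gC2_def by blast+
    qed
    have Di: "1 / g (D1 - w1) = th (D1 - w1) z / g D1" "1 / g (D2 - w1) = th (D2 - w1) z / g D2"
    proof -
      have "1 / g (c - w1) = th (c - w1) z / g c" if "\<bar>c\<bar> \<le> m" for c
        using g1(3,4)[OF that] unfolding g2[OF that] by (auto simp: divide_simps)
      thus "1 / g (D1 - w1) = th (D1 - w1) z / g D1" "1 / g (D2 - w1) = th (D2 - w1) z / g D2"
        using le'(7,8) by blast+
    qed
    have B: "g (B1 + w1) = th B1 z * g B1" "g (B2 + w1) = th B2 z * g B2"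
      using g1(1)[OF le'(3)] g1(1)[OF le'(4)] by blast+
    \<comment> \<open>Numerator factors stand at their lowest shift and denominator factors at their
      highest, so every term is \<open>E\<close> times a product of \<open>th\<close> with no
      quotient left.\<close>
    define E where "E = gA1 * gA2 * g B1 * g B2 * (1 / gC1) * (1 / gC2) * (1 / g D1) * (1 / g D2)"
    have K_eq: "K c z = g (A1 + c) * g (A2 + c) * g B1 * g B2 * (1 / g (C1 + c)) * (1 / g (C2 + c)) * (1 / g D1) * (1 / g D2)" for c
      by (simp add: K_def hyp_gamma_quot_def g_def divide_simps)
    have K1: "K w1 z = E * ((th A1 z * th A2 z) * (th (A1 - w1) z * th (A2 - w1) z))"
      unfolding K_eq A gC1_def[symmetric] gC2_def[symmetric] E_def by (simp only: mult_ac)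
    have K2: "K (- w1) z = E * ((th C1 z * th C2 z) * (th (C1 - w1) z * th (C2 - w1) z))"
      unfolding K_eq E_def add_uminus_conv_diff Ci gA1_def[symmetric] gA2_def[symmetric] by (simp add: divide_inverse mult_ac)
    have K3: "K 0 z = E * ((th (A1 - w1) z * th (A2 - w1) z) * (th C1 z * th C2 z))"
      unfolding K_eq E_def add_0_right A(1,2) Ci by (simp add: divide_inverse mult_ac)
    have M1: "M z = E * ((th (D1 - w1) z * th (D2 - w1) z) * (th C1 z * th C2 z) * f z)"
    proof -
      have "Q z = g (A1 - w1) * g (A2 - w1) * g B1 * g B2 * (1 / g C1) * (1 / g C2) * (1 / g (D1 - w1)) * (1 / g (D2 - w1))"
        by (simp add: Q_def hyp_gamma_quot_def g_def divide_simps)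
      thus ?thesis unfolding M_def E_def Ci Di gA1_def[symmetric] gA2_def[symmetric] by (simp add: divide_inverse mult_ac)
    qed
    have M2: "M (z + \<i> * of_real w1) = E * ((th (A1 - w1) z * th (A2 - w1) z) * (th B1 z * th B2 z) * f (z + \<i> * of_real w1))"
    proof -
      have *: "hyp_gamma w1 w2 (z + \<i> * of_real w1 + \<i> * of_real a) = g (a + w1)" for a
        by (simp add: g_def algebra_simps)
      have "Q (z + \<i> * of_real w1) = g (A1 - w1 + w1) * g (A2 - w1 + w1) * g (B1 + w1) * g (B2 + w1) * (1 / g (C1 + w1)) * (1 / g (C2 + w1))
         * (1 / g (D1 - w1 + w1)) * (1 / g (D2 - w1 + w1))"
        unfolding Q_def hyp_gamma_quot_def list.map prod_list.Cons * by (simp add: divide_simps)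
      thus ?thesis unfolding M_def E_def diff_add_cancel A B gC1_def[symmetric] gC2_def[symmetric] by (simp add: divide_inverse mult_ac)
    qed
    have "aP * K w1 z + aM * K (- w1) z + a0 * K 0 z = E * (aP * (th A1 z * th A2 z) * (th (A1 - w1) z * th (A2 - w1) z)
      + aM * (th C1 z * th C2 z) * (th (C1 - w1) z * th (C2 - w1) z)
      + a0 * (th (A1 - w1) z * th (A2 - w1) z) * (th C1 z * th C2 z))"
      unfolding K1 K2 K3 by (simp only: distrib_left mult_ac)
    also have "\<dots> = M (z + \<i> * of_real w1) - M z"
      unfolding id M1 M2 by (simp only: right_diff_distrib)
    finally show ?thesis unfolding z_def .
  qed
  have "aP * (LBINT t. K w1 (of_real t)) + aM * (LBINT t. K (- w1) (of_real t)) + a0 * (LBINT t. K 0 (of_real t))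
     = (LBINT t. aP * K w1 (of_real t) + aM * K (- w1) (of_real t) + a0 * K 0 (of_real t))"
    using intK[of w1] intK[of "- w1"] intK[of 0] w by simp
  also have "\<dots> = (LBINT t. M (of_real t + \<i> * of_real w1)) - (LBINT t. M (of_real t))"
    unfolding pt using int0 int1 by (rule Bochner_Integration.integral_diff[rotated])
  also have "\<dots> = 0" by (simp add: eq)
  finally show ?thesis .
qed

section \<open>The telescoping identity\<close>

text \<open>The terms of the identity that survive at the zeros of t - (k + 1/k), divided by that
  factor with explicit quotient. The half of the Laurent polynomial that depends on y enters only
  through \<open>e\<close> and \<open>r\<close>, so \<open>e\<close> can be arbitrary.\<close>

lemma AW_certificate_minus:
  fixes k l r t u y' e d' :: "'a::field"
  assumes nz: "l \<noteq> 0" "k \<noteq> 0" "y' \<noteq> 0" and d': "d' * (1 / y' - y') = 1"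
  defines "n \<equiv> y'\<^sup>2 + 1 / y'\<^sup>2 + t * u * (y' + 1 / y') + t\<^sup>2 + u\<^sup>2 - 2"
  defines "A \<equiv> r * ((u + t * y') * d') + l - 1 / l - t * e"
    and "B \<equiv> (u + t / y') / l * d' + (e + r)" and "C \<equiv> (u + t * y') * l * d' + e"
  shows "n * d' * (r + k / l + l / k) - (u + k * y' + 1 / (k * y')) * (A + k * B + C / k)
      = (t - (k + 1 / k)) * (y' * B * k + C / (y' * k) + (t * y' * B + u * B + y' * A - n * d' / l))"
proof -
  have E: "1 - y'\<^sup>2 \<noteq> 0"
  proof
    assume "1 - y'\<^sup>2 = 0"
    hence "1 / y' - y' = 0" using nz by (simp add: field_simps power2_eq_square)
    thus False using d' by simp
  qed
  have d: "d' = y' / (1 - y'\<^sup>2)"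
    using d' nz E by (simp add: field_simps power2_eq_square)
  show ?thesis
    unfolding A_def B_def C_def n_def d using nz E by (simp add: divide_simps) algebra
qed

text \<open>The counterpart at the zeros of r + j/l + l/j. Here the half that depends on y' enters
  only through \<open>e'\<close> and \<open>t\<close>.\<close>

lemma AW_certificate_plus:
  fixes j l r s t y g e' d :: "'a::field"
  assumes nz: "l \<noteq> 0" "j \<noteq> 0" "y \<noteq> 0" and d: "d * (y - 1 / y) = 1" and g: "g = (s + r * y) * d"
  defines "n \<equiv> y\<^sup>2 + 1 / y\<^sup>2 + s * r * (y + 1 / y) + s\<^sup>2 + r\<^sup>2 - 2"
  defines "A \<equiv> r * e' + l - 1 / l - t * (g - r)"
    and "B \<equiv> (e' + t) / l + g" and "C \<equiv> e' * l + (g - r)"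
  shows "n * d * (t - (j + 1 / j)) + (s - (j / (y * l) + y * l / j)) * (A + j * B + C / j)
      = (r + j / l + l / j) * (- (B / y) * j - y * C / j + l * (- n * d + s * B - A / (y * l) + r * B / y))"
proof -
  have E: "y\<^sup>2 - 1 \<noteq> 0"
  proof
    assume "y\<^sup>2 - 1 = 0"
    hence "y - 1 / y = 0" using nz by (simp add: field_simps power2_eq_square)
    thus False using d by simp
  qed
  have dd: "d = y / (y\<^sup>2 - 1)"
    using d nz E by (simp add: field_simps power2_eq_square)
  show ?thesis
    unfolding A_def B_def C_def n_def g dd using nz E by (simp add: divide_simps) algebra
qed

text \<open>Here \<open>k\<close> stands for a multiple of \<open>exp (2 \<pi> z / w\<^sub>2)\<close> and \<open>j\<close> for its value at \<open>z + i w\<^sub>1\<close>.  The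
  Laurent polynomial \<open>F\<close> was found from its values at the zeros of \<open>t - (k + 1 / k)\<close> and of
  \<open>r + j / l + l / j\<close>, at each of which only two terms of the identity survive.\<close>

lemma AW_certificate:
  fixes k l r s t u y y' d d' :: "'a::field"
  assumes nz: "l \<noteq> 0" "k \<noteq> 0" "y \<noteq> 0" "y' \<noteq> 0"
    and d: "d * (y - 1 / y) = 1" and d': "d' * (1 / y' - y') = 1" and j: "j = k * y * y'"
  defines "F \<equiv> \<lambda>k. - (r * ((u + t * y') * d') + l - 1 / l - t * ((s + r / y) * d)
      + k * ((u + t / y') / l * d' + (s + r * y) * d) + ((u + t * y') * l * d' + (s + r / y) * d) / k)"
  shows "(y\<^sup>2 + 1 / y\<^sup>2 + s * r * (y + 1 / y) + s\<^sup>2 + r\<^sup>2 - 2) * d * (t - (j + 1 / j)) * (t - (k + 1 / k))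
      + (y'\<^sup>2 + 1 / y'\<^sup>2 + t * u * (y' + 1 / y') + t\<^sup>2 + u\<^sup>2 - 2) * d' * (r + j / l + l / j) * (r + k / l + l / k)
      + (l * (y - y') + (1 / y' - 1 / y) / l - (d / y + d' / y') * (r * u + t * s) - (d + d') * (s * u + r * t))
         * (t - (k + 1 / k)) * (r + j / l + l / j)
    = (t - (k + 1 / k)) * (s - (j / (y * l) + y * l / j)) * F j
      - (u + k * y' + 1 / (k * y')) * (r + j / l + l / j) * F k"
proof -
  define e where "e = (s + r / y) * d"
  define g where "g = (s + r * y) * d"
  define e' where "e' = (u + t * y') * d'"
  define n where "n = y\<^sup>2 + 1 / y\<^sup>2 + s * r * (y + 1 / y) + s\<^sup>2 + r\<^sup>2 - 2"
  define n' where "n' = y'\<^sup>2 + 1 / y'\<^sup>2 + t * u * (y' + 1 / y') + t\<^sup>2 + u\<^sup>2 - 2"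
  have j0: "j \<noteq> 0" using nz j by simp
  have ge: "g - e = r"
  proof -
    have "g - e = r * (d * (y - 1 / y))" unfolding g_def e_def by (simp add: algebra_simps divide_inverse)
    thus ?thesis using d by simp
  qed
  have e't: "(u + t / y') * d' = e' + t"
  proof -
    have "(u + t / y') * d' = e' + t * (d' * (1 / y' - y'))" unfolding e'_def by (simp add: algebra_simps divide_inverse)
    thus ?thesis unfolding d' by simp
  qed
  define A where "A = r * e' + l - 1 / l - t * e"
  define B where "B = (e' + t) / l + g"
  define C where "C = e' * l + e"
  have F: "F k = - (A + k * B + C / k)" for k
    unfolding F_def A_def B_def C_def e't[symmetric] by (simp add: e_def g_def e'_def mult_ac)
  define Vm where "Vm = y' * B * k + C / (y' * k) + (t * y' * B + u * B + y' * A - n' * d' / l)"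
  define Vp where "Vp = - (B / y) * j - y * C / j + l * (- n * d + s * B - A / (y * l) + r * B / y)"
  have minus: "n' * d' * (r + k / l + l / k) + (u + k * y' + 1 / (k * y')) * F k = (t - (k + 1 / k)) * Vm"
  proof -
    have eqs: "r * ((u + t * y') * d') + l - 1 / l - t * e = A" "(u + t / y') / l * d' + (e + r) = B" "(u + t * y') * l * d' + e = C"
      using ge e't unfolding A_def B_def C_def by (simp_all add: e'_def algebra_simps diff_eq_eq)
    note AW_certificate_minus[OF nz(1,2,4) d', of t u r e, unfolded eqs, folded n'_def]
    thus ?thesis unfolding F Vm_def by (simp only: mult_minus_right diff_conv_add_uminus)
  qed
  have plus: "n * d * (t - (j + 1 / j)) - (s - (j / (y * l) + y * l / j)) * F j = (r + j / l + l / j) * Vp"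
  proof -
    have "e = g - r" using ge by (simp add: algebra_simps)
    hence eqs: "r * e' + l - 1 / l - t * (g - r) = A" "(e' + t) / l + g = B" "e' * l + (g - r) = C"
      by (simp_all only: A_def B_def C_def)
    note AW_certificate_plus[OF nz(1) j0 nz(3) d g_def, of t e', unfolded eqs, folded n_def]
    thus ?thesis unfolding F Vp_def by (simp only: mult_minus_right diff_minus_eq_add)
  qed
  \<comment> \<open>Multiplying \<open>plus\<close> by t - (k + 1/k) and \<open>minus\<close> by r +
    j/l + l/j reduces the full identity to the product of both factors times this sum.\<close>
  have sum: "Vp + Vm + (l * (y - y') + (1 / y' - 1 / y) / l - (d / y + d' / y') * (r * u + t * s) - (d + d') * (s * u + r * t)) = 0"
  proof -
    have E: "y\<^sup>2 - 1 \<noteq> 0" "1 - y'\<^sup>2 \<noteq> 0"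
      using d d' nz by (auto simp: field_simps power2_eq_square)
    have dd: "d = y / (y\<^sup>2 - 1)" "d' = y' / (1 - y'\<^sup>2)"
      using d d' nz E by (simp_all add: field_simps power2_eq_square)
    show ?thesis
      unfolding Vp_def Vm_def A_def B_def C_def n_def n'_def e_def g_def e'_def dd j using nz E
      by (simp add: divide_simps) algebra
  qed
  show ?thesis
    using minus plus sum unfolding n_def[symmetric] n'_def[symmetric] by algebra
qed

text \<open>The product runs over all sign choices in S^(+-1) R^(+-1), so it is invariant under S ->
  1/S and R -> 1/R and can be written in S + 1/S and R + 1/R. The bracket on the right is the
  coefficient \<open>n\<close> of the certificate.\<close>

lemma AW_quartic:
  fixes y S R :: "'a::field"
  assumes "y \<noteq> 0" "S \<noteq> 0" "R \<noteq> 0"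
  shows "(1 + y * (S / R)) * (1 + y / (S / R)) * (1 + y * (S * R)) * (1 + y / (S * R)) =
     y\<^sup>2 * (y\<^sup>2 + 1 / y\<^sup>2 + (S + 1 / S) * (R + 1 / R) * (y + 1 / y) + (S + 1 / S)\<^sup>2 + (R + 1 / R)\<^sup>2 - 2)"
  using assms by (simp add: divide_simps) algebra

text \<open>This evaluates A(x) + A(-x) when the numerator of A has coefficients 1, e1, e2, e3, h^2.
  Only e1 + e3 and e2 + 1 + h^2 occur; for the Askey-Wilson parameters these are h times polynomials
  in r, s, t, u.\<close>

lemma AW_quartic_sum:
  fixes q X e1 e2 e3 h y y' d d' :: "'a::field"
  assumes nz: "q \<noteq> 0" "X \<noteq> 0" and X: "X\<^sup>2 \<noteq> 1" and y: "y = q * X" "y' = q / X"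
    and d: "d * (y - 1 / y) = 1" "d' * (1 / y' - y') = 1"
  shows "(1 + e1 * y + e2 * y\<^sup>2 + e3 * y ^ 3 + h\<^sup>2 * y ^ 4) / ((1 - X\<^sup>2) * (1 - y\<^sup>2))
      + (1 + e1 * y' + e2 * y'\<^sup>2 + e3 * y' ^ 3 + h\<^sup>2 * y' ^ 4) / ((1 - 1 / X\<^sup>2) * (1 - y'\<^sup>2))
    = 1 + q\<^sup>2 * h\<^sup>2 + q / (X - 1 / X) * ((d / y + d' / y') * (e1 + e3) + (d + d') * (e2 + 1 + h\<^sup>2))"
proof -
  have y0: "y \<noteq> 0" "y' \<noteq> 0" using nz y by auto
  have "y - 1 / y = (y\<^sup>2 - 1) / y" "1 / y' - y' = (1 - y'\<^sup>2) / y'"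
    using y0 by (simp_all add: field_simps power2_eq_square)
  hence "d * ((y\<^sup>2 - 1) / y) = 1" "d' * ((1 - y'\<^sup>2) / y') = 1" using d by simp_all
  hence *: "d * (y\<^sup>2 - 1) = y" "d' * (1 - y'\<^sup>2) = y'" using y0 by (simp_all add: divide_eq_eq)
  hence E: "y\<^sup>2 - 1 \<noteq> 0" "1 - y'\<^sup>2 \<noteq> 0" using y0 by auto
  with * have dd: "d = y / (y\<^sup>2 - 1)" "d' = y' / (1 - y'\<^sup>2)" by (simp_all add: eq_divide_eq)
  have E2: "q\<^sup>2 * X\<^sup>2 \<noteq> 1" "X\<^sup>2 \<noteq> q\<^sup>2"
    using E nz unfolding y by (auto simp: power_mult_distrib power_divide)
  show ?thesis using E2 X nz unfolding dd y power_mult_distrib power_divide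
    by (simp add: divide_simps) algebra
qed

text \<open>The certificate in terms of the coefficients that the operator produces. All of them
  share the factor c = h q / (X - 1/X), which is absorbed into the Laurent polynomial; the
  telescoping only asks that its three coefficients exist.\<close>

lemma AW_certificate_full:
  fixes q X l S R T U :: "'a::field"
  assumes nz: "q \<noteq> 0" "X \<noteq> 0" "l \<noteq> 0" "S \<noteq> 0" "R \<noteq> 0" "T \<noteq> 0" "U \<noteq> 0"
    and X: "X\<^sup>2 \<noteq> 1" and y: "y = q * X" "y' = q / X" and y1: "y\<^sup>2 \<noteq> 1" "y'\<^sup>2 \<noteq> 1"
  defines "r \<equiv> R + 1 / R" and "s \<equiv> S + 1 / S" and "t \<equiv> T + 1 / T" and "u \<equiv> U + 1 / U" and "h \<equiv> S / U"
  defines "up \<equiv> h * ((1 + y * (S / R)) * (1 + y / (S / R)) * (1 + y * (S * R)) * (1 + y / (S * R))) / ((1 - X\<^sup>2) * (1 - y\<^sup>2))"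
    and "down \<equiv> h * ((1 + y' * (T / U)) * (1 + y' / (T / U)) * (1 + y' * (T * U)) * (1 + y' / (T * U))) / ((1 - 1 / X\<^sup>2) * (1 - y'\<^sup>2))"
    and "A \<equiv> (1 + y * (S / R)) * (1 + y * (S * R)) * (1 + y / (T * U)) * (1 + y * (T / U)) / ((1 - X\<^sup>2) * (1 - y\<^sup>2))"
    and "A' \<equiv> (1 + y' * (S / R)) * (1 + y' * (S * R)) * (1 + y' / (T * U)) * (1 + y' * (T / U)) / ((1 - 1 / X\<^sup>2) * (1 - y'\<^sup>2))"
    and "v \<equiv> - (q * h) * (l * q + 1 / (l * q) + q * h + 1 / (q * h))"
  obtains \<alpha> \<beta> \<delta> where "\<And>k j. k \<noteq> 0 \<Longrightarrow> j = k * y * y' \<Longrightarrow>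
      up * (t - (j + 1 / j)) * (t - (k + 1 / k)) + down * (r + (j / l + l / j)) * (r + (k / l + l / k))
        - (A + A' + v) * (t - (k + 1 / k)) * (r + (j / l + l / j))
      = (t - (k + 1 / k)) * (s - (j / (y * l) + y * l / j)) * (\<alpha> + \<beta> * j + \<delta> / j)
        - (u + (k * y' + 1 / (k * y'))) * (r + (j / l + l / j)) * (\<alpha> + \<beta> * k + \<delta> / k)"
proof -
  have y0: "y \<noteq> 0" "y' \<noteq> 0" using nz y by auto
  define d where "d = y / (y\<^sup>2 - 1)"
  define d' where "d' = y' / (1 - y'\<^sup>2)"
  have d: "d * (y - 1 / y) = 1" "d' * (1 / y' - y') = 1"
    using y0 y1 by (simp_all add: d_def d'_def divide_simps) (simp_all add: power2_eq_square)
  have p0: "X - 1 / X \<noteq> 0" using X nz by (simp add: field_simps power2_eq_square)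
  define c where "c = h * q / (X - 1 / X)"
  define n where "n = y\<^sup>2 + 1 / y\<^sup>2 + s * r * (y + 1 / y) + s\<^sup>2 + r\<^sup>2 - 2"
  define n' where "n' = y'\<^sup>2 + 1 / y'\<^sup>2 + t * u * (y' + 1 / y') + t\<^sup>2 + u\<^sup>2 - 2"
  have up: "up = c * (n * d)"
  proof -
    have "up = h * (y\<^sup>2 * n) / ((1 - X\<^sup>2) * (1 - y\<^sup>2))"
      unfolding up_def n_def AW_quartic[OF y0(1) nz(4,5)] s_def r_def ..
    also have "\<dots> = c * (n * d)"
    proof -
      have "(1 - X\<^sup>2) * (1 - y\<^sup>2) = (X * (X - 1 / X)) * (y\<^sup>2 - 1)" using nz by (simp add: field_simps power2_eq_square)
      moreover have "y\<^sup>2 = (q * y) * X" by (simp add: y power2_eq_square)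
      ultimately show ?thesis using nz p0 unfolding c_def d_def by simp
    qed
    finally show ?thesis .
  qed
  have down: "down = c * (n' * d')"
  proof -
    have "down = h * (y'\<^sup>2 * n') / ((1 - 1 / X\<^sup>2) * (1 - y'\<^sup>2))"
      unfolding down_def n'_def AW_quartic[OF y0(2) nz(6,7)] t_def u_def ..
    also have "\<dots> = c * (n' * d')"
    proof -
      have "(1 - 1 / X\<^sup>2) * (1 - y'\<^sup>2) = ((X - 1 / X) / X) * (1 - y'\<^sup>2)" using nz by (simp add: field_simps power2_eq_square)
      moreover have "y'\<^sup>2 = (q * y') / X" by (simp add: y power2_eq_square)
      ultimately show ?thesis using nz p0 unfolding c_def d'_def by simp
    qed
    finally show ?thesis .
  qed
  have AA: "- (A + A' + v) = c * (l * (y - y') + (1 / y' - 1 / y) / l - (d / y + d' / y') * (r * u + t * s) - (d + d') * (s * u + r * t))"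
  proof -
    define e1 where "e1 = S * r + t / U"
    define e2 where "e2 = S\<^sup>2 + 1 / U\<^sup>2 + S * r * t / U"
    define e3 where "e3 = S\<^sup>2 * t / U + S * r / U\<^sup>2"
    have quart: "(1 + y * (S / R)) * (1 + y * (S * R)) * (1 + y / (T * U)) * (1 + y * (T / U)) = 1 + e1 * y + e2 * y\<^sup>2 + e3 * y ^ 3 + h\<^sup>2 * y ^ 4"
      for y using nz unfolding e1_def e2_def e3_def h_def r_def t_def by (simp add: divide_simps) algebra
    have "A + A' = 1 + q\<^sup>2 * h\<^sup>2 + q / (X - 1 / X) * ((d / y + d' / y') * (e1 + e3) + (d + d') * (e2 + 1 + h\<^sup>2))"
      unfolding A_def A'_def quart by (rule AW_quartic_sum[OF nz(1,2) X y d])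
    also have "e1 + e3 = h * (r * u + t * s)"
      using nz unfolding e1_def e3_def h_def s_def u_def by (simp add: divide_simps) algebra
    also have "e2 + 1 + h\<^sup>2 = h * (s * u + r * t)"
      using nz unfolding e2_def h_def s_def u_def by (simp add: divide_simps) algebra
    also have "q / (X - 1 / X) * ((d / y + d' / y') * (h * (r * u + t * s)) + (d + d') * (h * (s * u + r * t)))
       = c * ((d / y + d' / y') * (r * u + t * s) + (d + d') * (s * u + r * t))"
      unfolding c_def divide_inverse by (simp only: distrib_left distrib_right mult_ac add_ac)
    finally have "A + A' = 1 + q\<^sup>2 * h\<^sup>2 + c * ((d / y + d' / y') * (r * u + t * s) + (d + d') * (s * u + r * t))" .
    moreover have "c * (l * (y - y') + (1 / y' - 1 / y) / l) = h * q * (l * q + 1 / (l * q))"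
    proof -
      have "l * (y - y') + (1 / y' - 1 / y) / l = (X - 1 / X) * (l * q + 1 / (l * q))"
        using nz unfolding y by (simp add: divide_simps) algebra
      thus ?thesis using p0 by (simp add: c_def)
    qed
    moreover have "v = - (h * q * (l * q + 1 / (l * q))) - q\<^sup>2 * h\<^sup>2 - 1"
      using nz by (simp add: v_def h_def field_simps power2_eq_square)
    moreover have "- (A + A' + v) = c * (W - M - N)"
      if "A + A' = 1 + q\<^sup>2 * h\<^sup>2 + c * (M + N)" "c * W = H" "v = - H - q\<^sup>2 * h\<^sup>2 - 1" for M N W H
      using that by algebra
    ultimately show ?thesis by blast
  qed
  define a where "a = r * ((u + t * y') * d') + l - 1 / l - t * ((s + r / y) * d)"
  define b where "b = (u + t / y') / l * d' + (s + r * y) * d"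
  define e where "e = (u + t * y') * l * d' + (s + r / y) * d"
  show thesis
  proof (rule that[of "- c * a" "- c * b" "- c * e"])
    fix k j assume k: "k \<noteq> 0" and j: "j = k * y * y'"
    have F: "- c * a + - c * b * k + - c * e / k = c * - (a + k * b + e / k)" for k
      by (simp add: algebra_simps)
    note cert = AW_certificate[OF nz(3) k y0 d j, of s r t u, folded n_def n'_def a_def b_def e_def]
    have "up * (t - (j + 1 / j)) * (t - (k + 1 / k)) + down * (r + (j / l + l / j)) * (r + (k / l + l / k))
        - (A + A' + v) * (t - (k + 1 / k)) * (r + (j / l + l / j))
      = up * (t - (j + 1 / j)) * (t - (k + 1 / k)) + down * (r + (j / l + l / j)) * (r + (k / l + l / k))
        + (- (A + A' + v)) * (t - (k + 1 / k)) * (r + (j / l + l / j))"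
      by (simp only: mult_minus_left diff_conv_add_uminus)
    also have "\<dots> = c * (n * d * (t - (j + 1 / j)) * (t - (k + 1 / k)) + n' * d' * (r + j / l + l / j) * (r + k / l + l / k)
      + (l * (y - y') + (1 / y' - 1 / y) / l - (d / y + d' / y') * (r * u + t * s) - (d + d') * (s * u + r * t))
         * (t - (k + 1 / k)) * (r + j / l + l / j))"
      unfolding up down AA by (simp only: distrib_left[of c] mult.assoc add.assoc)
    also have "\<dots> = (t - (k + 1 / k)) * (s - (j / (y * l) + y * l / j)) * (- c * a + - c * b * j + - c * e / j)
        - (u + (k * y' + 1 / (k * y'))) * (r + (j / l + l / j)) * (- c * a + - c * b * k + - c * e / k)"
      unfolding cert F by (simp only: right_diff_distrib add.assoc mult_ac)
    finally show "up * (t - (j + 1 / j)) * (t - (k + 1 / k)) + down * (r + (j / l + l / j)) * (r + (k / l + l / k))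
        - (A + A' + v) * (t - (k + 1 / k)) * (r + (j / l + l / j))
      = (t - (k + 1 / k)) * (s - (j / (y * l) + y * l / j)) * (- c * a + - c * b * j + - c * e / j)
        - (u + (k * y' + 1 / (k * y'))) * (r + (j / l + l / j)) * (- c * a + - c * b * k + - c * e / k)" .
  qed
qed

section \<open>The difference equation for the integral\<close>

definition qexp :: "complex \<Rightarrow> complex \<Rightarrow> complex" where
  "qexp w u = exp (2 * of_real pi * u / w)"

lemma qexp_nonzero [simp]: "qexp w u \<noteq> 0"
  by (simp add: qexp_def)

lemma qexp_add: "qexp w (u + v) = qexp w u * qexp w v"
  by (simp add: qexp_def distrib_left add_divide_distrib exp_add)

lemma qexp_minus: "qexp w (- u) = inverse (qexp w u)"
  by (simp add: qexp_def exp_minus)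

lemma qexp_diff: "qexp w (u - v) = qexp w u / qexp w v"
  by (simp add: qexp_def right_diff_distrib diff_divide_distrib exp_diff)

lemma qexp_double: "qexp w (2 * u) = (qexp w u)\<^sup>2"
  by (simp only: mult_2 qexp_add power2_eq_square)

lemma qexp_half_period: "w \<noteq> 0 \<Longrightarrow> qexp w (\<i> * w / 2) = - 1"
proof -
  assume "w \<noteq> 0"
  hence "qexp w (\<i> * w / 2) = exp (of_real pi * \<i>)" by (simp add: qexp_def)
  thus ?thesis by simp
qed

lemma qexp_quarter_period: "w \<noteq> 0 \<Longrightarrow> qexp w (\<i> * w / 4) = \<i>"
proof -
  assume "w \<noteq> 0"
  hence "2 * of_real pi * (\<i> * w / 4) / w = \<i> * of_real (pi / 2)" by simp
  hence "qexp w (\<i> * w / 4) = exp (\<i> * of_real (pi / 2))" by (simp only: qexp_def)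
  also have "\<dots> = \<i>" by (simp only: cis_conv_exp[symmetric] cis_pi_half)
  finally show ?thesis .
qed

text \<open>\<open>AW_coeff\<close> times the ratio of weights \<open>\<Delta>(x) / \<Delta>(x + i w\<^sub>1)\<close>, respectively
  \<open>\<Delta>(x) / \<Delta>(x - i w\<^sub>1)\<close>: the coefficients of the difference equation for \<open>\<psi>\<close>.\<close>

definition AW_up :: "complex \<Rightarrow> complex \<Rightarrow> (nat \<Rightarrow> complex) \<Rightarrow> complex \<Rightarrow> complex" where
  "AW_up w1 w2 \<gamma> x = qexp w2 (\<i> * dual_par \<gamma> 0) *
     ((1 + qexp w2 (x + \<i> * w1 / 2 + \<i> * \<gamma> 0)) * (1 + qexp w2 (x + \<i> * w1 / 2 - \<i> * \<gamma> 0)) *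
      (1 + qexp w2 (x + \<i> * w1 / 2 + \<i> * \<gamma> 1)) * (1 + qexp w2 (x + \<i> * w1 / 2 - \<i> * \<gamma> 1))) /
     ((1 - qexp w2 (2 * x)) * (1 - qexp w2 (2 * x + \<i> * w1)))"

definition AW_down :: "complex \<Rightarrow> complex \<Rightarrow> (nat \<Rightarrow> complex) \<Rightarrow> complex \<Rightarrow> complex" where
  "AW_down w1 w2 \<gamma> x = qexp w2 (\<i> * dual_par \<gamma> 0) *
     ((1 + qexp w2 (\<i> * w1 / 2 - x + \<i> * \<gamma> 3)) * (1 + qexp w2 (\<i> * w1 / 2 - x - \<i> * \<gamma> 3)) *
      (1 + qexp w2 (\<i> * w1 / 2 - x - \<i> * \<gamma> 2)) * (1 + qexp w2 (\<i> * w1 / 2 - x + \<i> * \<gamma> 2))) /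
     ((1 - qexp w2 (- 2 * x)) * (1 - qexp w2 (- 2 * x + \<i> * w1)))"

text \<open>The summand i w2/2 of i w contributes a factor -1 to each exponential of the numerator.
  In the denominator it occurs doubled and contributes 1.\<close>

lemma AW_coeff_eq_qexp:
  assumes "w2 \<noteq> 0"
  shows "AW_coeff w1 w2 \<gamma> x =
     (1 + qexp w2 (x + \<i> * w1 / 2 + \<i> * \<gamma> 0)) * (1 + qexp w2 (x + \<i> * w1 / 2 + \<i> * \<gamma> 1)) *
     (1 + qexp w2 (x + \<i> * w1 / 2 + \<i> * \<gamma> 2)) * (1 + qexp w2 (x + \<i> * w1 / 2 + \<i> * \<gamma> 3)) /
     ((1 - qexp w2 (2 * x)) * (1 - qexp w2 (2 * x + \<i> * w1)))"
proof -
  have 1: "exp (2 * of_real pi * (\<i> * wmean w1 w2 + \<i> * \<gamma> j + x) / w2) = - qexp w2 (x + \<i> * w1 / 2 + \<i> * \<gamma> j)" for j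
  proof -
    have "\<i> * wmean w1 w2 + \<i> * \<gamma> j + x = (x + \<i> * w1 / 2 + \<i> * \<gamma> j) + \<i> * w2 / 2"
      by (simp add: wmean_def field_simps)
    thus ?thesis unfolding qexp_def[symmetric] by (simp only: qexp_add qexp_half_period[OF assms] mult_minus_right mult_1_right)
  qed
  have 2: "exp (4 * of_real pi * (x + \<i> * wmean w1 w2) / w2) = qexp w2 (2 * x + \<i> * w1)"
  proof -
    have e: "2 * (x + \<i> * wmean w1 w2) = 2 * x + \<i> * w1 + \<i> * w2 / 2 + \<i> * w2 / 2"
      by (simp add: wmean_def field_simps)
    have "exp (4 * of_real pi * u / w2) = qexp w2 (2 * u)" for u by (simp add: qexp_def mult.assoc)
    hence "exp (4 * of_real pi * (x + \<i> * wmean w1 w2) / w2) = qexp w2 (2 * (x + \<i> * wmean w1 w2))" .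
    also have "\<dots> = qexp w2 (2 * x + \<i> * w1 + \<i> * w2 / 2 + \<i> * w2 / 2)" unfolding e ..
    also have "\<dots> = qexp w2 (2 * x + \<i> * w1)"
      unfolding qexp_add[of _ _ "\<i> * w2 / 2"] qexp_half_period[OF assms] by simp
    finally show ?thesis .
  qed
  have 3: "exp (4 * of_real pi * x / w2) = qexp w2 (2 * x)"
    by (simp add: qexp_def mult.assoc)
  have "{0..3} = {0, 1, 2, 3::nat}" by auto
  thus ?thesis unfolding AW_coeff_def 1 2 3 by (simp add: mult.assoc)
qed

lemma dual_par_0_gamma_par: "dual_par (gamma_par \<rho> \<sigma> \<tau> \<upsilon>) 0 = \<sigma> - \<upsilon>"
  by (simp add: dual_par_def gamma_par_def)

lemma two_cosh_eq_exp: "2 * cosh u = exp u + exp (- u :: complex)"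
  by (simp add: cosh_field_def)

lemma AW_eigenvalue_eq_qexp:
  "AW_eigenvalue w1 w2 \<gamma> l = - qexp w2 (\<i> * w1 / 2 + \<i> * dual_par \<gamma> 0) *
     (qexp w2 l + qexp w2 (- l) + (qexp w2 (\<i> * w1 / 2 + \<i> * dual_par \<gamma> 0) + qexp w2 (- (\<i> * w1 / 2 + \<i> * dual_par \<gamma> 0))))"
proof -
  have a: "of_real pi * \<i> * w1 / w2 + 2 * of_real pi * \<i> * dual_par \<gamma> 0 / w2 = 2 * of_real pi * (\<i> * w1 / 2 + \<i> * dual_par \<gamma> 0) / w2"
    by (simp add: distrib_left add_divide_distrib mult_ac)
  have m: "qexp w2 (- u) = exp (- (2 * of_real pi * u / w2))" for u by (simp add: qexp_def)
  have gen: "- 2 * E * (B + C) = - E * (2 * B + 2 * C)" for E B C :: complex by (simp add: algebra_simps)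
  have "AW_eigenvalue w1 w2 \<gamma> l = - exp (2 * of_real pi * (\<i> * w1 / 2 + \<i> * dual_par \<gamma> 0) / w2) *
     (2 * cosh (2 * of_real pi * l / w2) + 2 * cosh (2 * of_real pi * (\<i> * w1 / 2 + \<i> * dual_par \<gamma> 0) / w2))"
    unfolding AW_eigenvalue_def Let_def a by (rule gen)
  thus ?thesis unfolding m unfolding qexp_def by (simp only: two_cosh_eq_exp)
qed

text \<open>Turns a pair of cosh factors with shifts u + v and u - v into the sum of two symmetric
  Laurent terms, the form in which the certificate is written.\<close>

lemma cosh_pair_eq_qexp:
  "(2 * cosh (of_real pi * (u + v) / w)) * (2 * cosh (of_real pi * (u - v) / w)) =
     (qexp w v + 1 / qexp w v) + (qexp w u + 1 / qexp w u)"
proof -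
  define a where "a = of_real pi * u / w"
  define b where "b = of_real pi * v / w"
  have ab: "of_real pi * (u + v) / w = a + b" "of_real pi * (u - v) / w = a - b"
    by (simp_all add: a_def b_def distrib_left right_diff_distrib add_divide_distrib diff_divide_distrib)
  have "(2 * cosh (a + b)) * (2 * cosh (a - b)) = (exp (2 * b) + exp (- (2 * b))) + (exp (2 * a) + exp (- (2 * a)))"
    unfolding two_cosh_eq_exp by (simp add: distrib_left distrib_right flip: exp_add)
  also have "\<dots> = (qexp w v + 1 / qexp w v) + (qexp w u + 1 / qexp w u)"
    by (simp add: qexp_def a_def b_def exp_minus divide_inverse mult_ac)
  finally show ?thesis unfolding ab .
qed

lemma psi_integral_eq_quot:
  fixes w1 w2 \<rho> \<sigma> \<tau> \<upsilon> x c l :: real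
  defines "w \<equiv> (w1 + w2) / 2"
  shows "psi_integral w1 w2 \<rho> \<sigma> \<tau> \<upsilon> (\<i> * of_real (x + c)) (\<i> * of_real l) =
    (LBINT t. hyp_gamma_quot w1 w2
       [(x + l / 2 - w / 2 + \<tau>) + c, (x + l / 2 - w / 2 - \<tau>) + c, - l / 2 - w / 2 + \<sigma>, - l / 2 - w / 2 - \<sigma>]
       [(x - l / 2 + w / 2 + \<rho>) + c, (x - l / 2 + w / 2 - \<rho>) + c, l / 2 + w / 2 + \<upsilon>, l / 2 + w / 2 - \<upsilon>] (of_real t))"
proof -
  have w: "wmean (of_real w1) (of_real w2) = of_real w" by (simp add: w_def wmean_def)
  show ?thesis
    unfolding psi_integral_def Let_def w hyp_gamma_quot_def
  proof (intro Bochner_Integration.integral_cong refl)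
    fix t :: real
    have args:
      "of_real t + \<i> * of_real (x + c) + \<i> * of_real l / 2 - \<i> * of_real w / 2 + \<i> * of_real \<tau> = of_real t + \<i> * complex_of_real (x + l / 2 - w / 2 + \<tau> + c)"
      "of_real t + \<i> * of_real (x + c) + \<i> * of_real l / 2 - \<i> * of_real w / 2 - \<i> * of_real \<tau> = of_real t + \<i> * complex_of_real (x + l / 2 - w / 2 - \<tau> + c)"
      "of_real t - \<i> * of_real l / 2 - \<i> * of_real w / 2 + \<i> * of_real \<sigma> = of_real t + \<i> * complex_of_real (- l / 2 - w / 2 + \<sigma>)"
      "of_real t - \<i> * of_real l / 2 - \<i> * of_real w / 2 - \<i> * of_real \<sigma> = of_real t + \<i> * complex_of_real (- l / 2 - w / 2 - \<sigma>)"
      "of_real t + \<i> * of_real (x + c) - \<i> * of_real l / 2 + \<i> * of_real w / 2 + \<i> * of_real \<rho> = of_real t + \<i> * complex_of_real (x - l / 2 + w / 2 + \<rho> + c)"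
      "of_real t + \<i> * of_real (x + c) - \<i> * of_real l / 2 + \<i> * of_real w / 2 - \<i> * of_real \<rho> = of_real t + \<i> * complex_of_real (x - l / 2 + w / 2 - \<rho> + c)"
      "of_real t + \<i> * of_real l / 2 + \<i> * of_real w / 2 + \<i> * of_real \<upsilon> = of_real t + \<i> * complex_of_real (l / 2 + w / 2 + \<upsilon>)"
      "of_real t + \<i> * of_real l / 2 + \<i> * of_real w / 2 - \<i> * of_real \<upsilon> = of_real t + \<i> * complex_of_real (l / 2 + w / 2 - \<upsilon>)"
      by (simp_all add: complex_eq_iff)
    show "hyp_gamma w1 w2 (of_real t + \<i> * of_real (x + c) + \<i> * of_real l / 2 - \<i> * of_real w / 2 + \<i> * of_real \<tau>) *
        hyp_gamma w1 w2 (of_real t + \<i> * of_real (x + c) + \<i> * of_real l / 2 - \<i> * of_real w / 2 - \<i> * of_real \<tau>) *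
       (hyp_gamma w1 w2 (of_real t - \<i> * of_real l / 2 - \<i> * of_real w / 2 + \<i> * of_real \<sigma>) *
        hyp_gamma w1 w2 (of_real t - \<i> * of_real l / 2 - \<i> * of_real w / 2 - \<i> * of_real \<sigma>)) /
       (hyp_gamma w1 w2 (of_real t + \<i> * of_real (x + c) - \<i> * of_real l / 2 + \<i> * of_real w / 2 + \<i> * of_real \<rho>) *
        hyp_gamma w1 w2 (of_real t + \<i> * of_real (x + c) - \<i> * of_real l / 2 + \<i> * of_real w / 2 - \<i> * of_real \<rho>) *
       (hyp_gamma w1 w2 (of_real t + \<i> * of_real l / 2 + \<i> * of_real w / 2 + \<i> * of_real \<upsilon>) *
        hyp_gamma w1 w2 (of_real t + \<i> * of_real l / 2 + \<i> * of_real w / 2 - \<i> * of_real \<upsilon>))) =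
      (\<Prod>a\<leftarrow>[x + l / 2 - w / 2 + \<tau> + c, x + l / 2 - w / 2 - \<tau> + c, - l / 2 - w / 2 + \<sigma>, - l / 2 - w / 2 - \<sigma>]. hyp_gamma w1 w2 (of_real t + \<i> * of_real a)) /
      (\<Prod>b\<leftarrow>[x - l / 2 + w / 2 + \<rho> + c, x - l / 2 + w / 2 - \<rho> + c, l / 2 + w / 2 + \<upsilon>, l / 2 + w / 2 - \<upsilon>]. hyp_gamma w1 w2 (of_real t + \<i> * of_real b))"
      unfolding args list.map prod_list.Cons prod_list.Nil by (simp only: mult.assoc mult_1_right)
  qed
qed

text \<open>The large ratio of the periods keeps the telescoped function free of poles between the
  two contours. The bounds on x, in particular 0 < x, keep the denominators of the coefficients away
  from 0.\<close>

lemma psi_integral_AW_relation: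
  fixes w1 w2 \<rho> \<sigma> \<tau> \<upsilon> x l :: real
  assumes w: "w1 > 0" "20 * w1 < w2"
    and small: "10 * \<bar>\<rho>\<bar> < w1" "10 * \<bar>\<sigma>\<bar> < w1" "10 * \<bar>\<tau>\<bar> < w1" "10 * \<bar>\<upsilon>\<bar> < w1" "0 < x" "10 * x < w1" "10 * \<bar>l\<bar> < w1"
  defines "\<gamma> \<equiv> gamma_par \<rho> \<sigma> \<tau> \<upsilon>" and "ix \<equiv> \<i> * complex_of_real x" and "il \<equiv> \<i> * complex_of_real l"
  shows "AW_up w1 w2 \<gamma> ix * psi_integral w1 w2 \<rho> \<sigma> \<tau> \<upsilon> (ix + \<i> * w1) il
       + AW_down w1 w2 \<gamma> ix * psi_integral w1 w2 \<rho> \<sigma> \<tau> \<upsilon> (ix - \<i> * w1) il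
       = (AW_coeff w1 w2 \<gamma> ix + AW_coeff w1 w2 \<gamma> (- ix) + AW_eigenvalue w1 w2 \<gamma> il) * psi_integral w1 w2 \<rho> \<sigma> \<tau> \<upsilon> ix il"
proof -
  define e where "e = qexp (of_real w2)"
  have w2: "w2 > 0" "complex_of_real w2 \<noteq> 0" using w by auto
  have e_add: "e (u + v) = e u * e v" and e_diff: "e (u - v) = e u / e v" and e_minus: "e (- u) = 1 / e u"
    and e0: "e u \<noteq> 0" for u v
    by (simp_all add: e_def qexp_add qexp_diff qexp_minus divide_inverse)
  have e_i4: "e (\<i> * of_real w2 / 4) = \<i>" unfolding e_def by (rule qexp_quarter_period[OF w2(2)])
  define X where "X = e ix"
  define L where "L = e (il / 2)"
  define Q where "Q = e (\<i> * of_real w1 / 4)"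
  define S where "S = e (\<i> * of_real \<sigma>)"
  define R where "R = e (\<i> * of_real \<rho>)"
  define T where "T = e (\<i> * of_real \<tau>)"
  define U where "U = e (\<i> * of_real \<upsilon>)"
  define q where "q = Q\<^sup>2"
  \<comment> \<open>This is the \<open>l\<close> of the certificate: \<open>lq * q\<close> is L^2 =
    exp (2 pi lambda / w2), which turns \<open>v\<close> into the eigenvalue.\<close>
  define lq where "lq = L\<^sup>2 / Q\<^sup>2"
  define y where "y = q * X"
  define y' where "y' = q / X"
  have nz: "q \<noteq> 0" "X \<noteq> 0" "lq \<noteq> 0" "S \<noteq> 0" "R \<noteq> 0" "T \<noteq> 0" "U \<noteq> 0" "L \<noteq> 0" "Q \<noteq> 0"
    by (simp_all add: X_def L_def Q_def S_def R_def T_def U_def q_def lq_def e0)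
  have e_sq: "e (2 * u) = (e u)\<^sup>2" for u by (simp add: e_def qexp_double)
  have q_eq: "q = e (\<i> * of_real w1 / 2)"
    unfolding q_def Q_def e_sq[symmetric] by simp
  have q2_eq: "q\<^sup>2 = e (\<i> * of_real w1)"
    unfolding q_eq e_sq[symmetric] by simp
  have L2_eq: "L\<^sup>2 = e il"
    unfolding L_def e_sq[symmetric] by simp
  have ne1: "e (\<i> * of_real a) \<noteq> 1" if "0 < a" "a < w2" for a
  proof
    assume "e (\<i> * of_real a) = 1"
    hence "exp (2 * of_real pi * (\<i> * of_real a) / of_real w2) = 1" by (simp add: e_def qexp_def)
    hence "exp (\<i> * of_real (2 * pi * a / w2)) = 1" by (simp add: mult_ac)
    hence "cos (2 * pi * a / w2) = 1" by (simp add: exp_eq_polar complex_eq_iff)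
    then obtain n :: int where n: "2 * pi * a / w2 = of_int n * 2 * pi" using cos_one_2pi_int by blast
    hence "(2 * pi) * (a / w2) = (2 * pi) * of_int n" by (simp add: mult_ac)
    hence "a / w2 = of_int n" by (simp only: mult_cancel_left) simp
    moreover have "0 < a / w2" "a / w2 < 1" using that w2 by simp_all
    ultimately have "0 < n" "n < 1" by auto
    thus False by simp
  qed
  have X1: "X\<^sup>2 \<noteq> 1"
    using ne1[of "2 * x"] small w unfolding X_def ix_def e_sq[symmetric] by (simp add: mult.left_commute)
  have y1: "y\<^sup>2 \<noteq> 1"
  proof -
    have "y\<^sup>2 = e (\<i> * of_real (w1 + 2 * x))"
      unfolding y_def power_mult_distrib q2_eq X_def e_sq[symmetric] e_add[symmetric] by (simp add: ix_def algebra_simps)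
    thus ?thesis using ne1[of "w1 + 2 * x"] small w by simp
  qed
  have y'1: "y'\<^sup>2 \<noteq> 1"
  proof -
    have "y'\<^sup>2 = e (\<i> * of_real (w1 - 2 * x))"
      unfolding y'_def power_divide q2_eq X_def e_sq[symmetric] e_diff[symmetric] by (simp add: ix_def algebra_simps)
    thus ?thesis using ne1[of "w1 - 2 * x"] small w by simp
  qed
  define h where "h = S / U"
  define r where "r = R + 1 / R"
  define s where "s = S + 1 / S"
  define t where "t = T + 1 / T"
  define u where "u = U + 1 / U"
  have G: "e (\<i> * \<gamma> 0) = S / R" "e (\<i> * \<gamma> 1) = S * R" "e (\<i> * \<gamma> 2) = 1 / (T * U)" "e (\<i> * \<gamma> 3) = T / U" "e (\<i> * dual_par \<gamma> 0) = h"
  proof -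
    have "\<i> * \<gamma> 0 = \<i> * of_real \<sigma> - \<i> * of_real \<rho>" "\<i> * \<gamma> 1 = \<i> * of_real \<sigma> + \<i> * of_real \<rho>"
       "\<i> * \<gamma> 2 = - (\<i> * of_real \<tau> + \<i> * of_real \<upsilon>)" "\<i> * \<gamma> 3 = \<i> * of_real \<tau> - \<i> * of_real \<upsilon>"
       "\<i> * dual_par \<gamma> 0 = \<i> * of_real \<sigma> - \<i> * of_real \<upsilon>"
      unfolding \<gamma>_def dual_par_0_gamma_par by (simp_all add: gamma_par_def algebra_simps)
    thus "e (\<i> * \<gamma> 0) = S / R" "e (\<i> * \<gamma> 1) = S * R" "e (\<i> * \<gamma> 2) = 1 / (T * U)" "e (\<i> * \<gamma> 3) = T / U" "e (\<i> * dual_par \<gamma> 0) = h"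
      by (simp_all only: e_add e_diff e_minus S_def R_def T_def U_def h_def)
  qed
  have yy: "e (ix + \<i> * of_real w1 / 2) = y" "e (\<i> * of_real w1 / 2 - ix) = y'" "e (- ix + \<i> * of_real w1 / 2) = y'"
    unfolding y_def y'_def X_def q_eq by (simp_all add: e_add e_diff e_minus)
  have dens: "e (2 * ix) = X\<^sup>2" "e (2 * ix + \<i> * of_real w1) = y\<^sup>2" "e (- 2 * ix) = 1 / X\<^sup>2" "e (- 2 * ix + \<i> * of_real w1) = y'\<^sup>2"
    "e (2 * - ix) = 1 / X\<^sup>2" "e (2 * - ix + \<i> * of_real w1) = y'\<^sup>2"
    by (simp_all add: e_add e_diff e_minus e_sq q2_eq[symmetric] X_def[symmetric] y_def y'_def power_mult_distrib power_divide)
  define up where "up = h * ((1 + y * (S / R)) * (1 + y / (S / R)) * (1 + y * (S * R)) * (1 + y / (S * R))) / ((1 - X\<^sup>2) * (1 - y\<^sup>2))"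
  define down where "down = h * ((1 + y' * (T / U)) * (1 + y' / (T / U)) * (1 + y' * (T * U)) * (1 + y' / (T * U))) / ((1 - 1 / X\<^sup>2) * (1 - y'\<^sup>2))"
  define A where "A = (1 + y * (S / R)) * (1 + y * (S * R)) * (1 + y / (T * U)) * (1 + y * (T / U)) / ((1 - X\<^sup>2) * (1 - y\<^sup>2))"
  define A' where "A' = (1 + y' * (S / R)) * (1 + y' * (S * R)) * (1 + y' / (T * U)) * (1 + y' * (T / U)) / ((1 - 1 / X\<^sup>2) * (1 - y'\<^sup>2))"
  define v where "v = - (q * h) * (lq * q + 1 / (lq * q) + q * h + 1 / (q * h))"
  have up_eq: "AW_up w1 w2 \<gamma> ix = up"
    unfolding AW_up_def up_def e_def[symmetric] e_add[of _ "\<i> * \<gamma> _"] e_diff[of _ "\<i> * \<gamma> _"] yy dens G by simp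
  have down_eq: "AW_down w1 w2 \<gamma> ix = down"
    unfolding AW_down_def down_def e_def[symmetric] e_add[of _ "\<i> * \<gamma> _"] e_diff[of _ "\<i> * \<gamma> _"] yy dens G by simp
  have A_eq: "AW_coeff w1 w2 \<gamma> ix = A"
    unfolding AW_coeff_eq_qexp[OF w2(2)] A_def e_def[symmetric] e_add[of _ "\<i> * \<gamma> _"] yy dens G by simp
  have A'_eq: "AW_coeff w1 w2 \<gamma> (- ix) = A'"
    unfolding AW_coeff_eq_qexp[OF w2(2)] A'_def e_def[symmetric] e_add[of _ "\<i> * \<gamma> _"] yy dens G by simp
  have v_eq: "AW_eigenvalue w1 w2 \<gamma> il = v"
  proof -
    have "lq * q = L\<^sup>2" using nz by (simp add: lq_def q_def)
    thus ?thesis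
      unfolding AW_eigenvalue_eq_qexp e_def[symmetric] v_def e_minus e_add G q_eq[symmetric] L2_eq[symmetric] by simp
  qed
  obtain \<alpha> \<beta> \<delta> where cert: "\<And>k j. k \<noteq> 0 \<Longrightarrow> j = k * y * y' \<Longrightarrow>
      up * (t - (j + 1 / j)) * (t - (k + 1 / k)) + down * (r + (j / lq + lq / j)) * (r + (k / lq + lq / k))
        - (A + A' + v) * (t - (k + 1 / k)) * (r + (j / lq + lq / j))
      = (t - (k + 1 / k)) * (s - (j / (y * lq) + y * lq / j)) * (\<alpha> + \<beta> * j + \<delta> / j)
        - (u + (k * y' + 1 / (k * y'))) * (r + (j / lq + lq / j)) * (\<alpha> + \<beta> * k + \<delta> / k)"
    using AW_certificate_full[OF nz(1-7) X1 y_def y'_def y1 y'1, folded h_def r_def s_def t_def u_def,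
        folded up_def down_def A_def A'_def v_def] by blast
  define W where "W = (w1 + w2) / 2"
  define A1 where "A1 = x + l / 2 - W / 2 + \<tau>"
  define A2 where "A2 = x + l / 2 - W / 2 - \<tau>"
  define B1 where "B1 = - l / 2 - W / 2 + \<sigma>"
  define B2 where "B2 = - l / 2 - W / 2 - \<sigma>"
  define C1 where "C1 = x - l / 2 + W / 2 + \<rho>"
  define C2 where "C2 = x - l / 2 + W / 2 - \<rho>"
  define D1 where "D1 = l / 2 + W / 2 + \<upsilon>"
  define D2 where "D2 = l / 2 + W / 2 - \<upsilon>"
  define th where "th = (\<lambda>a z. 2 * cosh (of_real pi * (z + \<i> * of_real (a + w1 / 2)) / of_real w2))"
  have pair: "th (b + c) z * th (b - c) z = (e (\<i> * of_real c) + 1 / e (\<i> * of_real c)) +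
      (e (z + \<i> * of_real (b + w1 / 2)) + 1 / e (z + \<i> * of_real (b + w1 / 2)))" for b c z
    using cosh_pair_eq_qexp[of "z + \<i> * of_real (b + w1 / 2)" "\<i> * of_real c" "of_real w2"]
    unfolding th_def e_def by (simp add: algebra_simps)
  \<comment> \<open>Chosen so that k = kappa e(z) makes the exponential belonging to the pair A1 -
    w1, A2 - w1 equal to -k. The factor i comes from the quarter period w2/4 contained in
    W/2.\<close>
  define \<kappa> where "\<kappa> = \<i> * X * L / (Q * q)"
  define K where "K = (\<lambda>c. LBINT z. hyp_gamma_quot w1 w2 [A1 + c, A2 + c, B1, B2] [C1 + c, C2 + c, D1, D2] (of_real z))"
  have id: "up * (th A1 z * th A2 z) * (th (A1 - w1) z * th (A2 - w1) z) + down * (th C1 z * th C2 z) * (th (C1 - w1) z * th (C2 - w1) z)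
      + - (A + A' + v) * (th (A1 - w1) z * th (A2 - w1) z) * (th C1 z * th C2 z)
      = th (A1 - w1) z * th (A2 - w1) z * (th B1 z * th B2 z) *
         (\<alpha> + \<beta> * \<kappa> * exp (2 * of_real pi * (z + \<i> * of_real w1) / of_real w2) + \<delta> / \<kappa> * exp (- (2 * of_real pi * (z + \<i> * of_real w1) / of_real w2)))
       - th (D1 - w1) z * th (D2 - w1) z * (th C1 z * th C2 z) *
         (\<alpha> + \<beta> * \<kappa> * exp (2 * of_real pi * z / of_real w2) + \<delta> / \<kappa> * exp (- (2 * of_real pi * z / of_real w2)))" for z :: complex
  proof -
    define k where "k = \<kappa> * e z"
    define j where "j = k * q\<^sup>2"
    have k0: "k \<noteq> 0" and \<kappa>0: "\<kappa> \<noteq> 0" using nz by (auto simp: k_def \<kappa>_def e0)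
    have j: "j = k * y * y'" using nz by (simp add: j_def y_def y'_def power2_eq_square)
    have shift: "e (z + \<i> * of_real (b - w1 + w1 / 2)) = e (z + \<i> * of_real (b + w1 / 2)) / q\<^sup>2" for b
      unfolding q2_eq e_diff[symmetric] by (simp add: algebra_simps)
    have EA: "e (z + \<i> * of_real (x + l / 2 - W / 2 + w1 / 2)) = - j"
    proof -
      have "z + \<i> * of_real (x + l / 2 - W / 2 + w1 / 2) = z + ix + il / 2 + \<i> * of_real w1 / 4 - \<i> * of_real w2 / 4"
        by (simp add: complex_eq_iff ix_def il_def W_def field_simps)
      hence "e (z + \<i> * of_real (x + l / 2 - W / 2 + w1 / 2)) = e z * X * L * Q / \<i>"
        by (simp only: e_add e_diff X_def L_def Q_def e_i4)
      also have "\<dots> = - j" using nz by (simp add: j_def k_def \<kappa>_def q_def field_simps power2_eq_square)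
      finally show ?thesis .
    qed
    have EC: "e (z + \<i> * of_real (x - l / 2 + W / 2 + w1 / 2)) = j / lq"
    proof -
      have "z + \<i> * of_real (x - l / 2 + W / 2 + w1 / 2) = z + ix - il / 2 + \<i> * of_real w1 / 4 + \<i> * of_real w1 / 2 + \<i> * of_real w2 / 4"
        by (simp add: complex_eq_iff ix_def il_def W_def field_simps)
      hence "e (z + \<i> * of_real (x - l / 2 + W / 2 + w1 / 2)) = e z * X / L * Q * q * \<i>"
        by (simp only: e_add e_diff X_def L_def Q_def q_eq e_i4)
      also have "\<dots> = j / lq" using nz by (simp add: j_def k_def \<kappa>_def q_def lq_def field_simps power2_eq_square)
      finally show ?thesis .
    qed
    have EB: "e (z + \<i> * of_real (- l / 2 - W / 2 + w1 / 2)) = - (j / (y * lq))"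
    proof -
      have "z + \<i> * of_real (- l / 2 - W / 2 + w1 / 2) = z - il / 2 + \<i> * of_real w1 / 4 - \<i> * of_real w2 / 4"
        by (simp add: complex_eq_iff il_def W_def field_simps)
      hence "e (z + \<i> * of_real (- l / 2 - W / 2 + w1 / 2)) = e z / L * Q / \<i>"
        by (simp only: e_add e_diff L_def Q_def e_i4)
      also have "\<dots> = - (j / (y * lq))" using nz by (simp add: j_def k_def \<kappa>_def q_def lq_def y_def field_simps power2_eq_square)
      finally show ?thesis .
    qed
    have ED: "e (z + \<i> * of_real (l / 2 + W / 2 + w1 / 2)) = k * y' * q\<^sup>2"
    proof -
      have "z + \<i> * of_real (l / 2 + W / 2 + w1 / 2) = z + il / 2 + \<i> * of_real w1 / 4 + \<i> * of_real w1 / 2 + \<i> * of_real w2 / 4"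
        by (simp add: complex_eq_iff il_def W_def field_simps)
      hence "e (z + \<i> * of_real (l / 2 + W / 2 + w1 / 2)) = e z * L * Q * q * \<i>"
        by (simp only: e_add e_diff L_def Q_def q_eq e_i4)
      also have "\<dots> = k * y' * q\<^sup>2" using nz by (simp add: k_def \<kappa>_def q_def y'_def field_simps power2_eq_square)
      finally show ?thesis .
    qed
    have TA: "th A1 z * th A2 z = t - (j + 1 / j)"
      unfolding A1_def A2_def pair EA t_def T_def[symmetric] using nz by simp
    have TA': "th (A1 - w1) z * th (A2 - w1) z = t - (k + 1 / k)"
    proof -
      have "A1 - w1 = (x + l / 2 - W / 2 - w1) + \<tau>" "A2 - w1 = (x + l / 2 - W / 2 - w1) - \<tau>"
        by (simp_all add: A1_def A2_def)
      thus ?thesis unfolding t_def T_def by (simp only: pair shift EA) (use nz in \<open>simp add: j_def\<close>)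
    qed
    have TC: "th C1 z * th C2 z = r + (j / lq + lq / j)"
      unfolding C1_def C2_def pair EC r_def R_def[symmetric] by simp
    have TC': "th (C1 - w1) z * th (C2 - w1) z = r + (k / lq + lq / k)"
    proof -
      have "C1 - w1 = (x - l / 2 + W / 2 - w1) + \<rho>" "C2 - w1 = (x - l / 2 + W / 2 - w1) - \<rho>"
        by (simp_all add: C1_def C2_def)
      thus ?thesis unfolding r_def R_def by (simp only: pair shift EC) (use nz in \<open>simp add: j_def\<close>)
    qed
    have TB: "th B1 z * th B2 z = s - (j / (y * lq) + y * lq / j)"
      unfolding B1_def B2_def pair EB s_def S_def[symmetric] by simp
    have TD': "th (D1 - w1) z * th (D2 - w1) z = u + (k * y' + 1 / (k * y'))"
    proof -
      have "D1 - w1 = (l / 2 + W / 2 - w1) + \<upsilon>" "D2 - w1 = (l / 2 + W / 2 - w1) - \<upsilon>"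
        by (simp_all add: D1_def D2_def)
      thus ?thesis unfolding u_def U_def by (simp only: pair shift ED) (use nz in \<open>simp add: j_def\<close>)
    qed
    have f: "\<alpha> + \<beta> * \<kappa> * exp (2 * of_real pi * z / of_real w2) + \<delta> / \<kappa> * exp (- (2 * of_real pi * z / of_real w2)) = \<alpha> + \<beta> * k + \<delta> / k" (is "?f z = _")
      unfolding k_def e_def qexp_def by (simp add: exp_minus divide_inverse mult_ac)
    have f': "\<alpha> + \<beta> * \<kappa> * exp (2 * of_real pi * (z + \<i> * of_real w1) / of_real w2) + \<delta> / \<kappa> * exp (- (2 * of_real pi * (z + \<i> * of_real w1) / of_real w2)) = \<alpha> + \<beta> * j + \<delta> / j"
    proof -
      have "j = \<kappa> * e (z + \<i> * of_real w1)" by (simp add: j_def k_def e_add q2_eq mult.assoc)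
      thus ?thesis unfolding e_def qexp_def by (simp add: exp_minus divide_inverse mult_ac)
    qed
    show ?thesis
      unfolding TA TA' TC TC' TB TD' f f' cert[OF k0 j, symmetric] by (simp only: mult_minus_left diff_conv_add_uminus)
  qed
  have "up * K w1 + down * K (- w1) + (- (A + A' + v)) * K 0 = 0"
    unfolding K_def
  \<comment> \<open>The margin w1/4 adds up from x, l/2 and one of the four parameters: 1/10 + 1/20
    + 1/10.\<close>
  proof (rule hyp_gamma_telescope[where m = "W / 2 + w1 / 4", OF _ _ _ _ _ id[unfolded th_def]])
    show "w1 > 0" "w2 > 0" using w by auto
    have "W = w1 / 2 + w2 / 2" by (simp add: W_def)
    thus "W / 2 + w1 / 4 + 3 * w1 < w2 / 2" using w by linarith
    have Wpos: "W > 0" using w by (simp add: W_def)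
    show "\<bar>a\<bar> \<le> W / 2 + w1 / 4" if "a \<in> {A1, A2, B1, B2, C1, C2, D1, D2}" for a
    proof -
      have sm: "- w1 < 10 * \<rho>" "10 * \<rho> < w1" "- w1 < 10 * \<sigma>" "10 * \<sigma> < w1" "- w1 < 10 * \<tau>" "10 * \<tau> < w1"
        "- w1 < 10 * \<upsilon>" "10 * \<upsilon> < w1" "- w1 < 10 * l" "10 * l < w1" "0 < x" "10 * x < w1"
        using small by (simp_all add: abs_if split: if_splits)
      have "\<bar>A1\<bar> \<le> W / 2 + w1 / 4" "\<bar>A2\<bar> \<le> W / 2 + w1 / 4" "\<bar>B1\<bar> \<le> W / 2 + w1 / 4" "\<bar>B2\<bar> \<le> W / 2 + w1 / 4"
           "\<bar>C1\<bar> \<le> W / 2 + w1 / 4" "\<bar>C2\<bar> \<le> W / 2 + w1 / 4" "\<bar>D1\<bar> \<le> W / 2 + w1 / 4" "\<bar>D2\<bar> \<le> W / 2 + w1 / 4"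
        unfolding A1_def A2_def B1_def B2_def C1_def C2_def D1_def D2_def
        by (rule abs_leI; use sm Wpos w(1) in linarith)+
      with that show ?thesis by (elim insertE emptyE) (simp_all only:)
    qed
    show "A1 + A2 + B1 + B2 - (C1 + C2 + D1 + D2) = - (2 * (w1 + w2))"
      by (simp add: A1_def A2_def B1_def B2_def C1_def C2_def D1_def D2_def W_def field_simps)
  qed
  moreover have "psi_integral w1 w2 \<rho> \<sigma> \<tau> \<upsilon> (\<i> * of_real (x + c)) il = K c" for c
    unfolding il_def psi_integral_eq_quot K_def A1_def A2_def B1_def B2_def C1_def C2_def D1_def D2_def W_def ..
  from this[of w1] this[of "- w1"] this[of 0]
  have "psi_integral w1 w2 \<rho> \<sigma> \<tau> \<upsilon> (ix + \<i> * w1) il = K w1" "psi_integral w1 w2 \<rho> \<sigma> \<tau> \<upsilon> (ix - \<i> * w1) il = K (- w1)"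
       "psi_integral w1 w2 \<rho> \<sigma> \<tau> \<upsilon> ix il = K 0"
    by (simp_all add: ix_def algebra_simps)
  ultimately show ?thesis
    unfolding up_eq down_eq A_eq A'_eq v_eq by (simp add: algebra_simps)
qed

section \<open>Functions of several complex variables\<close>

lemma bounded_linear_smult_vec_left: "bounded_linear (\<lambda>s::complex. s *s (v :: complex ^ 'n))"
proof -
  have "linear (\<lambda>s::complex. s *s v)"
    by (rule linearI) (simp_all add: vec_eq_iff distrib_right)
  thus ?thesis by (rule linear_conv_bounded_linear[THEN iffD1])
qed

lemma mv_holomorphic_on_subset: "mv_holomorphic_on f U \<Longrightarrow> V \<subseteq> U \<Longrightarrow> mv_holomorphic_on f V"
  by (auto simp: mv_holomorphic_on_def)

lemma mv_holomorphic_onE: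
  assumes "mv_holomorphic_on f U" "p \<in> U"
  obtains f' where "(f has_derivative f') (at p)" "\<And>c v. f' (c *s v) = c * f' v"
  using assms unfolding mv_holomorphic_on_def by blast

lemma mv_holomorphic_onI:
  assumes "\<And>p. p \<in> U \<Longrightarrow> (f has_derivative F p) (at p)" "\<And>p c v. p \<in> U \<Longrightarrow> F p (c *s v) = c * F p v"
  shows "mv_holomorphic_on f U"
  using assms unfolding mv_holomorphic_on_def by blast

lemma mv_holomorphic_on_imp_continuous_on:
  assumes "mv_holomorphic_on f U"
  shows "continuous_on U f"
proof (rule continuous_at_imp_continuous_on, rule ballI)
  fix p assume "p \<in> U"
  with assms obtain f' where "(f has_derivative f') (at p)" by (rule mv_holomorphic_onE)
  thus "isCont f p" by (rule has_derivative_continuous)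
qed

lemma mv_holomorphic_on_const: "mv_holomorphic_on (\<lambda>p. c) U"
  by (rule mv_holomorphic_onI[where F = "\<lambda>_ _. 0"]) simp_all

lemma mv_holomorphic_on_component: "mv_holomorphic_on (\<lambda>p. p $ i) U"
  by (rule mv_holomorphic_onI[where F = "\<lambda>_ v. v $ i"])
     (simp_all add: bounded_linear_imp_has_derivative[OF bounded_linear_vec_nth])

lemma mv_holomorphic_on_add:
  assumes "mv_holomorphic_on f U" "mv_holomorphic_on g U"
  shows "mv_holomorphic_on (\<lambda>p. f p + g p) U"
  unfolding mv_holomorphic_on_def
proof
  fix p assume p: "p \<in> U"
  obtain f' where f': "(f has_derivative f') (at p)" "\<And>c v. f' (c *s v) = c * f' v"
    using mv_holomorphic_onE[OF assms(1) p] by metis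
  obtain g' where g': "(g has_derivative g') (at p)" "\<And>c v. g' (c *s v) = c * g' v"
    using mv_holomorphic_onE[OF assms(2) p] by metis
  have "((\<lambda>p. f p + g p) has_derivative (\<lambda>v. f' v + g' v)) (at p)"
    using f'(1) g'(1) by (rule has_derivative_add)
  thus "\<exists>h. ((\<lambda>p. f p + g p) has_derivative h) (at p) \<and> (\<forall>c v. h (c *s v) = c * h v)"
    by (intro exI[of _ "\<lambda>v. f' v + g' v"] conjI) (simp_all add: f'(2) g'(2) distrib_left)
qed

lemma mv_holomorphic_on_mult:
  assumes "mv_holomorphic_on f U" "mv_holomorphic_on g U"
  shows "mv_holomorphic_on (\<lambda>p. f p * g p) U"
  unfolding mv_holomorphic_on_def
proof
  fix p assume p: "p \<in> U"
  obtain f' where f': "(f has_derivative f') (at p)" "\<And>c v. f' (c *s v) = c * f' v"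
    using mv_holomorphic_onE[OF assms(1) p] by metis
  obtain g' where g': "(g has_derivative g') (at p)" "\<And>c v. g' (c *s v) = c * g' v"
    using mv_holomorphic_onE[OF assms(2) p] by metis
  have "((\<lambda>p. f p * g p) has_derivative (\<lambda>v. f p * g' v + f' v * g p)) (at p)"
    using f'(1) g'(1) by (rule has_derivative_mult)
  thus "\<exists>h. ((\<lambda>p. f p * g p) has_derivative h) (at p) \<and> (\<forall>c v. h (c *s v) = c * h v)"
    by (intro exI[of _ "\<lambda>v. f p * g' v + f' v * g p"] conjI) (simp_all add: f'(2) g'(2) distrib_left mult_ac)
qed

lemma mv_holomorphic_on_compose_field:
  assumes "mv_holomorphic_on f U" "\<And>p. p \<in> U \<Longrightarrow> h field_differentiable at (f p)"
  shows "mv_holomorphic_on (\<lambda>p. h (f p)) U"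
  unfolding mv_holomorphic_on_def
proof
  fix p assume p: "p \<in> U"
  obtain f' where f': "(f has_derivative f') (at p)" "\<And>c v. f' (c *s v) = c * f' v"
    using assms(1) p unfolding mv_holomorphic_on_def by metis
  obtain h' where "(h has_field_derivative h') (at (f p))"
    using assms(2)[OF p] unfolding field_differentiable_def by blast
  hence "(h has_derivative (\<lambda>v. h' * v)) (at (f p))" by (simp add: has_field_derivative_def)
  from has_derivative_compose[OF f'(1) this]
  show "\<exists>g. ((\<lambda>p. h (f p)) has_derivative g) (at p) \<and> (\<forall>c v. g (c *s v) = c * g v)"
    by (intro exI[of _ "\<lambda>v. h' * f' v"]) (auto simp: f'(2))
qed

lemma mv_holomorphic_on_minus: "mv_holomorphic_on f U \<Longrightarrow> mv_holomorphic_on (\<lambda>p. - f p) U"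
  using mv_holomorphic_on_mult[OF mv_holomorphic_on_const[of "- 1"]] by simp

lemma mv_holomorphic_on_diff:
  "mv_holomorphic_on f U \<Longrightarrow> mv_holomorphic_on g U \<Longrightarrow> mv_holomorphic_on (\<lambda>p. f p - g p) U"
  using mv_holomorphic_on_add[OF _ mv_holomorphic_on_minus] by simp

lemma mv_holomorphic_on_exp: "mv_holomorphic_on f U \<Longrightarrow> mv_holomorphic_on (\<lambda>p. exp (f p)) U"
  by (rule mv_holomorphic_on_compose_field) (auto intro: field_differentiable_within_exp)

lemma mv_holomorphic_on_divide:
  assumes "mv_holomorphic_on f U" "mv_holomorphic_on g U" "\<And>p. p \<in> U \<Longrightarrow> g p \<noteq> 0"
  shows "mv_holomorphic_on (\<lambda>p. f p / g p) U"
proof -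
  have "mv_holomorphic_on (\<lambda>p. inverse (g p)) U"
    by (rule mv_holomorphic_on_compose_field[OF assms(2)])
       (use assms(3) in \<open>auto intro!: field_differentiable_inverse field_differentiable_ident\<close>)
  from mv_holomorphic_on_mult[OF assms(1) this] show ?thesis by (simp add: divide_inverse)
qed

lemmas mv_holomorphic_intros =
  mv_holomorphic_on_const mv_holomorphic_on_component mv_holomorphic_on_add mv_holomorphic_on_diff
  mv_holomorphic_on_minus mv_holomorphic_on_mult mv_holomorphic_on_exp mv_holomorphic_on_divide

lemma mv_holomorphic_on_compose_linear:
  assumes "mv_holomorphic_on f V" "bounded_linear \<phi>" "\<And>c v. \<phi> (c *s v) = c *s \<phi> v" "\<And>p. p \<in> U \<Longrightarrow> \<phi> p \<in> V"
  shows "mv_holomorphic_on (\<lambda>p. f (\<phi> p)) U"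
  unfolding mv_holomorphic_on_def
proof
  fix p assume p: "p \<in> U"
  obtain f' where f': "(f has_derivative f') (at (\<phi> p))" "\<And>c v. f' (c *s v) = c * f' v"
    using assms(1) assms(4)[OF p] unfolding mv_holomorphic_on_def by metis
  have "(\<phi> has_derivative \<phi>) (at p)" using assms(2) by (rule bounded_linear_imp_has_derivative)
  from has_derivative_compose[OF this f'(1)]
  show "\<exists>g. ((\<lambda>p. f (\<phi> p)) has_derivative g) (at p) \<and> (\<forall>c v. g (c *s v) = c * g v)"
    by (intro exI[of _ "\<lambda>v. f' (\<phi> v)"]) (auto simp: f'(2) assms(3))
qed

lemma mv_holomorphic_on_line:
  assumes "mv_holomorphic_on f U" "open U"
  shows "(\<lambda>s. f (q + s *s v)) holomorphic_on {s. q + s *s v \<in> U}" and "open {s. q + s *s v \<in> U}"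
proof -
  have cont: "continuous_on UNIV (\<lambda>s::complex. q + s *s v)"
    by (intro continuous_intros linear_continuous_on bounded_linear_smult_vec_left)
  show op: "open {s. q + s *s v \<in> U}"
    using open_vimage[OF assms(2) cont] by (simp add: vimage_def)
  have "(\<lambda>s. f (q + s *s v)) field_differentiable at s" if s: "q + s *s v \<in> U" for s
  proof -
    obtain f' where f': "(f has_derivative f') (at (q + s *s v))" "\<And>c v. f' (c *s v) = c * f' v"
      using assms(1) s unfolding mv_holomorphic_on_def by metis
    have "((\<lambda>s. q + s *s v) has_derivative (\<lambda>h. h *s v)) (at s)"
      by (auto intro!: derivative_eq_intros bounded_linear_imp_has_derivative bounded_linear_smult_vec_left)
    from has_derivative_compose[OF this f'(1)]
    have "((\<lambda>s. f (q + s *s v)) has_derivative (\<lambda>h. f' v * h)) (at s)" by (simp add: f'(2) mult.commute)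
    thus ?thesis unfolding field_differentiable_def has_field_derivative_def by blast
  qed
  thus "(\<lambda>s. f (q + s *s v)) holomorphic_on {s. q + s *s v \<in> U}"
    unfolding holomorphic_on_def by (auto intro: field_differentiable_at_within)
qed

text \<open>The complex line through q and p meets \<open>U\<close> in a convex, hence connected,
  set, and f vanishes on the part of it in \<open>W\<close>; the one-variable identity theorem then
  reaches p.\<close>

lemma mv_holomorphic_on_identity:
  assumes hol: "mv_holomorphic_on f U" and U: "open U" "convex U"
    and W: "open W" "q \<in> W" "W \<subseteq> U" and zero: "\<And>p. p \<in> W \<Longrightarrow> f p = 0" and p: "p \<in> U"
  shows "f p = 0"
proof -
  define v where "v = p - q"
  define S where "S = {s. q + s *s v \<in> U}"
  have S: "(\<lambda>s. f (q + s *s v)) holomorphic_on S" "open S"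
    using mv_holomorphic_on_line[OF hol U(1)] unfolding S_def by blast+
  have "convex S"
  proof -
    have "S = (\<lambda>s. s *s v) -` ((\<lambda>x. - q + x) ` U)"
    proof (intro equalityI subsetI)
      fix s assume "s \<in> S"
      hence "- q + (q + s *s v) \<in> (\<lambda>x. - q + x) ` U" unfolding S_def by blast
      thus "s \<in> (\<lambda>s. s *s v) -` ((\<lambda>x. - q + x) ` U)" by simp
    next
      fix s assume "s \<in> (\<lambda>s. s *s v) -` ((\<lambda>x. - q + x) ` U)"
      then obtain x where "x \<in> U" "s *s v = - q + x" by blast
      thus "s \<in> S" by (simp add: S_def)
    qed
    thus ?thesis
      using convex_linear_vimage[OF bounded_linear.linear[OF bounded_linear_smult_vec_left[of v]] convex_translation[OF U(2), of "- q"]]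
      by simp
  qed
  have T: "open {s. q + s *s v \<in> W}"
    using mv_holomorphic_on_line(2)[OF mv_holomorphic_on_subset[OF hol W(3)] W(1)] .
  show ?thesis
  proof -
    have "f (q + 1 *s v) = 0"
    proof (rule analytic_continuation_open[where s = "{s. q + s *s v \<in> W}" and s' = S and f = "\<lambda>s. f (q + s *s v)" and g = "\<lambda>_. 0"])
      have "q + 0 *s v \<in> W" using W by simp
      thus "{s. q + s *s v \<in> W} \<noteq> {}" by blast
      show "connected S" using \<open>convex S\<close> by (rule convex_connected)
      show "{s. q + s *s v \<in> W} \<subseteq> S" using W by (auto simp: S_def)
      show "f (q + s *s v) = 0" if "s \<in> {s. q + s *s v \<in> W}" for s using that zero by blast
      have "q + 1 *s v \<in> U" using p by (simp add: v_def)
      thus "1 \<in> S" by (simp add: S_def)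
    qed (use S T in auto)
    thus ?thesis by (simp add: v_def)
  qed
qed

text \<open>If f vanished on a nonempty open subset, the identity theorem would make it vanish at p0
  as well.\<close>

lemma mv_holomorphic_on_dense_nonzero:
  assumes hol: "mv_holomorphic_on f U" and U: "open U" "convex U" and p0: "p0 \<in> U" "f p0 \<noteq> 0"
  shows "open {p \<in> U. f p \<noteq> 0}" and "U \<subseteq> closure {p \<in> U. f p \<noteq> 0}"
proof -
  show "open {p \<in> U. f p \<noteq> 0}"
    using continuous_open_preimage[OF mv_holomorphic_on_imp_continuous_on[OF hol] U(1) open_Compl[OF closed_singleton[of 0]]]
    by (simp add: vimage_def Int_def)
  show "U \<subseteq> closure {p \<in> U. f p \<noteq> 0}"
  proof (rule ccontr)
    assume "\<not> U \<subseteq> closure {p \<in> U. f p \<noteq> 0}"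
    then obtain q where q: "q \<in> U" "q \<notin> closure {p \<in> U. f p \<noteq> 0}" by blast
    have "f p0 = 0"
      by (rule mv_holomorphic_on_identity[OF hol U, of "U - closure {p \<in> U. f p \<noteq> 0}" q])
         (use q p0 U closure_subset[of "{p \<in> U. f p \<noteq> 0}"] in auto)
    thus False using p0 by simp
  qed
qed

text \<open>The set of points with real coordinates outside \<open>K\<close> and imaginary coordinates in \<open>K\<close> is a
  maximal totally real subspace: \<open>p = p\<^sub>0 + a + i b\<close> with \<open>a\<close>, \<open>b\<close> in it, and \<open>s \<mapsto> p\<^sub>0 + a + s b\<close>
  stays in it for real \<open>s\<close>.\<close>

definition tot_real :: "'n set \<Rightarrow> (complex ^ 'n) set" where
  "tot_real K = {p. \<forall>i. if i \<in> K then Re (p $ i) = 0 else Im (p $ i) = 0}"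

lemma mv_holomorphic_on_tot_real_identity:
  fixes U :: "(complex ^ 'n) set"
  assumes hol: "mv_holomorphic_on f U" and U: "open U" "convex U" and p0: "p0 \<in> U" "p0 \<in> tot_real K"
    and zero: "\<And>p. p \<in> U \<Longrightarrow> p \<in> tot_real K \<Longrightarrow> f p = 0" and p: "p \<in> U"
  shows "f p = 0"
proof -
  obtain r where r: "r > 0" "ball p0 r \<subseteq> U" using U(1) p0(1) openE by blast
  \<comment> \<open>The components of a and b are bounded by those of v, so |a + s b| <= 3 |v| for
    |s| <= 2. The radius r/3 thus keeps the whole disc |s| < 2 in U, and this disc contains both the
    real segment and s = i.\<close>
  have "f q = 0" if q: "q \<in> ball p0 (r / 3)" for q
  proof -
    define v where "v = q - p0"
    have v: "3 * norm v < r" using q by (simp add: v_def dist_norm norm_minus_commute)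
    define a :: "complex ^ 'n" where "a = (\<chi> i. if i \<in> K then \<i> * of_real (Im (v $ i)) else of_real (Re (v $ i)))"
    define b :: "complex ^ 'n" where "b = (\<chi> i. if i \<in> K then - \<i> * of_real (Re (v $ i)) else of_real (Im (v $ i)))"
    have v_eq: "v = a + \<i> *s b"
      by (auto simp: vec_eq_iff a_def b_def complex_eq_iff)
    have bound: "norm (a + s *s b) \<le> 3 * norm v" if "cmod s \<le> 2" for s
    proof -
      have "norm (a + s *s b) \<le> norm (3 *\<^sub>R v)"
      proof (rule norm_le_componentwise_cart)
        fix i
        have ab: "cmod (a $ i) \<le> cmod (v $ i)" "cmod (b $ i) \<le> cmod (v $ i)"
          using abs_Re_le_cmod[of "v $ i"] abs_Im_le_cmod[of "v $ i"] by (auto simp: a_def b_def norm_mult)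
        have "cmod ((a + s *s b) $ i) \<le> cmod (a $ i) + cmod s * cmod (b $ i)"
          using norm_triangle_ineq[of "a $ i" "s * b $ i"] by (simp add: norm_mult)
        also have "\<dots> \<le> cmod (v $ i) + 2 * cmod (v $ i)"
          using ab that by (intro add_mono mult_mono) auto
        finally show "norm ((a + s *s b) $ i) \<le> norm ((3 *\<^sub>R v) $ i)" by simp
      qed
      thus ?thesis by simp
    qed
    have in_U: "(p0 + a) + s *s b \<in> U" if "s \<in> ball 0 2" for s
    proof -
      have "dist p0 (p0 + x) = norm x" for x by (simp add: dist_norm)
      hence "dist p0 ((p0 + a) + s *s b) = norm (a + s *s b)" by (simp only: add.assoc)
      also have "\<dots> < r" using bound[of s] v that by auto
      finally show ?thesis using r(2) by auto
    qed
    have "f ((p0 + a) + \<i> *s b) = 0"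
    proof (rule analytic_continuation[of "\<lambda>s. f ((p0 + a) + s *s b)" "ball 0 2" "of_real ` {-1<..<1}" 0])
      show "(\<lambda>s. f ((p0 + a) + s *s b)) holomorphic_on ball 0 2"
        using mv_holomorphic_on_line(1)[OF hol U(1), of "p0 + a" b] by (rule holomorphic_on_subset) (use in_U in auto)
      show "of_real ` {-1<..<1::real} \<subseteq> ball (0::complex) 2" by (auto simp: norm_of_real)
      show "(0::complex) islimpt of_real ` {-1<..<1}"
      proof -
        have "\<exists>x\<in>of_real ` {-1<..<1}. x \<noteq> 0 \<and> dist x (0::complex) < e" if "e > 0" for e
        proof -
          have "of_real (min (e / 2) (1 / 2)) \<noteq> (0::complex)" "dist (of_real (min (e / 2) (1 / 2))) (0::complex) < e"
            using that unfolding dist_norm diff_zero norm_of_real of_real_eq_0_iff by (simp_all add: min_def)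
          moreover have "min (e / 2) (1 / 2) \<in> {-1<..<1}" using that by (simp add: min_def)
          ultimately show ?thesis by blast
        qed
        thus ?thesis unfolding islimpt_approachable by blast
      qed
      show "f ((p0 + a) + s *s b) = 0" if "s \<in> of_real ` {-1<..<1}" for s
      proof (rule zero)
        show "(p0 + a) + s *s b \<in> U" using that by (intro in_U) (auto simp: norm_of_real)
        show "(p0 + a) + s *s b \<in> tot_real K"
          using that p0(2) by (auto simp: tot_real_def a_def b_def)
      qed
    qed auto
    thus ?thesis using v_eq by (simp add: v_def algebra_simps)
  qed
  thus ?thesis
    using r by (intro mv_holomorphic_on_identity[OF hol U, of "ball p0 (r / 3)" p0 p] p) auto
qed

section \<open>Local quotients and the identity theorem for meromorphic functions of several
  variables\<close>

definition mv_quotient_on :: "(complex ^ 'n \<Rightarrow> complex) \<Rightarrow> (complex ^ 'n) set \<Rightarrow> (complex ^ 'n \<Rightarrow> complex) \<Rightarrow> (complex ^ 'n \<Rightarrow> complex) \<Rightarrow> bool" where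
  "mv_quotient_on f U g h \<longleftrightarrow> open U \<and> mv_holomorphic_on g U \<and> mv_holomorphic_on h U \<and>
     U \<subseteq> closure {q \<in> U. g q \<noteq> 0} \<and> (\<forall>q\<in>U. g q \<noteq> 0 \<longrightarrow> f q = h q / g q)"

lemma mv_meromorphic_on_iff:
  "mv_meromorphic_on f D \<longleftrightarrow> (\<forall>p\<in>D. \<exists>U g h. mv_quotient_on f U g h \<and> p \<in> U \<and> U \<subseteq> D)"
  unfolding mv_meromorphic_on_def mv_quotient_on_def
  by (intro ball_cong refl ex_cong1) (rule iffI; elim conjE; intro conjI; assumption)

lemma dense_subset_open:
  assumes "open U" "open V" "V \<subseteq> U" "U \<subseteq> closure {q \<in> U. P q}"
  shows "V \<subseteq> closure {q \<in> V. P q}"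
proof (rule ccontr)
  assume "\<not> V \<subseteq> closure {q \<in> V. P q}"
  then obtain p where p: "p \<in> V" "p \<notin> closure {q \<in> V. P q}" by blast
  define N where "N = V - closure {q \<in> V. P q}"
  have "open N" unfolding N_def using assms(2) closed_closure by (rule open_Diff)
  from open_Int_closure_eq_empty[OF this, of "{q \<in> U. P q}"]
  have eq: "N \<inter> closure {q \<in> U. P q} = {} \<longleftrightarrow> N \<inter> {q \<in> U. P q} = {}" .
  have "p \<in> N" "p \<in> closure {q \<in> U. P q}" using p assms(3,4) unfolding N_def by blast+
  hence "N \<inter> {q \<in> U. P q} \<noteq> {}" unfolding eq[symmetric] by blast
  then obtain q where q: "q \<in> N" "P q" by blast
  have "q \<in> V" "q \<notin> closure {q \<in> V. P q}" using q(1) unfolding N_def by blast+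
  moreover from \<open>q \<in> V\<close> q(2) have "q \<in> {q \<in> V. P q}" by blast
  ultimately show False using closure_subset[of "{q \<in> V. P q}"] by blast
qed

text \<open>One of the two dense sets has to be open: two dense sets can be disjoint.\<close>

lemma dense_open_Int:
  assumes "open U" "U \<subseteq> closure {q \<in> U. P q}" "open {q \<in> U. P q}" "U \<subseteq> closure {q \<in> U. Q q}"
  shows "U \<subseteq> closure {q \<in> U. P q \<and> Q q}"
proof -
  have "{q \<in> U. P q} \<subseteq> U" by blast
  from dense_subset_open[OF assms(1,3) this assms(4)]
  have "{q \<in> U. P q} \<subseteq> closure {q \<in> U. P q \<and> Q q}" by (simp add: conj_assoc)
  hence "closure {q \<in> U. P q} \<subseteq> closure {q \<in> U. P q \<and> Q q}" by (intro closure_minimal closed_closure)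
  with assms(2) show ?thesis by (rule order_trans)
qed

lemma mv_holomorphic_on_open_nonzero:
  assumes "mv_holomorphic_on g U" "open U"
  shows "open {q \<in> U. g q \<noteq> 0}"
  using continuous_open_preimage[OF mv_holomorphic_on_imp_continuous_on[OF assms(1)] assms(2) open_Compl[OF closed_singleton[of 0]]]
  by (simp add: vimage_def Int_def)

lemma mv_quotient_on_subset:
  assumes "mv_quotient_on f U g h" "open V" "V \<subseteq> U"
  shows "mv_quotient_on f V g h"
proof -
  have U: "open U" "mv_holomorphic_on g U" "mv_holomorphic_on h U" "U \<subseteq> closure {q \<in> U. g q \<noteq> 0}"
    "\<forall>q\<in>U. g q \<noteq> 0 \<longrightarrow> f q = h q / g q"
    using assms(1) by (simp_all add: mv_quotient_on_def)
  show ?thesis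
    unfolding mv_quotient_on_def
  proof (intro conjI)
    show "V \<subseteq> closure {q \<in> V. g q \<noteq> 0}"
      by (rule dense_subset_open[OF U(1) assms(2,3) U(4)])
    show "mv_holomorphic_on g V" "mv_holomorphic_on h V"
      by (rule mv_holomorphic_on_subset[OF U(2) assms(3)], rule mv_holomorphic_on_subset[OF U(3) assms(3)])
  qed (use U(5) assms(2,3) in auto)
qed

text \<open>The nonzero set of a holomorphic denominator is open and dense, so two such sets meet in
  a dense set and denominators may be multiplied.\<close>

lemma mv_meromorphic_on_local_pair:
  assumes "mv_meromorphic_on f1 D" "mv_meromorphic_on f2 D" "p \<in> D"
  shows "\<exists>U g1 h1 g2 h2. p \<in> U \<and> U \<subseteq> D \<and> mv_quotient_on f1 U g1 h1 \<and> mv_quotient_on f2 U g2 h2 \<and>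
    U \<subseteq> closure {q \<in> U. g1 q * g2 q \<noteq> 0}"
proof -
  obtain U1 g1 h1 where 1: "mv_quotient_on f1 U1 g1 h1" "p \<in> U1" "U1 \<subseteq> D"
    using assms(1,3) unfolding mv_meromorphic_on_iff by blast
  obtain U2 g2 h2 where 2: "mv_quotient_on f2 U2 g2 h2" "p \<in> U2" "U2 \<subseteq> D"
    using assms(2,3) unfolding mv_meromorphic_on_iff by blast
  define U where "U = U1 \<inter> U2"
  have U: "open U" "U \<subseteq> U1" "U \<subseteq> U2" using 1(1) 2(1) by (auto simp: U_def mv_quotient_on_def)
  have q: "mv_quotient_on f1 U g1 h1" "mv_quotient_on f2 U g2 h2"
    by (rule mv_quotient_on_subset[OF 1(1) U(1,2)], rule mv_quotient_on_subset[OF 2(1) U(1,3)])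
  have "U \<subseteq> closure {q \<in> U. g1 q \<noteq> 0 \<and> g2 q \<noteq> 0}"
  proof (rule dense_open_Int)
    show "open {q \<in> U. g1 q \<noteq> 0}"
      using q(1) U(1) by (intro mv_holomorphic_on_open_nonzero) (simp_all add: mv_quotient_on_def)
  qed (use q in \<open>simp_all add: mv_quotient_on_def\<close>)
  hence "U \<subseteq> closure {q \<in> U. g1 q * g2 q \<noteq> 0}" by simp
  moreover have "p \<in> U" "U \<subseteq> D" using 1 2 by (auto simp: U_def)
  ultimately show ?thesis using q by blast
qed

lemma mv_meromorphic_on_add:
  assumes "mv_meromorphic_on f1 D" "mv_meromorphic_on f2 D"
  shows "mv_meromorphic_on (\<lambda>p. f1 p + f2 p) D"
  unfolding mv_meromorphic_on_iff
proof
  fix p assume p: "p \<in> D"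
  obtain U g1 h1 g2 h2 where *: "p \<in> U" "U \<subseteq> D" "mv_quotient_on f1 U g1 h1" "mv_quotient_on f2 U g2 h2"
    "U \<subseteq> closure {q \<in> U. g1 q * g2 q \<noteq> 0}"
    using mv_meromorphic_on_local_pair[OF assms p] by blast
  have "mv_quotient_on (\<lambda>p. f1 p + f2 p) U (\<lambda>q. g1 q * g2 q) (\<lambda>q. h1 q * g2 q + h2 q * g1 q)"
    unfolding mv_quotient_on_def
  proof (intro conjI ballI impI)
    show "open U" "U \<subseteq> closure {q \<in> U. g1 q * g2 q \<noteq> 0}" using * by (simp_all add: mv_quotient_on_def)
    have H: "mv_holomorphic_on g1 U" "mv_holomorphic_on h1 U" "mv_holomorphic_on g2 U" "mv_holomorphic_on h2 U"
      using *(3,4) by (simp_all add: mv_quotient_on_def)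
    show "mv_holomorphic_on (\<lambda>q. g1 q * g2 q) U" "mv_holomorphic_on (\<lambda>q. h1 q * g2 q + h2 q * g1 q) U"
      by (rule mv_holomorphic_on_mult[OF H(1,3)],
          rule mv_holomorphic_on_add[OF mv_holomorphic_on_mult[OF H(2,3)] mv_holomorphic_on_mult[OF H(4,1)]])
    fix q assume q: "q \<in> U" "g1 q * g2 q \<noteq> 0"
    hence "f1 q = h1 q / g1 q" "f2 q = h2 q / g2 q" using *(3,4) by (simp_all add: mv_quotient_on_def)
    thus "f1 q + f2 q = (h1 q * g2 q + h2 q * g1 q) / (g1 q * g2 q)" using q(2) by (simp add: add_frac_eq)
  qed
  thus "\<exists>U g h. mv_quotient_on (\<lambda>p. f1 p + f2 p) U g h \<and> p \<in> U \<and> U \<subseteq> D" using *(1,2) by blast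
qed

lemma mv_meromorphic_on_mult:
  assumes "mv_meromorphic_on f1 D" "mv_meromorphic_on f2 D"
  shows "mv_meromorphic_on (\<lambda>p. f1 p * f2 p) D"
  unfolding mv_meromorphic_on_iff
proof
  fix p assume p: "p \<in> D"
  obtain U g1 h1 g2 h2 where *: "p \<in> U" "U \<subseteq> D" "mv_quotient_on f1 U g1 h1" "mv_quotient_on f2 U g2 h2"
    "U \<subseteq> closure {q \<in> U. g1 q * g2 q \<noteq> 0}"
    using mv_meromorphic_on_local_pair[OF assms p] by blast
  have "mv_quotient_on (\<lambda>p. f1 p * f2 p) U (\<lambda>q. g1 q * g2 q) (\<lambda>q. h1 q * h2 q)"
    unfolding mv_quotient_on_def
  proof (intro conjI ballI impI)
    show "open U" "U \<subseteq> closure {q \<in> U. g1 q * g2 q \<noteq> 0}" using * by (simp_all add: mv_quotient_on_def)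
    have H: "mv_holomorphic_on g1 U" "mv_holomorphic_on h1 U" "mv_holomorphic_on g2 U" "mv_holomorphic_on h2 U"
      using *(3,4) by (simp_all add: mv_quotient_on_def)
    show "mv_holomorphic_on (\<lambda>q. g1 q * g2 q) U" "mv_holomorphic_on (\<lambda>q. h1 q * h2 q) U"
      using H by (blast intro: mv_holomorphic_on_mult)+
    fix q assume q: "q \<in> U" "g1 q * g2 q \<noteq> 0"
    hence "f1 q = h1 q / g1 q" "f2 q = h2 q / g2 q" using *(3,4) by (simp_all add: mv_quotient_on_def)
    thus "f1 q * f2 q = (h1 q * h2 q) / (g1 q * g2 q)" by simp
  qed
  thus "\<exists>U g h. mv_quotient_on (\<lambda>p. f1 p * f2 p) U g h \<and> p \<in> U \<and> U \<subseteq> D" using *(1,2) by blast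
qed

lemma mv_holomorphic_imp_meromorphic_on:
  assumes "mv_holomorphic_on f D" "open D"
  shows "mv_meromorphic_on f D"
proof -
  have "mv_quotient_on f D (\<lambda>_. 1) f"
    using assms closure_subset[of D] by (simp add: mv_quotient_on_def mv_holomorphic_on_const)
  thus ?thesis unfolding mv_meromorphic_on_iff by blast
qed

text \<open>The inverse map carries the dense set of nonzero denominators back, so density survives
  the substitution.\<close>

lemma mv_meromorphic_on_compose_linear:
  assumes mero: "mv_meromorphic_on f D" and lin: "bounded_linear \<phi>" "\<And>c v. \<phi> (c *s v) = c *s \<phi> v"
    and inv: "bounded_linear \<phi>'" "\<And>p. \<phi> (\<phi>' p) = p" "\<And>p. \<phi>' (\<phi> p) = p"
    and D: "\<And>p. p \<in> D \<Longrightarrow> \<phi> p \<in> D" "\<And>p. p \<in> D \<Longrightarrow> \<phi>' p \<in> D"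
  shows "mv_meromorphic_on (\<lambda>p. f (\<phi> p)) D"
  unfolding mv_meromorphic_on_iff
proof
  fix p assume p: "p \<in> D"
  obtain U g h where U: "mv_quotient_on f U g h" "\<phi> p \<in> U" "U \<subseteq> D"
    using bspec[OF mero[unfolded mv_meromorphic_on_iff] D(1)[OF p]] by blast
  define V where "V = \<phi> -` U"
  have cont: "continuous_on UNIV \<phi>" using lin(1) by (simp add: linear_continuous_on)
  have V: "open V" "p \<in> V" unfolding V_def using open_vimage[OF _ cont, of U] U by (auto simp: mv_quotient_on_def)
  have V_eq: "{q \<in> V. P (\<phi> q)} = \<phi>' ` {q \<in> U. P q}" for P
  proof (intro equalityI subsetI)
    fix q assume "q \<in> {q \<in> V. P (\<phi> q)}"
    hence "\<phi>' (\<phi> q) \<in> \<phi>' ` {q \<in> U. P q}" unfolding V_def by blast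
    thus "q \<in> \<phi>' ` {q \<in> U. P q}" by (simp add: inv)
  qed (auto simp: V_def inv)
  have VU: "V = \<phi>' ` U" using V_eq[of "\<lambda>_. True"] by simp
  hence "V \<subseteq> D" using U(3) D(2) by auto
  have "V \<subseteq> \<phi>' ` closure {q \<in> U. g q \<noteq> 0}" unfolding VU using U(1) by (intro image_mono) (simp add: mv_quotient_on_def)
  also have "\<dots> \<subseteq> closure (\<phi>' ` {q \<in> U. g q \<noteq> 0})"
    using inv(1) by (intro closure_bounded_linear_image_subset)
  also have "\<phi>' ` {q \<in> U. g q \<noteq> 0} = {q \<in> V. g (\<phi> q) \<noteq> 0}" by (rule V_eq[symmetric])
  finally have "V \<subseteq> closure {q \<in> V. g (\<phi> q) \<noteq> 0}" .
  moreover have hol: "mv_holomorphic_on g U" "mv_holomorphic_on h U" using U(1) by (simp_all add: mv_quotient_on_def)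
  have "\<phi> q \<in> U" if "q \<in> V" for q using that by (simp add: V_def)
  from mv_holomorphic_on_compose_linear[OF hol(1) lin this] mv_holomorphic_on_compose_linear[OF hol(2) lin this]
  have "mv_holomorphic_on (\<lambda>q. g (\<phi> q)) V \<and> mv_holomorphic_on (\<lambda>q. h (\<phi> q)) V" by blast
  ultimately have "mv_quotient_on (\<lambda>p. f (\<phi> p)) V (\<lambda>q. g (\<phi> q)) (\<lambda>q. h (\<phi> q))"
    using V(1) U(1) by (simp add: mv_quotient_on_def V_def)
  thus "\<exists>U g h. mv_quotient_on (\<lambda>p. f (\<phi> p)) U g h \<and> p \<in> U \<and> U \<subseteq> D"
    using V(2) \<open>V \<subseteq> D\<close> by blast
qed

text \<open>A connectedness argument: the points of \<open>D\<close> around which the interior of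
  the zero set is dense form an open and closed subset, and the totally real piece through p0 makes
  it nonempty.\<close>

lemma mv_meromorphic_on_vanish:
  fixes D :: "(complex ^ 'n) set"
  assumes mero: "mv_meromorphic_on F D" and D: "open D" "connected D"
    and p0: "p0 \<in> D" "p0 \<in> tot_real K" and B: "open B" "p0 \<in> B"
    and zero: "\<And>p. p \<in> B \<Longrightarrow> p \<in> tot_real K \<Longrightarrow> F p = 0"
  obtains U where "open U" "U \<subseteq> D" "D \<subseteq> closure U" "\<And>p. p \<in> U \<Longrightarrow> F p = 0"
proof -
  define U where "U = interior {p \<in> D. F p = 0}"
  have U: "open U" "U \<subseteq> D" "\<And>p. p \<in> U \<Longrightarrow> F p = 0"
    using interior_subset[of "{p \<in> D. F p = 0}"] by (auto simp: U_def)
  \<comment> \<open>On a small ball, zeros on a totally real piece and contact with \<open>U\<close>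
    have the same effect: they force numerator times denominator to vanish, so the ball lies in the
    closure of \<open>U\<close>.\<close>
  have loc: "\<exists>W. open W \<and> p \<in> W \<and> W \<subseteq> D \<inter> C \<and>
      ((\<exists>q0\<in>W. q0 \<in> tot_real K \<and> (\<forall>q\<in>W. q \<in> tot_real K \<longrightarrow> F q = 0)) \<or> W \<inter> U \<noteq> {} \<longrightarrow> W \<subseteq> closure U)"
    if p: "p \<in> D" and C: "open C" "p \<in> C" for p C
  proof -
    obtain W0 g h where W0: "mv_quotient_on F W0 g h" "p \<in> W0" "W0 \<subseteq> D"
      using mero p unfolding mv_meromorphic_on_iff by blast
    hence "open (W0 \<inter> C)" "p \<in> W0 \<inter> C" using C by (auto simp: mv_quotient_on_def)
    then obtain r where r: "r > 0" "ball p r \<subseteq> W0 \<inter> C" using openE by blast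
    define W where "W = ball p r"
    have W: "open W" "convex W" "p \<in> W" "W \<subseteq> W0" "W \<subseteq> C" "W \<subseteq> D" using r W0(3) by (auto simp: W_def)
    have hol: "mv_holomorphic_on g W" "mv_holomorphic_on h W" and dense: "W \<subseteq> closure {q \<in> W. g q \<noteq> 0}"
      and rep: "\<And>q. q \<in> W \<Longrightarrow> g q \<noteq> 0 \<Longrightarrow> F q = h q / g q"
      using mv_quotient_on_subset[OF W0(1) W(1,4)] by (auto simp: mv_quotient_on_def)
    \<comment> \<open>The product replaces \<open>h\<close> because at a zero of \<open>g\<close>
      the value of F says nothing about \<open>h\<close>, whereas g h vanishes there anyway.\<close>
    have gh: "mv_holomorphic_on (\<lambda>q. g q * h q) W" using hol by (rule mv_holomorphic_on_mult)
    have gh0: "g q * h q = 0" if "q \<in> W" "F q = 0" for q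
      using rep[of q] that by (cases "g q = 0") auto
    have "W \<subseteq> closure U"
      if cases: "(\<exists>q0\<in>W. q0 \<in> tot_real K \<and> (\<forall>q\<in>W. q \<in> tot_real K \<longrightarrow> F q = 0)) \<or> W \<inter> U \<noteq> {}"
    proof -
      have all: "g q * h q = 0" if q: "q \<in> W" for q
        using cases
      proof (rule disjE)
        assume "\<exists>q0\<in>W. q0 \<in> tot_real K \<and> (\<forall>q\<in>W. q \<in> tot_real K \<longrightarrow> F q = 0)"
        then obtain q0 where q0: "q0 \<in> W" "q0 \<in> tot_real K" "\<forall>q\<in>W. q \<in> tot_real K \<longrightarrow> F q = 0" by blast
        show ?thesis
        proof (rule mv_holomorphic_on_tot_real_identity[OF gh W(1,2) q0(1,2) _ q])
          fix p assume p: "p \<in> W" "p \<in> tot_real K"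
          with q0(3) have "F p = 0" by blast
          with p(1) show "g p * h p = 0" by (rule gh0)
        qed
      next
        assume "W \<inter> U \<noteq> {}"
        then obtain q0 where q0: "q0 \<in> W \<inter> U" by blast
        show ?thesis
        proof (rule mv_holomorphic_on_identity[OF gh W(1,2) _ q0 _ _ q])
          show "open (W \<inter> U)" using W(1) U(1) by (rule open_Int)
          show "W \<inter> U \<subseteq> W" by blast
          fix p assume p: "p \<in> W \<inter> U"
          hence "F p = 0" using U(3) by blast
          with p show "g p * h p = 0" using gh0 by blast
        qed
      qed
      have "{q \<in> W. g q \<noteq> 0} \<subseteq> {p \<in> D. F p = 0}"
      proof
        fix q assume "q \<in> {q \<in> W. g q \<noteq> 0}"
        hence q: "q \<in> W" "g q \<noteq> 0" by blast+
        have "F q = 0" using rep[OF q] all[OF q(1)] q(2) by simp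
        thus "q \<in> {p \<in> D. F p = 0}" using q(1) W(6) by blast
      qed
      hence "{q \<in> W. g q \<noteq> 0} \<subseteq> U"
        unfolding U_def using mv_holomorphic_on_open_nonzero[OF hol(1) W(1)] by (rule interior_maximal)
      from closure_mono[OF this] dense show ?thesis by (rule order_trans[rotated])
    qed
    moreover have "W \<subseteq> D \<inter> C" using W(5,6) by blast
    ultimately show ?thesis using W(1,3) by (intro exI[of _ W] conjI impI)
  qed
  \<comment> \<open>\<open>U\<close> can miss zeros of the local denominators, hence the interior of
    its closure.\<close>
  define V where "V = D \<inter> interior (closure U)"
  have "open V" using D by (simp add: V_def open_Int)
  have "open (D - V)"
    unfolding open_subopen[of "D - V"]
  proof
    fix p assume p: "p \<in> D - V"
    obtain W where W: "open W" "p \<in> W" "W \<subseteq> D" "W \<inter> U \<noteq> {} \<Longrightarrow> W \<subseteq> closure U"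
      using loc[of p UNIV] p by auto
    have "W \<inter> V = {}"
    proof (rule ccontr)
      assume "W \<inter> V \<noteq> {}"
      then obtain q where "q \<in> W" "q \<in> closure U" using interior_subset by (auto simp: V_def)
      hence "W \<inter> closure U \<noteq> {}" by blast
      hence "W \<inter> U \<noteq> {}" using W(1) by (simp add: open_Int_closure_eq_empty)
      hence "W \<subseteq> interior (closure U)" using W by (intro interior_maximal) auto
      thus False using W p by (auto simp: V_def)
    qed
    thus "\<exists>T. open T \<and> p \<in> T \<and> T \<subseteq> D - V" using W by blast
  qed
  moreover have "p0 \<in> V"
  proof -
    obtain W where W: "open W" "p0 \<in> W" "W \<subseteq> B"
       "(\<exists>q0\<in>W. q0 \<in> tot_real K \<and> (\<forall>q\<in>W. q \<in> tot_real K \<longrightarrow> F q = 0)) \<Longrightarrow> W \<subseteq> closure U"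
      using loc[OF p0(1) B] by auto
    have "W \<subseteq> closure U" using W(2,3) p0(2) zero by (intro W(4)) blast
    hence "W \<subseteq> interior (closure U)" using W(1) by (rule interior_maximal)
    thus ?thesis using W(2) p0(1) by (auto simp: V_def)
  qed
  ultimately have "D - V = {}"
    using connectedD[OF D(2) \<open>open V\<close>, of "D - V"] p0(1) by (auto simp: V_def)
  hence "D \<subseteq> closure U" using interior_subset[of "closure U"] by (auto simp: V_def)
  with U show thesis using that by blast
qed

section \<open>The weight function and the operator\<close>

lemma two_cosh_eq_qexp: "2 * cosh (of_real pi * u / w) = (1 + qexp w u) * exp (- (of_real pi * u / w))"
proof -
  have "qexp w u = exp (of_real pi * u / w) * exp (of_real pi * u / w)"
    unfolding exp_add[symmetric] qexp_def by (simp add: add_divide_distrib[symmetric] mult.commute mult.left_commute)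
  thus ?thesis by (simp add: two_cosh_eq_exp distrib_right exp_minus)
qed

lemma qexp_dual_par_0:
  "qexp w (\<i> * dual_par \<gamma> 0) = exp (of_real pi * (\<i> * \<gamma> 0 + \<i> * \<gamma> 1 + \<i> * \<gamma> 2 + \<i> * \<gamma> 3) / w)"
proof -
  have "2 * dual_par \<gamma> 0 = \<gamma> 0 + \<gamma> 1 + \<gamma> 2 + \<gamma> 3" by (simp add: dual_par_def)
  moreover have "qexp w (\<i> * dual_par \<gamma> 0) = exp (of_real pi * (\<i> * (2 * dual_par \<gamma> 0)) / w)"
    by (simp add: qexp_def mult_ac)
  ultimately show ?thesis by (simp only: distrib_left)
qed

lemma hyp_gamma_up_qexp:
  assumes "Re w1 > 0" "Re w2 > 0" "1 + qexp w2 (z + \<i> * w1 / 2) \<noteq> 0"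
  shows "hyp_gamma w1 w2 (z + \<i> * w1) =
    (1 + qexp w2 (z + \<i> * w1 / 2)) * exp (- (of_real pi * (z + \<i> * w1 / 2) / w2)) * hyp_gamma w1 w2 z"
proof -
  have "2 * cosh (of_real pi * (z + \<i> * w1 / 2) / w2) \<noteq> 0"
    unfolding two_cosh_eq_qexp using assms(3) by simp
  hence "cosh (of_real pi * (z + \<i> * w1 / 2) / w2) \<noteq> 0" by simp
  from hyp_gamma_shift[OF assms(1,2) this] show ?thesis
    unfolding two_cosh_eq_qexp by (simp add: add.assoc)
qed

lemma hyp_gamma_down_qexp:
  assumes "Re w1 > 0" "Re w2 > 0" "1 + qexp w2 (\<i> * w1 / 2 - z) \<noteq> 0"
  shows "hyp_gamma w1 w2 z =
    (1 + qexp w2 (\<i> * w1 / 2 - z)) * exp (- (of_real pi * (\<i> * w1 / 2 - z) / w2)) * hyp_gamma w1 w2 (z - \<i> * w1)"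
proof -
  have neg: "of_real pi * (z - \<i> * w1 / 2) / w2 = - (of_real pi * (\<i> * w1 / 2 - z) / w2)"
    by (simp add: algebra_simps minus_divide_left)
  have "2 * cosh (of_real pi * (z - \<i> * w1 / 2) / w2) \<noteq> 0"
    unfolding neg cosh_minus two_cosh_eq_qexp using assms(3) by simp
  hence "cosh (of_real pi * (z - \<i> * w1 / 2) / w2) \<noteq> 0" by simp
  from hyp_gamma_shift[OF assms(1,2) this] show ?thesis
    unfolding neg cosh_minus two_cosh_eq_qexp by (simp add: diff_diff_eq)
qed

text \<open>Each of the four gamma functions in the weight takes one step of the difference
  equation. The factors for gamma_2 and gamma_3 cancel against the numerator of
  \<open>AW_coeff\<close>, those for gamma_0 and gamma_1 are joined by their reflections, and the
  leftover exponentials combine to the one with the dual parameter.\<close>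

lemma AW_coeff_divide_Delta_up:
  assumes w: "Re w1 > 0" "Re w2 > 0"
    and nz: "1 + qexp w2 (x + \<i> * w1 / 2 - \<i> * \<gamma> 0) \<noteq> 0" "1 + qexp w2 (x + \<i> * w1 / 2 - \<i> * \<gamma> 1) \<noteq> 0"
      "1 + qexp w2 (x + \<i> * w1 / 2 + \<i> * \<gamma> 2) \<noteq> 0" "1 + qexp w2 (x + \<i> * w1 / 2 + \<i> * \<gamma> 3) \<noteq> 0"
  shows "AW_coeff w1 w2 \<gamma> x / Delta_fun w1 w2 \<gamma> (x + \<i> * w1) = AW_up w1 w2 \<gamma> x / Delta_fun w1 w2 \<gamma> x"
proof -
  define G where "G = hyp_gamma w1 w2"
  define k where "k = (\<lambda>u. exp (- (of_real pi * u / w2)))"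
  define b where "b = (\<lambda>u. 1 + qexp w2 (x + \<i> * w1 / 2 + u))"
  define den where "den = (1 - qexp w2 (2 * x)) * (1 - qexp w2 (2 * x + \<i> * w1))"
  define K where "K = (\<lambda>u. k (x + \<i> * w1 / 2 + u))"
  have G: "G (x + \<i> * w1 + u) = b u * K u * G (x + u)" if "b u \<noteq> 0" for u
    using hyp_gamma_up_qexp[OF w, of "x + u"] that by (simp add: G_def b_def K_def k_def ac_simps)
  have K: "K (- (\<i> * \<gamma> 0)) * K (- (\<i> * \<gamma> 1)) = qexp w2 (\<i> * dual_par \<gamma> 0) * (K (\<i> * \<gamma> 2) * K (\<i> * \<gamma> 3))"
  proof -
    define c where "c = of_real pi / w2"
    have c: "of_real pi * u / w2 = c * u" for u by (simp add: c_def)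
    show ?thesis unfolding qexp_dual_par_0 K_def k_def c by (simp add: algebra_simps flip: exp_add)
  qed
  have A: "AW_coeff w1 w2 \<gamma> x = b (\<i> * \<gamma> 0) * b (\<i> * \<gamma> 1) * b (\<i> * \<gamma> 2) * b (\<i> * \<gamma> 3) / den"
    using w by (subst AW_coeff_eq_qexp) (auto simp: b_def den_def)
  have U: "AW_up w1 w2 \<gamma> x = qexp w2 (\<i> * dual_par \<gamma> 0) * (b (\<i> * \<gamma> 0) * b (- (\<i> * \<gamma> 0)) * b (\<i> * \<gamma> 1) * b (- (\<i> * \<gamma> 1))) / den"
    by (simp add: AW_up_def b_def den_def)
  have bnz: "b (- (\<i> * \<gamma> 0)) \<noteq> 0" "b (- (\<i> * \<gamma> 1)) \<noteq> 0" "b (\<i> * \<gamma> 2) \<noteq> 0" "b (\<i> * \<gamma> 3) \<noteq> 0"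
    using nz by (simp_all add: b_def)
  have D1: "1 / Delta_fun w1 w2 \<gamma> (x + \<i> * w1) =
      (b (- (\<i> * \<gamma> 0)) * b (- (\<i> * \<gamma> 1)) * (K (- (\<i> * \<gamma> 0)) * K (- (\<i> * \<gamma> 1))) * (G (x - \<i> * \<gamma> 0) * G (x - \<i> * \<gamma> 1))) /
      (b (\<i> * \<gamma> 2) * b (\<i> * \<gamma> 3) * (K (\<i> * \<gamma> 2) * K (\<i> * \<gamma> 3)) * (G (x + \<i> * \<gamma> 2) * G (x + \<i> * \<gamma> 3)))"
    using G[OF bnz(1)] G[OF bnz(2)] G[OF bnz(3)] G[OF bnz(4)]
    by (simp add: Delta_fun_def Let_def G_def[symmetric] mult_ac)
  have D0: "1 / Delta_fun w1 w2 \<gamma> x = (G (x - \<i> * \<gamma> 0) * G (x - \<i> * \<gamma> 1)) / (G (x + \<i> * \<gamma> 2) * G (x + \<i> * \<gamma> 3))"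
    by (simp add: Delta_fun_def Let_def G_def[symmetric])
  have Knz: "K u \<noteq> 0" for u by (simp add: K_def k_def)
  \<comment> \<open>With 1/0 = 0 this holds even for d = 0 or g' = 0, so zeros and poles of the
    weight itself need no separate treatment.\<close>
  have alg: "a0 * a1 * a2 * a3 / d * (c0 * c1 * (h * (k2 * k3)) * g / (a2 * a3 * (k2 * k3) * g')) =
      h * (a0 * c0 * a1 * c1) / d * (g / g')"
    if "a2 \<noteq> 0" "a3 \<noteq> 0" "k2 \<noteq> 0" "k3 \<noteq> 0" for a0 a1 a2 a3 d c0 c1 h k2 k3 g g' :: complex
    using that by (cases "d = 0"; cases "g' = 0") (simp_all add: field_simps)
  have "AW_coeff w1 w2 \<gamma> x * (1 / Delta_fun w1 w2 \<gamma> (x + \<i> * w1)) = AW_up w1 w2 \<gamma> x * (1 / Delta_fun w1 w2 \<gamma> x)"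
    unfolding A U D1 D0 K by (rule alg) (rule bnz Knz)+
  thus ?thesis by simp
qed

text \<open>As in the upward case, with the two pairs of parameters exchanged: now the factors for
  gamma_0 and gamma_1 cancel and those for gamma_2 and gamma_3 are joined by their
  reflections.\<close>

lemma AW_coeff_divide_Delta_down:
  assumes w: "Re w1 > 0" "Re w2 > 0"
    and nz: "1 + qexp w2 (\<i> * w1 / 2 - x + \<i> * \<gamma> 0) \<noteq> 0" "1 + qexp w2 (\<i> * w1 / 2 - x + \<i> * \<gamma> 1) \<noteq> 0"
      "1 + qexp w2 (\<i> * w1 / 2 - x - \<i> * \<gamma> 2) \<noteq> 0" "1 + qexp w2 (\<i> * w1 / 2 - x - \<i> * \<gamma> 3) \<noteq> 0"
  shows "AW_coeff w1 w2 \<gamma> (- x) / Delta_fun w1 w2 \<gamma> (x - \<i> * w1) = AW_down w1 w2 \<gamma> x / Delta_fun w1 w2 \<gamma> x"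
proof -
  define G where "G = hyp_gamma w1 w2"
  define k where "k = (\<lambda>u. exp (- (of_real pi * u / w2)))"
  define b where "b = (\<lambda>u. 1 + qexp w2 (\<i> * w1 / 2 - x + u))"
  define den where "den = (1 - qexp w2 (- 2 * x)) * (1 - qexp w2 (- 2 * x + \<i> * w1))"
  define K where "K = (\<lambda>u. k (\<i> * w1 / 2 - x + u))"
  have G: "G (x - u) = b u * K u * G (x - \<i> * w1 - u)" if "b u \<noteq> 0" for u
    using hyp_gamma_down_qexp[OF w, of "x - u"] that by (simp add: G_def b_def K_def k_def algebra_simps)
  have K: "K (- (\<i> * \<gamma> 2)) * K (- (\<i> * \<gamma> 3)) = qexp w2 (\<i> * dual_par \<gamma> 0) * (K (\<i> * \<gamma> 0) * K (\<i> * \<gamma> 1))"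
  proof -
    define c where "c = of_real pi / w2"
    have c: "of_real pi * u / w2 = c * u" for u by (simp add: c_def)
    show ?thesis unfolding qexp_dual_par_0 K_def k_def c by (simp add: algebra_simps flip: exp_add)
  qed
  have A: "AW_coeff w1 w2 \<gamma> (- x) = b (\<i> * \<gamma> 0) * b (\<i> * \<gamma> 1) * b (\<i> * \<gamma> 2) * b (\<i> * \<gamma> 3) / den"
    using w by (subst AW_coeff_eq_qexp) (auto simp: b_def den_def)
  have U: "AW_down w1 w2 \<gamma> x = qexp w2 (\<i> * dual_par \<gamma> 0) * (b (\<i> * \<gamma> 3) * b (- (\<i> * \<gamma> 3)) * b (- (\<i> * \<gamma> 2)) * b (\<i> * \<gamma> 2)) / den"
    by (simp add: AW_down_def b_def den_def)
  have bnz: "b (\<i> * \<gamma> 0) \<noteq> 0" "b (\<i> * \<gamma> 1) \<noteq> 0" "b (- (\<i> * \<gamma> 2)) \<noteq> 0" "b (- (\<i> * \<gamma> 3)) \<noteq> 0"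
    using nz by (simp_all add: b_def)
  have D0: "1 / Delta_fun w1 w2 \<gamma> x =
      (b (\<i> * \<gamma> 0) * b (\<i> * \<gamma> 1) * (K (\<i> * \<gamma> 0) * K (\<i> * \<gamma> 1)) * (G (x - \<i> * w1 - \<i> * \<gamma> 0) * G (x - \<i> * w1 - \<i> * \<gamma> 1))) /
      (b (- (\<i> * \<gamma> 2)) * b (- (\<i> * \<gamma> 3)) * (K (- (\<i> * \<gamma> 2)) * K (- (\<i> * \<gamma> 3))) * (G (x - \<i> * w1 + \<i> * \<gamma> 2) * G (x - \<i> * w1 + \<i> * \<gamma> 3)))"
    using G[OF bnz(1)] G[OF bnz(2)] G[OF bnz(3)] G[OF bnz(4)]
    by (simp add: Delta_fun_def Let_def G_def[symmetric] mult_ac)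
  have D1: "1 / Delta_fun w1 w2 \<gamma> (x - \<i> * w1) =
      (G (x - \<i> * w1 - \<i> * \<gamma> 0) * G (x - \<i> * w1 - \<i> * \<gamma> 1)) / (G (x - \<i> * w1 + \<i> * \<gamma> 2) * G (x - \<i> * w1 + \<i> * \<gamma> 3))"
    by (simp add: Delta_fun_def Let_def G_def[symmetric])
  have Knz: "K u \<noteq> 0" for u by (simp add: K_def k_def)
  have alg: "a0 * a1 * a2 * a3 / d * (g / g') =
      h * (a3 * c3 * c2 * a2) / d * (a0 * a1 * (k0 * k1) * g / (c2 * c3 * (h * (k0 * k1)) * g'))"
    if "c2 \<noteq> 0" "c3 \<noteq> 0" "k0 \<noteq> 0" "k1 \<noteq> 0" "h \<noteq> 0" for a0 a1 a2 a3 d c2 c3 h k0 k1 g g' :: complex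
    using that by (cases "d = 0"; cases "g' = 0") (simp_all add: field_simps)
  have "AW_coeff w1 w2 \<gamma> (- x) * (1 / Delta_fun w1 w2 \<gamma> (x - \<i> * w1)) = AW_down w1 w2 \<gamma> x * (1 / Delta_fun w1 w2 \<gamma> x)"
    unfolding A U D1 D0 K by (rule alg) (rule bnz Knz qexp_nonzero)+
  thus ?thesis by simp
qed

text \<open>S is psi / Delta times a factor independent of x, so the eigenvalue equation is the
  three-term relation for psi divided by Delta(x).\<close>

lemma AW_op_S_fun_eq:
  fixes \<psi> :: fun8
  assumes up: "AW_coeff w1 w2 (gamma_par \<rho> \<sigma> \<tau> \<upsilon>) x / Delta_fun w1 w2 (gamma_par \<rho> \<sigma> \<tau> \<upsilon>) (x + \<i> * w1) =
      AW_up w1 w2 (gamma_par \<rho> \<sigma> \<tau> \<upsilon>) x / Delta_fun w1 w2 (gamma_par \<rho> \<sigma> \<tau> \<upsilon>) x"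
    and down: "AW_coeff w1 w2 (gamma_par \<rho> \<sigma> \<tau> \<upsilon>) (- x) / Delta_fun w1 w2 (gamma_par \<rho> \<sigma> \<tau> \<upsilon>) (x - \<i> * w1) =
      AW_down w1 w2 (gamma_par \<rho> \<sigma> \<tau> \<upsilon>) x / Delta_fun w1 w2 (gamma_par \<rho> \<sigma> \<tau> \<upsilon>) x"
    and rel: "AW_up w1 w2 (gamma_par \<rho> \<sigma> \<tau> \<upsilon>) x * \<psi> w1 w2 \<rho> \<sigma> \<tau> \<upsilon> (x + \<i> * w1) l +
      AW_down w1 w2 (gamma_par \<rho> \<sigma> \<tau> \<upsilon>) x * \<psi> w1 w2 \<rho> \<sigma> \<tau> \<upsilon> (x - \<i> * w1) l =
      (AW_coeff w1 w2 (gamma_par \<rho> \<sigma> \<tau> \<upsilon>) x + AW_coeff w1 w2 (gamma_par \<rho> \<sigma> \<tau> \<upsilon>) (- x) +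
       AW_eigenvalue w1 w2 (gamma_par \<rho> \<sigma> \<tau> \<upsilon>) l) * \<psi> w1 w2 \<rho> \<sigma> \<tau> \<upsilon> x l"
  shows "AW_op w1 w2 (gamma_par \<rho> \<sigma> \<tau> \<upsilon>) (\<lambda>y. S_fun \<psi> w1 w2 \<rho> \<sigma> \<tau> \<upsilon> y l) x =
    AW_eigenvalue w1 w2 (gamma_par \<rho> \<sigma> \<tau> \<upsilon>) l * S_fun \<psi> w1 w2 \<rho> \<sigma> \<tau> \<upsilon> x l"
proof -
  define \<gamma> where "\<gamma> = gamma_par \<rho> \<sigma> \<tau> \<upsilon>"
  define D where "D = (\<lambda>y. inverse (Delta_fun w1 w2 \<gamma> y))"
  define P where "P = (\<lambda>y. \<psi> w1 w2 \<rho> \<sigma> \<tau> \<upsilon> y l)"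
  define c where "c = N_fun w1 w2 \<gamma> / (csqrt (w1 * w2) * Delta_fun w1 w2 (dual_par \<gamma>) l)"
  have S: "S_fun \<psi> w1 w2 \<rho> \<sigma> \<tau> \<upsilon> y l = c * P y * D y" for y
    by (simp add: S_fun_def Let_def \<gamma>_def[symmetric] c_def P_def D_def divide_inverse mult_ac)
  have "AW_op w1 w2 \<gamma> (\<lambda>y. S_fun \<psi> w1 w2 \<rho> \<sigma> \<tau> \<upsilon> y l) x =
      c * ((AW_coeff w1 w2 \<gamma> x * D (x + \<i> * w1)) * P (x + \<i> * w1) + (AW_coeff w1 w2 \<gamma> (- x) * D (x - \<i> * w1)) * P (x - \<i> * w1)
        - (AW_coeff w1 w2 \<gamma> x + AW_coeff w1 w2 \<gamma> (- x)) * P x * D x)"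
    unfolding AW_op_def S by (simp add: algebra_simps)
  also have "\<dots> = c * D x * ((AW_up w1 w2 \<gamma> x * P (x + \<i> * w1) + AW_down w1 w2 \<gamma> x * P (x - \<i> * w1))
        - (AW_coeff w1 w2 \<gamma> x + AW_coeff w1 w2 \<gamma> (- x)) * P x)"
  proof -
    have "AW_coeff w1 w2 \<gamma> x * D (x + \<i> * w1) = AW_up w1 w2 \<gamma> x * D x"
      "AW_coeff w1 w2 \<gamma> (- x) * D (x - \<i> * w1) = AW_down w1 w2 \<gamma> x * D x"
      using up down by (simp_all only: \<gamma>_def D_def divide_inverse)
    thus ?thesis by (simp only:) (simp add: algebra_simps)
  qed
  also have "\<dots> = c * D x * (AW_eigenvalue w1 w2 \<gamma> l * P x)"
  proof -
    have "AW_up w1 w2 \<gamma> x * P (x + \<i> * w1) + AW_down w1 w2 \<gamma> x * P (x - \<i> * w1) =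
        (AW_coeff w1 w2 \<gamma> x + AW_coeff w1 w2 \<gamma> (- x) + AW_eigenvalue w1 w2 \<gamma> l) * P x"
      using rel by (simp only: \<gamma>_def P_def)
    thus ?thesis by (simp only:) (simp add: algebra_simps)
  qed
  finally show ?thesis unfolding \<gamma>_def[symmetric] S by (simp add: mult_ac)
qed

section \<open>Analytic continuation in the parameters\<close>

text \<open>Both \<open>fps_nth\<close> and \<open>vec_nth\<close> are written \<open>$\<close>.\<close>

no_notation fps_nth (infixl \<open>$\<close> 75)

lemma open_param_domain: "open param_domain"
  unfolding param_domain_def Collect_conj_eq
  by (intro open_Int open_Collect_less continuous_intros)

lemma convex_param_domain: "convex param_domain"
proof -
  have "linear (\<lambda>p::complex ^ 8. Re (p $ i))" for i by (rule linearI) simp_all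
  from convex_linear_vimage[OF this, of "{0<..}"]
  have "convex ((\<lambda>p::complex ^ 8. Re (p $ i)) -` {0<..})" for i by simp
  from convex_Int[OF this[of 1] this[of 2]] show ?thesis
    by (simp add: param_domain_def vimage_def Int_def)
qed

text \<open>As w1 is itself a coordinate, x -> x + c w1 is a linear automorphism of the parameter
  space, inverted by -c; composition with it therefore preserves meromorphy.\<close>

definition shift_vec8 :: "complex \<Rightarrow> complex ^ 8 \<Rightarrow> complex ^ 8" where
  "shift_vec8 c p = (\<chi> i. if i = 7 then p $ 7 + c * p $ 1 else p $ i)"

definition swap_vec8 :: "complex ^ 8 \<Rightarrow> complex ^ 8" where
  "swap_vec8 p = (\<chi> i. if i = 1 then p $ 2 else if i = 2 then p $ 1 else p $ i)"

lemma vec8_nth [simp]: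
  "shift_vec8 c p $ 1 = p $ 1" "shift_vec8 c p $ 2 = p $ 2" "shift_vec8 c p $ 3 = p $ 3" "shift_vec8 c p $ 4 = p $ 4"
  "shift_vec8 c p $ 5 = p $ 5" "shift_vec8 c p $ 6 = p $ 6" "shift_vec8 c p $ 7 = p $ 7 + c * p $ 1" "shift_vec8 c p $ 8 = p $ 8"
  "swap_vec8 p $ 1 = p $ 2" "swap_vec8 p $ 2 = p $ 1" "swap_vec8 p $ 3 = p $ 3" "swap_vec8 p $ 4 = p $ 4"
  "swap_vec8 p $ 5 = p $ 5" "swap_vec8 p $ 6 = p $ 6" "swap_vec8 p $ 7 = p $ 7" "swap_vec8 p $ 8 = p $ 8"
  by (simp_all add: shift_vec8_def swap_vec8_def)

lemma bounded_linear_shift_vec8: "bounded_linear (shift_vec8 c)"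
proof -
  have "linear (shift_vec8 c)"
    by (rule linearI) (simp_all add: shift_vec8_def vec_eq_iff distrib_left scaleR_add_right)
  thus ?thesis by (rule linear_conv_bounded_linear[THEN iffD1])
qed

lemma bounded_linear_swap_vec8: "bounded_linear swap_vec8"
proof -
  have "linear swap_vec8"
    by (rule linearI) (simp_all add: swap_vec8_def vec_eq_iff)
  thus ?thesis by (rule linear_conv_bounded_linear[THEN iffD1])
qed

lemma swap_vec8_swap_vec8: "swap_vec8 (swap_vec8 p) = p"
  by (simp add: swap_vec8_def vec_eq_iff)

lemma mv_meromorphic_on_shift_vec8:
  assumes "mv_meromorphic_on F param_domain"
  shows "mv_meromorphic_on (\<lambda>p. F (shift_vec8 c p)) param_domain"
proof (rule mv_meromorphic_on_compose_linear[OF assms bounded_linear_shift_vec8 _ bounded_linear_shift_vec8[of "- c"]])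
  show "shift_vec8 c (a *s v) = a *s shift_vec8 c v" for a v
    by (simp add: shift_vec8_def vec_eq_iff algebra_simps)
qed (simp_all add: shift_vec8_def vec_eq_iff param_domain_def)

lemma mv_meromorphic_on_swap_vec8:
  assumes "mv_meromorphic_on F param_domain"
  shows "mv_meromorphic_on (\<lambda>p. F (swap_vec8 p)) param_domain"
proof (rule mv_meromorphic_on_compose_linear[OF assms bounded_linear_swap_vec8 _ bounded_linear_swap_vec8])
  show "swap_vec8 (a *s v) = a *s swap_vec8 v" for a v
    by (simp add: swap_vec8_def vec_eq_iff)
qed (simp_all add: swap_vec8_swap_vec8 param_domain_def)

lemma mv_mero_eq_on_swap_vec8:
  assumes "mv_mero_eq_on param_domain F G"
  shows "mv_mero_eq_on param_domain (\<lambda>p. F (swap_vec8 p)) (\<lambda>p. G (swap_vec8 p))"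
proof -
  obtain U where U: "open U" "U \<subseteq> param_domain" "param_domain \<subseteq> closure U" "\<forall>p\<in>U. F p = G p"
    using assms unfolding mv_mero_eq_on_def by blast
  have img: "swap_vec8 -` A = swap_vec8 ` A" for A
    by (auto simp: swap_vec8_swap_vec8 image_iff) (metis swap_vec8_swap_vec8)
  have dom: "swap_vec8 ` param_domain = param_domain"
    by (subst img[symmetric]) (auto simp: param_domain_def)
  have "continuous_on UNIV swap_vec8"
    by (rule linear_continuous_on[OF bounded_linear_swap_vec8])
  hence "open (swap_vec8 -` U)" using U(1) by (intro open_vimage)
  moreover have "swap_vec8 -` U \<subseteq> param_domain"
    unfolding img using image_mono[OF U(2), of swap_vec8] dom by simp
  moreover have "param_domain \<subseteq> closure (swap_vec8 -` U)"
  proof -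
    have "swap_vec8 ` param_domain \<subseteq> swap_vec8 ` closure U" using U(3) by (rule image_mono)
    also have "\<dots> \<subseteq> closure (swap_vec8 ` U)"
      by (rule closure_bounded_linear_image_subset[OF bounded_linear_swap_vec8])
    finally show ?thesis unfolding dom img .
  qed
  ultimately show ?thesis
    unfolding mv_mero_eq_on_def using U(4) by (intro exI[of _ "swap_vec8 -` U"]) simp
qed

text \<open>Swapping the periods in psi yields a function that again satisfies
  \<open>is_psi\<close>. The first equation applies to it as it stands, without comparing it with
  the original psi.\<close>

definition swap_periods :: "fun8 \<Rightarrow> fun8" where
  "swap_periods F w1 w2 = F w2 w1"

lemma on_vec8_swap_periods: "on_vec8 (swap_periods F) p = on_vec8 F (swap_vec8 p)"
  by (simp add: on_vec8_def swap_periods_def)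

text \<open>In \<open>is_psi\<close> the type constraint reaches \<open>w\<^sub>2\<close> only; \<open>w\<^sub>1\<close> is a complex number that
  is positive in the order of \<open>Complex_Order\<close>, that is, a positive real.\<close>

lemma is_psi_iff:
  "is_psi \<psi> \<longleftrightarrow> mv_meromorphic_on (on_vec8 \<psi>) param_domain \<and>
     (\<forall>(w1 :: real) (w2 :: real). \<forall>\<rho> \<sigma> \<tau> \<upsilon> x l.
        (0 :: real) < w1 \<longrightarrow> (0 :: real) < w2 \<longrightarrow> \<bar>Im x\<bar> < zeta_bound w1 w2 \<rho> \<sigma> \<tau> \<upsilon> l \<longrightarrow>
        \<psi> w1 w2 \<rho> \<sigma> \<tau> \<upsilon> x l = psi_integral w1 w2 \<rho> \<sigma> \<tau> \<upsilon> x l)" (is "_ \<longleftrightarrow> _ \<and> ?R")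
proof -
  have pos: "(0::complex) < w \<longleftrightarrow> (\<exists>r::real. w = of_real r \<and> 0 < r)" for w
    by (auto simp: less_complex_def complex_eq_iff)
  have zb: "\<bar>a\<bar> < z \<Longrightarrow> 0 < z" for a z :: real by linarith
  have real: "(0::complex) < of_real r \<longleftrightarrow> 0 < r" for r
    by (simp add: less_complex_def)
  show ?thesis
    unfolding is_psi_def real
  proof (intro conj_cong refl iffI allI impI, goal_cases)
    case (1 w1 w2 \<rho> \<sigma> \<tau> \<upsilon> x l)
    have "0 < complex_of_real w1" using 1(3) by (simp only: real)
    with 1(4,5) zb[OF 1(5)] show ?case by (intro 1(2)[rule_format] conjI)
  next
    case (2 w1 w2 \<rho> \<sigma> \<tau> \<upsilon> x l)
    then obtain r :: real where r: "w1 = of_real r" "0 < r" unfolding pos by blast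
    show ?case
      using 2(3) unfolding r(1) by (intro 2(2)[rule_format] r(2)) simp_all
  qed
qed

lemma is_psi_swap_periods:
  assumes "is_psi \<psi>"
  shows "is_psi (swap_periods \<psi>)"
proof -
  have "psi_integral w2 w1 = psi_integral w1 w2" for w1 w2
    by (intro ext) (simp add: psi_integral_def hyp_gamma_commute[of w2 w1] wmean_commute[of w2 w1])
  note psi_comm = this
  have "zeta_bound w2 w1 = zeta_bound w1 w2" for w1 w2
    by (intro ext) (simp add: zeta_bound_def wmean_commute[of w2 w1])
  note zeta_comm = this
  have "mv_meromorphic_on (on_vec8 (swap_periods \<psi>)) param_domain"
    using mv_meromorphic_on_swap_vec8[of "on_vec8 \<psi>"] assms
    by (simp add: is_psi_def on_vec8_swap_periods[abs_def])
  moreover have "swap_periods \<psi> w1 w2 \<rho> \<sigma> \<tau> \<upsilon> x l = psi_integral w1 w2 \<rho> \<sigma> \<tau> \<upsilon> x l"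
    if "(0 :: real) < w1" "(0 :: real) < w2" "\<bar>Im x\<bar> < zeta_bound w1 w2 \<rho> \<sigma> \<tau> \<upsilon> l" for w1 w2 :: real and \<rho> \<sigma> \<tau> \<upsilon> x l
    using assms that unfolding is_psi_iff swap_periods_def psi_comm[of "of_real w1" "of_real w2"] zeta_comm[of "of_real w1" "of_real w2"]
    by blast
  ultimately show ?thesis unfolding is_psi_iff by blast
qed

lemma S_fun_swap_periods: "S_fun (swap_periods \<psi>) w1 w2 = S_fun \<psi> w2 w1"
proof -
  have "Delta_fun w2 w1 = Delta_fun w1 w2" "N_fun w2 w1 = N_fun w1 w2"
    by (intro ext; simp add: Delta_fun_def N_fun_def hyp_gamma_commute[of w2 w1] wmean_commute[of w2 w1])+
  thus ?thesis
    by (intro ext) (simp add: S_fun_def swap_periods_def mult.commute[of w2 w1])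
qed

lemma mv_holomorphic_on_qexp:
  assumes "mv_holomorphic_on f param_domain"
  shows "mv_holomorphic_on (\<lambda>p. qexp (p $ 2) (f p)) param_domain"
  unfolding qexp_def
  by (intro mv_holomorphic_intros assms) (auto simp: param_domain_def)

lemma Im_qexp_pos:
  assumes "0 < t" "2 * t < w"
  shows "Im (qexp (of_real w) (\<i> * of_real t)) > 0"
proof -
  have "2 * of_real pi * (\<i> * of_real t) / of_real w = \<i> * complex_of_real (2 * pi * t / w)"
    by simp
  hence "qexp (of_real w) (\<i> * of_real t) = cis (2 * pi * t / w)"
    unfolding qexp_def cis_conv_exp by (rule arg_cong)
  moreover have "0 < 2 * pi * t / w" "2 * pi * t / w < pi" using assms by (simp_all add: field_simps)
  ultimately show ?thesis by (simp add: sin_gt_zero)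
qed

text \<open>For these arguments \<open>qexp\<close> lies on the open upper half of the unit circle,
  away from 1 and -1.\<close>

lemma qexp_neq:
  assumes "0 < t" "2 * t < w" "u = \<i> * of_real t"
  shows "1 + qexp (of_real w) u \<noteq> 0" "1 - qexp (of_real w) u \<noteq> 0" "1 - qexp (of_real w) (- u) \<noteq> 0"
proof -
  have I: "Im (qexp (of_real w) u) > 0" using Im_qexp_pos[OF assms(1,2)] assms(3) by simp
  show "1 + qexp (of_real w) u \<noteq> 0"
  proof
    assume "1 + qexp (of_real w) u = 0"
    hence "Im (1 + qexp (of_real w) u) = 0" by simp
    with I show False by simp
  qed
  show "1 - qexp (of_real w) u \<noteq> 0"
  proof
    assume "1 - qexp (of_real w) u = 0"
    hence "Im (1 - qexp (of_real w) u) = 0" by simp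
    with I show False by simp
  qed
  thus "1 - qexp (of_real w) (- u) \<noteq> 0" by (simp add: qexp_minus)
qed

section \<open>The three-term relation as a meromorphic function of all eight parameters\<close>

lemma gamma_par_simps:
  "gamma_par \<rho> \<sigma> \<tau> \<upsilon> 0 = - \<rho> + \<sigma>" "gamma_par \<rho> \<sigma> \<tau> \<upsilon> 1 = \<rho> + \<sigma>"
  "gamma_par \<rho> \<sigma> \<tau> \<upsilon> 2 = - \<tau> - \<upsilon>" "gamma_par \<rho> \<sigma> \<tau> \<upsilon> 3 = \<tau> - \<upsilon>"
  by (simp_all add: gamma_par_def)

abbreviation gamma_vec8 :: "complex ^ 8 \<Rightarrow> nat \<Rightarrow> complex" where
  "gamma_vec8 p \<equiv> gamma_par (p $ 3) (p $ 4) (p $ 5) (p $ 6)"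

definition AW_den :: "complex ^ 8 \<Rightarrow> complex \<Rightarrow> complex" where
  "AW_den p x = (1 - qexp (p $ 2) (2 * x)) * (1 - qexp (p $ 2) (2 * x + \<i> * p $ 1))"

definition AW_relation :: "fun8 \<Rightarrow> complex ^ 8 \<Rightarrow> complex" where
  "AW_relation \<psi> p =
     AW_up (p $ 1) (p $ 2) (gamma_vec8 p) (p $ 7) * on_vec8 \<psi> (shift_vec8 \<i> p) +
     AW_down (p $ 1) (p $ 2) (gamma_vec8 p) (p $ 7) * on_vec8 \<psi> (shift_vec8 (- \<i>) p) -
     (AW_coeff (p $ 1) (p $ 2) (gamma_vec8 p) (p $ 7) + AW_coeff (p $ 1) (p $ 2) (gamma_vec8 p) (- p $ 7) +
      AW_eigenvalue (p $ 1) (p $ 2) (gamma_vec8 p) (p $ 8)) * on_vec8 \<psi> p"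

lemma mv_holomorphic_on_gamma_vec8:
  "mv_holomorphic_on (\<lambda>p. gamma_vec8 p 0) D" "mv_holomorphic_on (\<lambda>p. gamma_vec8 p 1) D"
  "mv_holomorphic_on (\<lambda>p. gamma_vec8 p 2) D" "mv_holomorphic_on (\<lambda>p. gamma_vec8 p 3) D"
  "mv_holomorphic_on (\<lambda>p. dual_par (gamma_vec8 p) 0) D"
  unfolding gamma_par_simps dual_par_0_gamma_par by (rule mv_holomorphic_intros)+

lemma mv_holomorphic_on_AW_den:
  "mv_holomorphic_on f param_domain \<Longrightarrow> mv_holomorphic_on (\<lambda>p. AW_den p (f p)) param_domain"
  unfolding AW_den_def by (intro mv_holomorphic_intros mv_holomorphic_on_qexp)

text \<open>Multiplying the relation by the denominators of its coefficients makes these holomorphic on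
  the whole domain.\<close>

lemma AW_relation_cleared_meromorphic:
  assumes "mv_meromorphic_on (on_vec8 \<psi>) param_domain"
  obtains F where "mv_meromorphic_on F param_domain"
    "\<And>p. p \<in> param_domain \<Longrightarrow> AW_den p (p $ 7) \<noteq> 0 \<Longrightarrow> AW_den p (- p $ 7) \<noteq> 0 \<Longrightarrow>
       F p = AW_den p (p $ 7) * AW_den p (- p $ 7) * AW_relation \<psi> p"
proof -
  define b where "b = (\<lambda>(p :: complex ^ 8) u. 1 + qexp (p $ 2) u)"
  define up where "up = (\<lambda>p. qexp (p $ 2) (\<i> * dual_par (gamma_vec8 p) 0) *
     (b p (p $ 7 + \<i> * p $ 1 / 2 + \<i> * gamma_vec8 p 0) * b p (p $ 7 + \<i> * p $ 1 / 2 - \<i> * gamma_vec8 p 0) *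
      b p (p $ 7 + \<i> * p $ 1 / 2 + \<i> * gamma_vec8 p 1) * b p (p $ 7 + \<i> * p $ 1 / 2 - \<i> * gamma_vec8 p 1)))"
  define down where "down = (\<lambda>p. qexp (p $ 2) (\<i> * dual_par (gamma_vec8 p) 0) *
     (b p (\<i> * p $ 1 / 2 - p $ 7 + \<i> * gamma_vec8 p 3) * b p (\<i> * p $ 1 / 2 - p $ 7 - \<i> * gamma_vec8 p 3) *
      b p (\<i> * p $ 1 / 2 - p $ 7 - \<i> * gamma_vec8 p 2) * b p (\<i> * p $ 1 / 2 - p $ 7 + \<i> * gamma_vec8 p 2)))"
  define A where "A = (\<lambda>(p :: complex ^ 8) x.
     b p (x + \<i> * p $ 1 / 2 + \<i> * gamma_vec8 p 0) * b p (x + \<i> * p $ 1 / 2 + \<i> * gamma_vec8 p 1) *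
     b p (x + \<i> * p $ 1 / 2 + \<i> * gamma_vec8 p 2) * b p (x + \<i> * p $ 1 / 2 + \<i> * gamma_vec8 p 3))"
  define v where "v = (\<lambda>p :: complex ^ 8. AW_eigenvalue (p $ 1) (p $ 2) (gamma_vec8 p) (p $ 8))"
  define P0 where "P0 = (\<lambda>p. - (AW_den p (- p $ 7) * A p (p $ 7) + AW_den p (p $ 7) * A p (- p $ 7) +
      v p * (AW_den p (p $ 7) * AW_den p (- p $ 7))))"
  define F where "F = (\<lambda>p. (AW_den p (- p $ 7) * up p) * on_vec8 \<psi> (shift_vec8 \<i> p) +
     (AW_den p (p $ 7) * down p) * on_vec8 \<psi> (shift_vec8 (- \<i>) p) + P0 p * on_vec8 \<psi> p)"
  have b: "mv_holomorphic_on (\<lambda>p. b p (f p)) param_domain" if "mv_holomorphic_on f param_domain" for f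
    unfolding b_def by (intro mv_holomorphic_intros mv_holomorphic_on_qexp that)
  have half: "mv_holomorphic_on (\<lambda>p :: complex ^ 8. \<i> * p $ 1 / 2) param_domain"
    by (intro mv_holomorphic_intros) simp
  note intros = mv_holomorphic_on_gamma_vec8 half mv_holomorphic_on_AW_den b mv_holomorphic_on_qexp
    mv_holomorphic_on_component mv_holomorphic_on_const mv_holomorphic_on_minus mv_holomorphic_on_mult
    mv_holomorphic_on_diff mv_holomorphic_on_add
  have up: "mv_holomorphic_on up param_domain" unfolding up_def by (intro intros)
  have down: "mv_holomorphic_on down param_domain" unfolding down_def by (intro intros)
  have v: "mv_holomorphic_on v param_domain" unfolding v_def AW_eigenvalue_eq_qexp by (intro intros)
  have A: "mv_holomorphic_on (\<lambda>p. A p (p $ 7)) param_domain" "mv_holomorphic_on (\<lambda>p. A p (- p $ 7)) param_domain"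
    unfolding A_def by (intro intros)+
  have P0: "mv_holomorphic_on P0 param_domain"
    unfolding P0_def by (intro intros A v)
  have "mv_meromorphic_on F param_domain"
    unfolding F_def
    by (intro mv_meromorphic_on_add mv_meromorphic_on_mult mv_meromorphic_on_shift_vec8 assms
        mv_holomorphic_imp_meromorphic_on open_param_domain mv_holomorphic_on_mult mv_holomorphic_on_AW_den
        mv_holomorphic_on_component mv_holomorphic_on_minus up down P0)
  moreover have "F p = AW_den p (p $ 7) * AW_den p (- p $ 7) * AW_relation \<psi> p"
    if p: "p \<in> param_domain" and nz: "AW_den p (p $ 7) \<noteq> 0" "AW_den p (- p $ 7) \<noteq> 0" for p
  proof -
    have w2: "p $ 2 \<noteq> 0" using p by (auto simp: param_domain_def)
    have "AW_up (p $ 1) (p $ 2) (gamma_vec8 p) (p $ 7) = up p / AW_den p (p $ 7)"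
      by (simp add: AW_up_def up_def b_def AW_den_def)
    moreover have "AW_down (p $ 1) (p $ 2) (gamma_vec8 p) (p $ 7) = down p / AW_den p (- p $ 7)"
      by (simp add: AW_down_def down_def b_def AW_den_def)
    moreover have "AW_coeff (p $ 1) (p $ 2) (gamma_vec8 p) x = A p x / AW_den p x" for x
      unfolding AW_coeff_eq_qexp[OF w2] A_def b_def AW_den_def ..
    moreover have "D' * u * f + D * d * g + - (D' * a + D * a' + e * (D * D')) * h =
        D * D' * (u / D * f + d / D' * g - (a / D + a' / D' + e) * h)"
      if "D \<noteq> 0" "D' \<noteq> 0" for D D' u f d g a a' e h :: complex
      using that by (simp add: field_simps)
    ultimately show ?thesis
      using nz by (simp only: F_def P0_def AW_relation_def v_def)
  qed
  ultimately show thesis by (rule that)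
qed

lemma zeta_bound_of_real:
  "zeta_bound (of_real w1) (of_real w2) (of_real \<rho>) (of_real \<sigma>) (of_real \<tau>) (of_real \<upsilon>) (\<i> * of_real l) =
     (w1 + w2) / 4 - Max {\<bar>\<rho>\<bar>, \<bar>\<sigma>\<bar>, \<bar>\<tau>\<bar>, \<bar>\<upsilon>\<bar>} - \<bar>l\<bar> / 2"
  by (simp add: zeta_bound_def wmean_def)

text \<open>Only those real and imaginary parts are constrained that remain free on the totally real
  subspace, which makes the set open. On that subspace the conditions become the hypotheses of
  \<open>psi_integral_AW_relation\<close>.\<close>

definition AW_box :: "(complex ^ 8) set" where
  "AW_box = {p. 0 < Re (p $ 1) \<and> 20 * Re (p $ 1) < Re (p $ 2) \<and> 10 * \<bar>Re (p $ 3)\<bar> < Re (p $ 1) \<and>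
     10 * \<bar>Re (p $ 4)\<bar> < Re (p $ 1) \<and> 10 * \<bar>Re (p $ 5)\<bar> < Re (p $ 1) \<and> 10 * \<bar>Re (p $ 6)\<bar> < Re (p $ 1) \<and>
     0 < Im (p $ 7) \<and> 10 * Im (p $ 7) < Re (p $ 1) \<and> 10 * \<bar>Im (p $ 8)\<bar> < Re (p $ 1)}"

lemma open_AW_box: "open AW_box"
  unfolding AW_box_def Collect_conj_eq
  by (intro open_Int open_Collect_less continuous_intros)

lemma AW_relation_on_box:
  assumes psi: "is_psi \<psi>" and p: "p \<in> AW_box" "p \<in> tot_real {7, 8}"
  shows "AW_den p (p $ 7) \<noteq> 0" "AW_den p (- p $ 7) \<noteq> 0" "AW_relation \<psi> p = 0"
proof -
  obtain w1 w2 \<rho> \<sigma> \<tau> \<upsilon> x l :: real where eq: "p $ 1 = of_real w1" "p $ 2 = of_real w2" "p $ 3 = of_real \<rho>"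
    "p $ 4 = of_real \<sigma>" "p $ 5 = of_real \<tau>" "p $ 6 = of_real \<upsilon>" "p $ 7 = \<i> * of_real x" "p $ 8 = \<i> * of_real l"
  proof
    have t: "if i = 7 \<or> i = 8 then Re (p $ i) = 0 else Im (p $ i) = 0" for i :: 8
      using p(2) by (simp add: tot_real_def)
    show "p $ 1 = of_real (Re (p $ 1))" "p $ 2 = of_real (Re (p $ 2))" "p $ 3 = of_real (Re (p $ 3))"
      "p $ 4 = of_real (Re (p $ 4))" "p $ 5 = of_real (Re (p $ 5))" "p $ 6 = of_real (Re (p $ 6))"
      "p $ 7 = \<i> * of_real (Im (p $ 7))" "p $ 8 = \<i> * of_real (Im (p $ 8))"
      using t[of 1] t[of 2] t[of 3] t[of 4] t[of 5] t[of 6] t[of 7] t[of 8] by (simp_all add: complex_eq_iff)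
  qed
  have bounds: "0 < w1" "20 * w1 < w2" "10 * \<bar>\<rho>\<bar> < w1" "10 * \<bar>\<sigma>\<bar> < w1" "10 * \<bar>\<tau>\<bar> < w1" "10 * \<bar>\<upsilon>\<bar> < w1"
    "0 < x" "10 * x < w1" "10 * \<bar>l\<bar> < w1"
    using p(1) by (simp_all add: AW_box_def eq)
  have "2 * p $ 7 = \<i> * of_real (2 * x)" "2 * p $ 7 + \<i> * p $ 1 = \<i> * of_real (2 * x + w1)"
    "2 * (- p $ 7) + \<i> * p $ 1 = \<i> * of_real (w1 - 2 * x)"
    by (simp_all add: eq algebra_simps)
  note e = this
  have "0 < 2 * x" "2 * (2 * x) < w2" "0 < 2 * x + w1" "2 * (2 * x + w1) < w2" "0 < w1 - 2 * x" "2 * (w1 - 2 * x) < w2"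
    using bounds(1,2,7,8) by argo+
  note r = this
  show "AW_den p (p $ 7) \<noteq> 0"
    using qexp_neq(2)[OF r(1,2) e(1)] qexp_neq(2)[OF r(3,4) e(2)] by (simp add: AW_den_def eq(2))
  show "AW_den p (- p $ 7) \<noteq> 0"
    using qexp_neq(3)[OF r(1,2) e(1)] qexp_neq(2)[OF r(5,6) e(3)] by (simp add: AW_den_def eq(2))
  have val: "\<psi> w1 w2 \<rho> \<sigma> \<tau> \<upsilon> (\<i> * of_real y) (\<i> * of_real l) = psi_integral w1 w2 \<rho> \<sigma> \<tau> \<upsilon> (\<i> * of_real y) (\<i> * of_real l)"
    if "\<bar>y\<bar> \<le> x + w1" for y
  proof -
    have w2: "0 < w2" using bounds by linarith
    have 1: "Max {\<bar>\<rho>\<bar>, \<bar>\<sigma>\<bar>, \<bar>\<tau>\<bar>, \<bar>\<upsilon>\<bar>} < w1 / 10" using bounds by (subst Max_less_iff) auto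
    \<comment> \<open>Room for the shifted points: w/2 exceeds 5 w1, while |y|, the parameters and
      l/2 together take less than 11/10 + 1/10 + 1/20 of w1.\<close>
    have 2: "5 * w1 < (w1 + w2) / 4" using bounds(1,2) by argo
    have 3: "\<bar>y\<bar> < 11 * w1 / 10" using that bounds(8) by linarith
    have 4: "\<bar>l\<bar> / 2 < w1 / 20" using bounds(9) by linarith
    have rule: "\<bar>a\<bar> < 11 * w1 / 10 \<Longrightarrow> m < w1 / 10 \<Longrightarrow> k < w1 / 20 \<Longrightarrow> 5 * w1 < d \<Longrightarrow> \<bar>a\<bar> < d - m - k"
      for a m k d :: real using bounds(1) by linarith
    have Im: "Im (\<i> * complex_of_real y) = y" by simp
    have "\<bar>Im (\<i> * complex_of_real y)\<bar> < zeta_bound w1 w2 \<rho> \<sigma> \<tau> \<upsilon> (\<i> * of_real l)"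
      unfolding zeta_bound_of_real Im by (rule rule[OF 3 1 4 2])
    thus ?thesis by (rule conjunct2[OF psi[unfolded is_psi_iff], rule_format, OF bounds(1) w2])
  qed
  have "\<psi> w1 w2 \<rho> \<sigma> \<tau> \<upsilon> (\<i> * of_real x + \<i> * of_real w1) (\<i> * of_real l) =
      psi_integral w1 w2 \<rho> \<sigma> \<tau> \<upsilon> (\<i> * of_real x + \<i> * of_real w1) (\<i> * of_real l)"
    "\<psi> w1 w2 \<rho> \<sigma> \<tau> \<upsilon> (\<i> * of_real x - \<i> * of_real w1) (\<i> * of_real l) =
      psi_integral w1 w2 \<rho> \<sigma> \<tau> \<upsilon> (\<i> * of_real x - \<i> * of_real w1) (\<i> * of_real l)"
    "\<psi> w1 w2 \<rho> \<sigma> \<tau> \<upsilon> (\<i> * of_real x) (\<i> * of_real l) = psi_integral w1 w2 \<rho> \<sigma> \<tau> \<upsilon> (\<i> * of_real x) (\<i> * of_real l)"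
    using val[of "x + w1"] val[of "x - w1"] val[of x] bounds(1,7) by (simp_all add: distrib_left right_diff_distrib)
  with psi_integral_AW_relation[OF bounds] show "AW_relation \<psi> p = 0"
    by (simp add: AW_relation_def on_vec8_def eq)
qed

lemma AW_relation_dense:
  assumes psi: "is_psi \<psi>"
  obtains U where "open U" "U \<subseteq> param_domain" "param_domain \<subseteq> closure U"
    "\<And>p. p \<in> U \<Longrightarrow> AW_den p (p $ 7) \<noteq> 0 \<Longrightarrow> AW_den p (- p $ 7) \<noteq> 0 \<Longrightarrow> AW_relation \<psi> p = 0"
proof -
  have mero: "mv_meromorphic_on (on_vec8 \<psi>) param_domain"
    using psi by (simp add: is_psi_def)
  obtain F where F: "mv_meromorphic_on F param_domain"
    "\<And>p. p \<in> param_domain \<Longrightarrow> AW_den p (p $ 7) \<noteq> 0 \<Longrightarrow> AW_den p (- p $ 7) \<noteq> 0 \<Longrightarrow>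
       F p = AW_den p (p $ 7) * AW_den p (- p $ 7) * AW_relation \<psi> p"
    by (rule AW_relation_cleared_meromorphic[OF mero]) blast
  \<comment> \<open>A starting point in the box and in the subspace; x is nonzero because the
    coefficients are singular at x = 0.\<close>
  define p0 :: "complex ^ 8" where "p0 = (\<chi> i. if i = 1 then 1 else if i = 2 then 40 else if i = 7 then \<i> / 20 else 0)"
  have box: "p \<in> param_domain" if "p \<in> AW_box" for p
    using that by (auto simp: AW_box_def param_domain_def)
  have p0: "p0 \<in> AW_box" "p0 \<in> tot_real {7, 8}"
    by (simp_all add: AW_box_def tot_real_def p0_def)
  have zero: "F p = 0" if "p \<in> AW_box" "p \<in> tot_real {7, 8}" for p
    using F(2)[OF box[OF that(1)] AW_relation_on_box(1,2)[OF psi that]] AW_relation_on_box(3)[OF psi that] by simp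
  obtain U where U: "open U" "U \<subseteq> param_domain" "param_domain \<subseteq> closure U" "\<And>p. p \<in> U \<Longrightarrow> F p = 0"
    using mv_meromorphic_on_vanish[OF F(1) open_param_domain convex_connected[OF convex_param_domain]
        box[OF p0(1)] p0(2) open_AW_box p0(1) zero] by metis
  show thesis
  proof (rule that[OF U(1-3)])
    fix p assume p: "p \<in> U" "AW_den p (p $ 7) \<noteq> 0" "AW_den p (- p $ 7) \<noteq> 0"
    have "p \<in> param_domain" using p(1) U(2) by blast
    from F(2)[OF this p(2,3)] U(4)[OF p(1)] p(2,3) show "AW_relation \<psi> p = 0" by simp
  qed
qed

text \<open>The zeros of this function are the points at which a denominator of the operator vanishes or
  a quotient of two shifted weights degenerates.\<close>

definition AW_generic :: "complex ^ 8 \<Rightarrow> complex" where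
  "AW_generic p = AW_den p (p $ 7) * AW_den p (- p $ 7) *
     ((1 + qexp (p $ 2) (p $ 7 + \<i> * p $ 1 / 2 - \<i> * gamma_vec8 p 0)) *
      (1 + qexp (p $ 2) (p $ 7 + \<i> * p $ 1 / 2 - \<i> * gamma_vec8 p 1)) *
      (1 + qexp (p $ 2) (p $ 7 + \<i> * p $ 1 / 2 + \<i> * gamma_vec8 p 2)) *
      (1 + qexp (p $ 2) (p $ 7 + \<i> * p $ 1 / 2 + \<i> * gamma_vec8 p 3))) *
     ((1 + qexp (p $ 2) (\<i> * p $ 1 / 2 - p $ 7 + \<i> * gamma_vec8 p 0)) *
      (1 + qexp (p $ 2) (\<i> * p $ 1 / 2 - p $ 7 + \<i> * gamma_vec8 p 1)) *
      (1 + qexp (p $ 2) (\<i> * p $ 1 / 2 - p $ 7 - \<i> * gamma_vec8 p 2)) *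
      (1 + qexp (p $ 2) (\<i> * p $ 1 / 2 - p $ 7 - \<i> * gamma_vec8 p 3)))"

lemma AW_generic_dense:
  "open {p \<in> param_domain. AW_generic p \<noteq> 0}" "param_domain \<subseteq> closure {p \<in> param_domain. AW_generic p \<noteq> 0}"
proof -
  have half: "mv_holomorphic_on (\<lambda>p :: complex ^ 8. \<i> * p $ 1 / 2) param_domain"
    by (intro mv_holomorphic_intros) simp
  have hol: "mv_holomorphic_on AW_generic param_domain"
    unfolding AW_generic_def
    by (intro mv_holomorphic_on_gamma_vec8 half mv_holomorphic_on_AW_den mv_holomorphic_on_qexp
        mv_holomorphic_on_component mv_holomorphic_on_const mv_holomorphic_on_minus mv_holomorphic_on_mult
        mv_holomorphic_on_diff mv_holomorphic_on_add)
  define p0 :: "complex ^ 8" where "p0 = (\<chi> i. if i = 1 then 1 else if i = 2 then 40 else if i = 7 then \<i> / 20 else 0)"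
  have c: "p0 $ 1 = 1" "p0 $ 2 = of_real 40" "p0 $ 7 = \<i> / 20" "p0 $ 3 = 0" "p0 $ 4 = 0" "p0 $ 5 = 0" "p0 $ 6 = 0"
    by (simp_all add: p0_def)
  have g: "gamma_vec8 p0 0 = 0" "gamma_vec8 p0 1 = 0" "gamma_vec8 p0 2 = 0" "gamma_vec8 p0 3 = 0"
    by (simp_all only: gamma_par_simps c) simp_all
  have e: "2 * (\<i> / 20) = \<i> * of_real (1 / 10)" "2 * (\<i> / 20) + \<i> * 1 = \<i> * of_real (11 / 10)"
    "2 * (- (\<i> / 20)) = - (2 * (\<i> / 20))" "2 * (- (\<i> / 20)) + \<i> * 1 = \<i> * of_real (9 / 10)"
    by (simp_all add: complex_eq_iff)
  have D: "AW_den p0 (p0 $ 7) \<noteq> 0" "AW_den p0 (- p0 $ 7) \<noteq> 0"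
    unfolding AW_den_def c mult_eq_0_iff de_Morgan_disj
    using qexp_neq(2)[OF _ _ e(1), of 40] qexp_neq(2)[OF _ _ e(2), of 40]
      qexp_neq(3)[OF _ _ e(1), of 40] qexp_neq(2)[OF _ _ e(4), of 40] unfolding e(3) by simp_all
  have B: "1 + qexp (of_real 40) (\<i> / 20 + \<i> * 1 / 2) \<noteq> 0" "1 + qexp (of_real 40) (\<i> * 1 / 2 - \<i> / 20) \<noteq> 0"
    by (rule qexp_neq(1)[of "11 / 20"] qexp_neq(1)[of "9 / 20"]; simp add: complex_eq_iff)+
  have "AW_generic p0 \<noteq> 0"
    using D B by (simp only: AW_generic_def g c(1,2,3)) simp
  moreover have "p0 \<in> param_domain" by (simp add: param_domain_def c(1,2))
  ultimately show "open {p \<in> param_domain. AW_generic p \<noteq> 0}" "param_domain \<subseteq> closure {p \<in> param_domain. AW_generic p \<noteq> 0}"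
    using mv_holomorphic_on_dense_nonzero[OF hol open_param_domain convex_param_domain] by blast+
qed

text \<open>The relation for psi holds on one dense open set, off the zeros of its denominators, and
  the identities for the weight hold on another that avoids those zeros. The intersection is still
  open and dense.\<close>

lemma AW_op_S_fun_mero_eq:
  assumes psi: "is_psi \<psi>"
  shows "mv_mero_eq_on param_domain
     (on_vec8 (\<lambda>w1 w2 \<rho> \<sigma> \<tau> \<upsilon> x l.
        AW_op w1 w2 (gamma_par \<rho> \<sigma> \<tau> \<upsilon>) (\<lambda>y. S_fun \<psi> w1 w2 \<rho> \<sigma> \<tau> \<upsilon> y l) x))
     (on_vec8 (\<lambda>w1 w2 \<rho> \<sigma> \<tau> \<upsilon> x l.
        AW_eigenvalue w1 w2 (gamma_par \<rho> \<sigma> \<tau> \<upsilon>) l * S_fun \<psi> w1 w2 \<rho> \<sigma> \<tau> \<upsilon> x l))"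
proof -
  obtain U where U: "open U" "U \<subseteq> param_domain" "param_domain \<subseteq> closure U"
    "\<And>p. p \<in> U \<Longrightarrow> AW_den p (p $ 7) \<noteq> 0 \<Longrightarrow> AW_den p (- p $ 7) \<noteq> 0 \<Longrightarrow> AW_relation \<psi> p = 0"
    by (rule AW_relation_dense[OF psi]) blast
  define V where "V = {p \<in> param_domain. AW_generic p \<noteq> 0 \<and> p \<in> U}"
  have UV: "{p \<in> param_domain. p \<in> U} = U" using U(2) by blast
  have dense: "param_domain \<subseteq> closure V"
    unfolding V_def
    by (rule dense_open_Int[OF open_param_domain AW_generic_dense(2,1)]) (simp add: UV U(3))
  have "V = {p \<in> param_domain. AW_generic p \<noteq> 0} \<inter> U" by (auto simp: V_def)
  hence "open V" using open_Int[OF AW_generic_dense(1) U(1)] by simp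
  moreover have "V \<subseteq> param_domain" by (auto simp: V_def)
  moreover have "AW_op (p $ 1) (p $ 2) (gamma_vec8 p) (\<lambda>y. S_fun \<psi> (p $ 1) (p $ 2) (p $ 3) (p $ 4) (p $ 5) (p $ 6) y (p $ 8)) (p $ 7) =
      AW_eigenvalue (p $ 1) (p $ 2) (gamma_vec8 p) (p $ 8) * S_fun \<psi> (p $ 1) (p $ 2) (p $ 3) (p $ 4) (p $ 5) (p $ 6) (p $ 7) (p $ 8)"
    if p: "p \<in> V" for p
  proof (rule AW_op_S_fun_eq)
    have w: "Re (p $ 1) > 0" "Re (p $ 2) > 0" and gen: "AW_generic p \<noteq> 0" and pU: "p \<in> U"
      using p by (auto simp: V_def param_domain_def)
    show "AW_coeff (p $ 1) (p $ 2) (gamma_vec8 p) (p $ 7) / Delta_fun (p $ 1) (p $ 2) (gamma_vec8 p) (p $ 7 + \<i> * p $ 1) =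
        AW_up (p $ 1) (p $ 2) (gamma_vec8 p) (p $ 7) / Delta_fun (p $ 1) (p $ 2) (gamma_vec8 p) (p $ 7)"
      using gen by (intro AW_coeff_divide_Delta_up w) (simp_all only: AW_generic_def mult_eq_0_iff de_Morgan_disj simp_thms)
    show "AW_coeff (p $ 1) (p $ 2) (gamma_vec8 p) (- p $ 7) / Delta_fun (p $ 1) (p $ 2) (gamma_vec8 p) (p $ 7 - \<i> * p $ 1) =
        AW_down (p $ 1) (p $ 2) (gamma_vec8 p) (p $ 7) / Delta_fun (p $ 1) (p $ 2) (gamma_vec8 p) (p $ 7)"
      using gen by (intro AW_coeff_divide_Delta_down w) (simp_all only: AW_generic_def mult_eq_0_iff de_Morgan_disj simp_thms)
    have "AW_relation \<psi> p = 0"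
      using gen by (intro U(4) pU) (simp_all only: AW_generic_def mult_eq_0_iff de_Morgan_disj simp_thms)
    thus "AW_up (p $ 1) (p $ 2) (gamma_vec8 p) (p $ 7) * \<psi> (p $ 1) (p $ 2) (p $ 3) (p $ 4) (p $ 5) (p $ 6) (p $ 7 + \<i> * p $ 1) (p $ 8) +
        AW_down (p $ 1) (p $ 2) (gamma_vec8 p) (p $ 7) * \<psi> (p $ 1) (p $ 2) (p $ 3) (p $ 4) (p $ 5) (p $ 6) (p $ 7 - \<i> * p $ 1) (p $ 8) =
        (AW_coeff (p $ 1) (p $ 2) (gamma_vec8 p) (p $ 7) + AW_coeff (p $ 1) (p $ 2) (gamma_vec8 p) (- p $ 7) +
         AW_eigenvalue (p $ 1) (p $ 2) (gamma_vec8 p) (p $ 8)) * \<psi> (p $ 1) (p $ 2) (p $ 3) (p $ 4) (p $ 5) (p $ 6) (p $ 7) (p $ 8)"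
      by (simp add: AW_relation_def on_vec8_def)
  qed
  ultimately show ?thesis
    unfolding mv_mero_eq_on_def on_vec8_def using dense by blast
qed

theorem theorem6p4:
  fixes \<psi> :: fun8
  assumes psi: "is_psi \<psi>"
  shows "mv_mero_eq_on param_domain
           (on_vec8 (\<lambda>w1 w2 \<rho> \<sigma> \<tau> \<upsilon> x l.
              AW_op w1 w2 (gamma_par \<rho> \<sigma> \<tau> \<upsilon>) (\<lambda>y. S_fun \<psi> w1 w2 \<rho> \<sigma> \<tau> \<upsilon> y l) x))
           (on_vec8 (\<lambda>w1 w2 \<rho> \<sigma> \<tau> \<upsilon> x l.
              AW_eigenvalue w1 w2 (gamma_par \<rho> \<sigma> \<tau> \<upsilon>) l * S_fun \<psi> w1 w2 \<rho> \<sigma> \<tau> \<upsilon> x l))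
       \<and> mv_mero_eq_on param_domain
           (on_vec8 (\<lambda>w1 w2 \<rho> \<sigma> \<tau> \<upsilon> x l.
              AW_op w2 w1 (gamma_par \<rho> \<sigma> \<tau> \<upsilon>) (\<lambda>y. S_fun \<psi> w1 w2 \<rho> \<sigma> \<tau> \<upsilon> y l) x))
           (on_vec8 (\<lambda>w1 w2 \<rho> \<sigma> \<tau> \<upsilon> x l.
              AW_eigenvalue w2 w1 (gamma_par \<rho> \<sigma> \<tau> \<upsilon>) l * S_fun \<psi> w1 w2 \<rho> \<sigma> \<tau> \<upsilon> x l))"
  \<comment> \<open>The second conjunct is the first one for the swapped psi, read after exchanging
    the coordinates of the two periods.\<close>
  using AW_op_S_fun_mero_eq[OF psi] mv_mero_eq_on_swap_vec8[OF AW_op_S_fun_mero_eq[OF is_psi_swap_periods[OF psi]]]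
  by (simp add: S_fun_swap_periods on_vec8_def[abs_def])

end
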